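(* Let $L\subset\mathbf{R}^n$ be an $n$-dimensional lattice, let $H$ be a hyperplane spanning an $(n-1)$-dimensional sub-lattice of $L$ (i.e. $H\cap L$ is an $(n-1)$-dimensional sub-lattice of $L$ whose affine span is $H$), and let $e\in\mathbf{R}^n$ be a unit vector orthogonal to $H$. Let $\{b_i:1\le i\le n\}$ be a basis of $L$, let $f(x)=(\sum_{i=1}^n b_ix_i)^2$ be the corresponding quadratic form, and let $D(f)$ be the $L$-type domain of $f$. Then the following assertions are equivalent: (i) $H$ is a lamina of the Delaunay partition of $L$; (ii) the Voronoi polytope $P_V$ of $L$ has a closed zone $Z_e$ of edges parallel to the vector $e$; (iii) for every $\epsilon>0$, the $\epsilon$-extended along $e$ lattice $L^{\epsilon}$ has the same $L$-type as $L$; (iv) the rank 1 form $f_e(x)=(e,\sum_{i=1}^n b_ix_i)^2$ lies on an extreme ray of the closure of $D(f)$, i.e. $f+\lambda f_e\in D(f)$ for all $\lambda\ge 0$.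
   Context: $(p,q)$ denotes the standard scalar product and $p^2=(p,p)$. The Voronoi polytope $P_V$ of $L$ is the set of points of $\mathbf{R}^n$ at least as close to $0$ as to any other lattice point; its translates by lattice vectors form the Voronoi partition. A sphere is empty if no lattice point lies in its interior; a Delaunay polytope is the convex hull of all lattice points lying on an empty sphere, when this hull is $n$-dimensional; the Delaunay polytopes form the Delaunay partition of $\mathbf{R}^n$, dual to the Voronoi partition (a $k$-face of one is orthogonal to an $(n-k)$-face of the other). The star is the set of Delaunay polytopes having $0$ as a vertex. Two lattices have the same $L$-type if the face posets (faces of all dimensions ordered by inclusion) of their Voronoi polytopes are isomorphic, i.e. their Voronoi (equivalently Delaunay) partitions are combinatorially and topologically equivalent. A quadratic form $g(x)=(\sum b'_ix_i)^2$ (Gram matrix of a basis $b'_i$) is said to be of the $L$-type of its lattice; the $L$-type domain $D(f)$ is the set of positive definite quadratic forms of the same $L$-type as $f$ (with correspondence via the basis), which is an open polyhedral cone in the space of symmetric $n\times n$ matrices. Zones: the edges of $P_V$ are partitioned into classes of mutually parallel edges, called zones; a zone is closed if every two-dimensional face of $P_V$ contains either exactly two edges of the zone or none. Lamina: for a hyperplane $H$ with $H\cap L$ an $(n-1)$-dimensional sub-lattice, $H$ is a lamina of $L$ if every $(n-1)$-dimensional Delaunay polytope of the lattice $L\cap H$ (within $H$) is a facet of a Delaunay polytope of $L$, i.e. $H$ is partitioned into facets of Delaunay polytopes of $L$. $\epsilon$-extension along a unit vector $e$: the linear map sending $v\in\mathbf{R}^n$ to $v'=v+\epsilon(e,v)e$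 (so ${v'}^2=v^2+\epsilon(2+\epsilon)(e,v)^2$); $L^{\epsilon}$ is the image of $L$ under this map. *)

theory Defs
  imports "HOL-Analysis.Analysis"
begin

definition lin_indep_family :: "('n::finite \<Rightarrow> real^'n) \<Rightarrow> bool" where
  "lin_indep_family b \<longleftrightarrow> (\<forall>c. (\<Sum>i\<in>UNIV. c i *\<^sub>R b i) = 0 \<longrightarrow> (\<forall>i. c i = 0))"

definition lattice_of :: "('n::finite \<Rightarrow> real^'n) \<Rightarrow> (real^'n) set" where
  "lattice_of b = range (\<lambda>z::'n \<Rightarrow> int. \<Sum>i\<in>UNIV. of_int (z i) *\<^sub>R b i)"

definition voronoi :: "(real^'n::finite) set \<Rightarrow> (real^'n) set" where
  "voronoi S = {x. \<forall>v\<in>S. norm x \<le> norm (x - v)}"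

definition same_face_poset :: "(real^'n::finite) set \<Rightarrow> (real^'n) set \<Rightarrow> bool" where
  "same_face_poset P Q \<longleftrightarrow> (\<exists>\<phi>. bij_betw \<phi> {F. F face_of P} {G. G face_of Q} \<and>
      (\<forall>F\<in>{F. F face_of P}. \<forall>F'\<in>{F. F face_of P}. F \<subseteq> F' \<longleftrightarrow> \<phi> F \<subseteq> \<phi> F'))"

definition same_Ltype :: "(real^'n::finite) set \<Rightarrow> (real^'n) set \<Rightarrow> bool" where
  "same_Ltype L L' \<longleftrightarrow> same_face_poset (voronoi L) (voronoi L')"

text \<open>Delaunay polytopes of a point set S, with empty-sphere centres taken in the affine
  space A, of dimension k: convex hulls of the points of S on an empty sphere
  (no point of S strictly inside), having dimension k.\<close>
definition delaunay_cells :: "(real^'n::finite) set \<Rightarrow> (real^'n) set \<Rightarrow> int \<Rightarrow> (real^'n) set set" where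
  "delaunay_cells S A k = {P. \<exists>c\<in>A. \<exists>r. (\<forall>x\<in>S. r \<le> dist c x) \<and>
      P = convex hull {x\<in>S. dist c x = r} \<and> aff_dim P = k}"

definition lamina :: "(real^'n::finite) set \<Rightarrow> (real^'n) set \<Rightarrow> bool" where
  "lamina L H \<longleftrightarrow> (\<forall>P\<in>delaunay_cells (L \<inter> H) H (int CARD('n) - 1).
      \<exists>Q\<in>delaunay_cells L UNIV (int CARD('n)). P face_of Q)"

definition edges_of :: "(real^'n::finite) set \<Rightarrow> (real^'n) set set" where
  "edges_of P = {F. F face_of P \<and> aff_dim F = 1}"

definition parallel_to :: "(real^'n::finite) set \<Rightarrow> real^'n \<Rightarrow> bool" where
  "parallel_to F e \<longleftrightarrow> (\<forall>x\<in>F. \<forall>y\<in>F. \<exists>t. x - y = t *\<^sub>R e)"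

definition zone :: "(real^'n::finite) set \<Rightarrow> real^'n \<Rightarrow> (real^'n) set set" where
  "zone P e = {F\<in>edges_of P. parallel_to F e}"

definition has_closed_zone :: "(real^'n::finite) set \<Rightarrow> real^'n \<Rightarrow> bool" where
  "has_closed_zone P e \<longleftrightarrow> zone P e \<noteq> {} \<and>
     (\<forall>G. G face_of P \<and> aff_dim G = 2 \<longrightarrow> card {F\<in>zone P e. F \<subseteq> G} \<in> {0, 2})"

definition extend :: "real \<Rightarrow> real^'n::finite \<Rightarrow> real^'n \<Rightarrow> real^'n" where
  "extend \<epsilon> e v = v + (\<epsilon> * (e \<bullet> v)) *\<^sub>R e"

definition qval :: "real^'n^'n \<Rightarrow> real^'n \<Rightarrow> real" where
  "qval Q x = x \<bullet> (Q *v x)"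

definition pos_def_form :: "real^'n::finite^'n \<Rightarrow> bool" where
  "pos_def_form Q \<longleftrightarrow> transpose Q = Q \<and> (\<forall>x. x \<noteq> 0 \<longrightarrow> 0 < qval Q x)"

definition int_points :: "(real^'n::finite) set" where
  "int_points = {z. \<forall>i. z $ i \<in> \<int>}"

definition delaunay_form :: "real^'n::finite^'n \<Rightarrow> (real^'n) set set" where
  "delaunay_form Q = {P. \<exists>c r. (\<forall>z\<in>int_points. r \<le> qval Q (z - c)) \<and>
      P = convex hull {z\<in>int_points. qval Q (z - c) = r} \<and> aff_dim P = int CARD('n)}"

text \<open>L-type domain of f: positive definite forms with the same L-type as f, the correspondence
  being via the basis (i.e. identical Delaunay partitions in coefficient space).\<close>
definition Ltype_domain :: "real^'n::finite^'n \<Rightarrow> (real^'n^'n) set" where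
  "Ltype_domain f = {g. pos_def_form g \<and> delaunay_form g = delaunay_form f}"

text \<open>Gram matrix of the basis b: f(x) = (\<Sum> b_i x_i)^2.\<close>
definition gram :: "('n::finite \<Rightarrow> real^'n) \<Rightarrow> real^'n^'n" where
  "gram b = (\<chi> i j. b i \<bullet> b j)"

text \<open>Matrix of the rank one form f_e(x) = (e, \<Sum> b_i x_i)^2.\<close>
definition rank_one_form :: "('n::finite \<Rightarrow> real^'n) \<Rightarrow> real^'n \<Rightarrow> real^'n^'n" where
  "rank_one_form b e = (\<chi> i j. (e \<bullet> b i) * (e \<bullet> b j))"

end

(* Everything is reduced to two conditions on the lattice L.

   (a) The Delaunay cells of |v|^2 + t (e.v)^2 do not depend on t >= 0.
   Lamina => (a): a cell lies between two neighbouring translates of H, say alpha <= e.v <= beta, so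
   t (e.v - alpha)(e.v - beta) may be added to its empty-sphere inequality.  Conversely, for large t
   the empty spheres of the section by H are empty in L.  If (a) holds, the Voronoi polytopes
   of all extensions have isomorphic face posets, because a face is determined by the star cells dual to
   its vertices.  Conversely, an isomorphism of face posets preserves the number of vertices, that
   is, of cells in the star; locally the star can only be refined when t moves, and a proper
   refinement would increase this number, so the star is locally constant in t, hence constant.

   (b) Over every vertex of the projection of the Voronoi polytope along e lies a segment, not just a
   point.  This is equivalent to the closed zone for any polytope: two-dimensional faces containing a zone edge
   project onto edges of the projection.  It is equivalent to H being a lamina because both force the
   projection to be the Voronoi polytope of the section by H. *)

theory Submission
  imports Defs
begin

section \<open>Voronoi polytopes of lattices\<close>

text \<open>Stretching along \<open>e\<close> is done on the form. By \<open>extend_norm\<close> the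
  lattice extended by \<epsilon> carries the same data as the fixed lattice with the form
  \<open>qe e t\<close>, t = \<epsilon> (2 + \<epsilon>), so that cells for different
  \<open>t\<close> are subsets of one lattice and can be compared by inclusion. The obstacle is
  (iii): an isomorphism of face posets knows nothing of the lattice and cannot be used to match
  cells, so only a number is extracted from it. A number says little about two distant values of
  \<open>t\<close>. It suffices because neighbouring stars are already related by inclusion, and
  because (iii) speaks of all \<epsilon>, which makes the whole half-line of parameters available.
  The section by \<open>H\<close> spans only a hyperplane. Voronoi polytopes and their dual cells
  are therefore studied relative to \<open>span S\<close>, and the results are applied both to the
  lattice and to its section.\<close>

lemma finite_has_min:
  fixes f :: "'a \<Rightarrow> 'b::linorder"
  assumes "finite A" "A \<noteq> {}"
  shows "\<exists>w\<in>A. \<forall>v\<in>A. f w \<le> f v"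
proof -
  have "Min (f ` A) \<in> f ` A" using assms by (intro Min_in) auto
  then obtain w where w: "w \<in> A" "f w = Min (f ` A)" by auto
  then show ?thesis using assms by (intro bexI[of _ w]) auto
qed

lemma voronoi_iff: "m \<in> voronoi S \<longleftrightarrow> (\<forall>v\<in>S. 2 * (m \<bullet> v) \<le> v \<bullet> v)"
  by (auto simp: voronoi_def norm_le inner_diff_left inner_diff_right inner_commute)

lemma voronoi_eq_INT: "voronoi S = (\<Inter>v\<in>S. {m. (2 *\<^sub>R v) \<bullet> m \<le> v \<bullet> v})"
  by (auto simp: voronoi_iff inner_commute)

lemma convex_voronoi: "convex (voronoi S)"
  unfolding voronoi_eq_INT by (intro convex_INT convex_halfspace_le)

lemma closed_voronoi: "closed (voronoi S)"
  unfolding voronoi_eq_INT by (intro closed_INT ballI closed_halfspace_le)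

text \<open>For \<open>m\<close> in the Voronoi polytope these are the lattice points as near to
  \<open>m\<close> as 0 is: the points on the empty sphere about \<open>m\<close> through 0. The
  origin always belongs to them.\<close>

definition tight :: "(real^'n::finite) set \<Rightarrow> real^'n \<Rightarrow> (real^'n) set" where
  "tight S m = {v\<in>S. 2 * (m \<bullet> v) = v \<bullet> v}"

text \<open>The lattice points on the largest empty sphere about \<open>m\<close>; this form avoids
  mentioning a radius.\<close>

definition nearest :: "(real^'n::finite) set \<Rightarrow> real^'n \<Rightarrow> (real^'n) set" where
  "nearest S m = {v\<in>S. \<forall>w\<in>S. norm (m - v) \<le> norm (m - w)}"

text \<open>The span is left free so that the section of a lattice by a hyperplane is an
  instance.\<close>

locale discrete_lattice =
  fixes S :: "(real^'n::finite) set"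
  assumes zero: "0 \<in> S"
    and diff: "\<And>x y. x \<in> S \<Longrightarrow> y \<in> S \<Longrightarrow> x - y \<in> S"
    and fin: "\<And>r. finite (S \<inter> cball 0 r)"
begin

lemma neg: "x \<in> S \<Longrightarrow> - x \<in> S"
  using diff[OF zero, of x] by simp

lemma add: "x \<in> S \<Longrightarrow> y \<in> S \<Longrightarrow> x + y \<in> S"
  using diff[OF _ neg, of x y] by simp

lemma fin_cball: "finite (S \<inter> cball m r)"
proof (rule finite_subset[OF _ fin[of "norm m + r"]])
  show "S \<inter> cball m r \<subseteq> S \<inter> cball 0 (norm m + r)"
  proof
    fix x assume x: "x \<in> S \<inter> cball m r"
    have "norm x - norm m \<le> norm (m - x)" by (metis norm_minus_commute norm_triangle_ineq2)
    then show "x \<in> S \<inter> cball 0 (norm m + r)" using x by (auto simp: dist_norm)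
  qed
qed

lemma nearest_nonempty: "nearest S m \<noteq> {}"
proof -
  let ?B = "S \<inter> cball m (norm m)"
  have "0 \<in> ?B" by (simp add: zero dist_norm)
  then have ne: "?B \<noteq> {}" by blast
  obtain v where v: "v \<in> ?B" "\<And>w. w \<in> ?B \<Longrightarrow> norm (m - v) \<le> norm (m - w)"
    using finite_has_min[OF fin_cball ne, of "\<lambda>w. norm (m - w)"] by (elim bexE) simp
  have "norm (m - v) \<le> norm (m - w)" if "w \<in> S" for w
    using v that by (cases "w \<in> ?B") (auto simp: dist_norm)
  then show ?thesis using v(1) unfolding nearest_def by blast
qed

text \<open>Only finitely many lattice points compete near \<open>m\<close>, and those that are not
  nearest are farther by a fixed gap, which a small move of the centre cannot close.\<close>

lemma nearest_stable: "\<exists>\<delta>>0. \<forall>m'. dist m' m < \<delta> \<longrightarrow> nearest S m' \<subseteq> nearest S m"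
proof -
  obtain v0 where v0: "v0 \<in> nearest S m" using nearest_nonempty by blast
  let ?r = "norm (m - v0)"
  let ?B = "(S \<inter> cball m (?r + 2)) - nearest S m"
  have finB: "finite ?B" using fin_cball by blast
  have "?r < norm (m - v)" if "v \<in> ?B" for v
  proof (rule ccontr)
    assume "\<not> ?r < norm (m - v)"
    then have "norm (m - v) \<le> norm (m - w)" if "w \<in> S" for w
      using v0 that unfolding nearest_def by force
    then show False using that unfolding nearest_def by blast
  qed
  then obtain \<eta> where eta: "\<eta> > 0" "\<And>v. v \<in> ?B \<Longrightarrow> ?r + \<eta> \<le> norm (m - v)"
  proof (cases "?B = {}")
    case True then show ?thesis using that[of 1] by (metis empty_iff zero_less_one)
  next
    case False
    let ?e = "Min ((\<lambda>v. norm (m - v) - ?r) ` ?B)"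
    have "?e > 0" using finB False \<open>\<And>v. v \<in> ?B \<Longrightarrow> ?r < norm (m - v)\<close>
      by (subst Min_gr_iff) auto
    moreover have "?e \<le> norm (m - v) - ?r" if "v \<in> ?B" for v
      by (rule Min_le) (use finB that in auto)
    ultimately show ?thesis using that[of ?e] by (metis add.commute le_diff_eq)
  qed
  \<comment> \<open>Half the gap, because the distances to \<open>v0\<close> and to \<open>v\<close>
    both change by less than \<delta>; the bound 1 keeps \<open>v\<close> in the ball of radius
    \<open>?r + 2\<close>.\<close>
  define \<delta> where "\<delta> = min 1 (\<eta>/2)"
  have "nearest S m' \<subseteq> nearest S m" if d: "dist m' m < \<delta>" for m'
  proof
    fix v assume v: "v \<in> nearest S m'"
    have vS: "v \<in> S" and "norm (m' - v) \<le> norm (m' - v0)"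
      using v v0 unfolding nearest_def by auto
    moreover have "norm (m' - v0) \<le> dist m' m + ?r"
      by (metis diff_add_cancel add_diff_eq dist_norm norm_triangle_ineq)
    moreover have "norm (m - v) \<le> dist m' m + norm (m' - v)"
      by (metis diff_add_cancel add_diff_eq dist_norm norm_triangle_ineq dist_commute)
    ultimately have le: "norm (m - v) < ?r + 2 * \<delta>" using d by linarith
    then have "v \<in> S \<inter> cball m (?r + 2)" using vS unfolding \<delta>_def by (auto simp: dist_norm)
    moreover have "norm (m - v) < ?r + \<eta>" using le unfolding \<delta>_def by linarith
    ultimately show "v \<in> nearest S m" using eta(2)[of v] by force
  qed
  moreover have "\<delta> > 0" using eta unfolding \<delta>_def by auto
  ultimately show ?thesis by blast
qed

lemma nearest_voronoi: "m \<in> voronoi S \<Longrightarrow> nearest S m = tight S m"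
proof -
  assume m: "m \<in> voronoi S"
  then have "norm m \<le> norm (m - w)" if "w \<in> S" for w using that by (simp add: voronoi_def)
  moreover have "norm (m - v) \<le> norm m \<longleftrightarrow> v \<bullet> v \<le> 2 * (m \<bullet> v)" for v
    by (auto simp: norm_le inner_diff_left inner_diff_right inner_commute)
  moreover have "2 * (m \<bullet> v) \<le> v \<bullet> v" if "v \<in> S" for v
    using that m voronoi_iff by blast
  ultimately have "v \<in> nearest S m \<longleftrightarrow> v \<in> tight S m" for v
    using zero unfolding nearest_def tight_def
    by (auto intro: order_trans) (metis diff_zero order_antisym)+
  then show ?thesis by blast
qed

lemma zero_tight: "0 \<in> tight S m" by (simp add: tight_def zero)

text \<open>Near \<open>m\<close> only the tight constraints can become violated, and moving along
  \<open>d\<close> does not worsen them.\<close>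

lemma voronoi_move:
  assumes "m \<in> voronoi S" "\<And>v. v \<in> tight S m \<Longrightarrow> d \<bullet> v \<le> 0"
  shows "\<exists>\<delta>>0. m + \<delta> *\<^sub>R d \<in> voronoi S"
proof -
  obtain \<delta>0 where d0: "\<delta>0 > 0" "\<And>m'. dist m' m < \<delta>0 \<Longrightarrow> nearest S m' \<subseteq> tight S m"
    using nearest_stable[of m] nearest_voronoi[OF assms(1)] by auto
  have n1: "0 < norm d + 1" by (simp add: add_nonneg_pos)
  define \<delta> where "\<delta> = \<delta>0 / (norm d + 1)"
  have pos: "\<delta> > 0" using d0 n1 by (simp add: \<delta>_def)
  let ?m = "m + \<delta> *\<^sub>R d"
  have "norm (\<delta> *\<^sub>R d) = \<delta>0 * (norm d / (norm d + 1))" using d0(1) n1 unfolding \<delta>_def by simp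
  also have "\<dots> < \<delta>0 * 1" using n1 d0(1) by (intro mult_strict_left_mono) auto
  finally have "norm (\<delta> *\<^sub>R d) < \<delta>0" by simp
  then have "dist ?m m < \<delta>0" by (simp add: dist_norm)
  then have sub: "nearest S ?m \<subseteq> tight S m" using d0 by blast
  \<comment> \<open>One point is enough: if a lattice point nearest to \<open>?m\<close> is no
    nearer than 0, then none is.\<close>
  obtain v where v: "v \<in> nearest S ?m" using nearest_nonempty by blast
  have "2 * (m \<bullet> v) = v \<bullet> v" "d \<bullet> v \<le> 0" using v sub assms(2) by (auto simp: tight_def)
  then have "2 * (?m \<bullet> v) \<le> v \<bullet> v" using pos
    by (simp add: inner_add_left mult_nonneg_nonpos)
  then have "norm ?m \<le> norm (?m - v)"
    by (auto simp: norm_le inner_diff_left inner_diff_right inner_commute)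
  then have "?m \<in> voronoi S" using v unfolding nearest_def voronoi_def by force
  then show ?thesis using pos by blast
qed

text \<open>\<open>S\<close> contains \<open>- v\<close> along with \<open>v\<close>, so
  \<open>Q v\<close> and \<open>Q (- v)\<close> bound \<open>m \<bullet> v\<close> from both sides,
  and linearity extends this to \<open>span S\<close>. The bound \<open>Q\<close> is arbitrary: it
  will be \<open>v \<bullet> v / 2\<close> for the Voronoi polytope and a stretched form in
  \<open>star_refine\<close>.\<close>

lemma bounded_functionals: "bounded {m \<in> span S. \<forall>v\<in>S. m \<bullet> v \<le> Q v}"
proof -
  let ?M = "{m \<in> span S. \<forall>v\<in>S. m \<bullet> v \<le> Q v}"
  have *: "\<exists>C. \<forall>m\<in>?M. \<bar>m \<bullet> u\<bar> \<le> C" if "u \<in> span S" for u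
    using that
  proof (induction rule: span_induct_alt)
    case base then show ?case by auto
  next
    case (step c x y)
    then obtain C where C: "\<forall>m\<in>?M. \<bar>m \<bullet> y\<bar> \<le> C" by blast
    have "\<bar>m \<bullet> x\<bar> \<le> max (Q x) (Q (-x))" if "m \<in> ?M" for m
    proof -
      have "m \<bullet> x \<le> Q x" "m \<bullet> (-x) \<le> Q (-x)" using that step(1) neg by blast+
      then show ?thesis by (simp add: abs_le_iff max_def)
    qed
    then have "\<bar>m \<bullet> (c *\<^sub>R x + y)\<bar> \<le> \<bar>c\<bar> * max (Q x) (Q (-x)) + C" if "m \<in> ?M" for m
    proof -
      have "\<bar>m \<bullet> (c *\<^sub>R x + y)\<bar> \<le> \<bar>c\<bar> * \<bar>m \<bullet> x\<bar> + \<bar>m \<bullet> y\<bar>"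
        by (simp add: inner_add_right) (metis abs_mult abs_triangle_ineq)
      also have "\<dots> \<le> \<bar>c\<bar> * max (Q x) (Q (-x)) + C"
        using C that \<open>\<And>m. m \<in> ?M \<Longrightarrow> \<bar>m \<bullet> x\<bar> \<le> max (Q x) (Q (-x))\<close>
        by (intro add_mono mult_left_mono) auto
      finally show ?thesis .
    qed
    then show ?case by blast
  qed
  have "\<forall>i. \<exists>C. \<forall>m\<in>?M. \<bar>m \<bullet> i\<bar> \<le> C"
  proof
    fix i
    obtain y z where yz: "y \<in> span S" "\<And>w. w \<in> span S \<Longrightarrow> orthogonal z w" "i = y + z"
      using orthogonal_subspace_decomp_exists[of S i] by blast
    have "m \<bullet> i = m \<bullet> y" if "m \<in> ?M" for m
      using yz that by (simp add: inner_add_right orthogonal_def inner_commute)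
    then show "\<exists>C. \<forall>m\<in>?M. \<bar>m \<bullet> i\<bar> \<le> C" using *[OF yz(1)] by simp
  qed
  from choice[OF this] obtain C where C: "\<forall>i. \<forall>m\<in>?M. \<bar>m \<bullet> i\<bar> \<le> C i" by (rule exE)
  have "norm m \<le> (\<Sum>i\<in>Basis. C i)" if "m \<in> ?M" for m
  proof -
    have "norm m \<le> (\<Sum>i\<in>Basis. \<bar>m \<bullet> i\<bar>)" by (rule norm_le_l1)
    also have "\<dots> \<le> (\<Sum>i\<in>Basis. C i)" by (rule sum_mono) (rule C[rule_format, OF that])
    finally show ?thesis .
  qed
  then show ?thesis unfolding bounded_iff by blast
qed

text \<open>If \<open>S\<close> does not span the space, \<open>voronoi S\<close> is a cylinder
  along the orthogonal complement of \<open>span S\<close>; this is its compact base.\<close>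

definition vor :: "(real^'n) set" where "vor = voronoi S \<inter> span S"

lemma convex_vor: "convex vor"
  unfolding vor_def by (simp add: convex_Int convex_voronoi subspace_imp_convex)

lemma compact_vor: "compact vor"
proof -
  have "vor = {m \<in> span S. \<forall>v\<in>S. m \<bullet> v \<le> v \<bullet> v / 2} "
    by (auto simp: vor_def voronoi_iff mult.commute)
  then have "bounded vor" using bounded_functionals[of "\<lambda>v. v \<bullet> v / 2"] by (simp only:)
  moreover have "closed vor" unfolding vor_def by (simp add: closed_Int closed_voronoi closed_subspace)
  ultimately show ?thesis using compact_eq_bounded_closed by blast
qed

lemma zero_vor: "0 \<in> vor" by (simp add: vor_def voronoi_iff span_zero)

text \<open>A direction in \<open>span S\<close> orthogonal to all tight vectors can be followed
  both ways by \<open>voronoi_move\<close>. Conversely the slack of a constraint is affine and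
  nonnegative, so a constraint tight inside a segment is tight at both ends, and the segment is
  orthogonal to all tight vectors. Dually, vertices are the centres of the cells through 0 that
  span.\<close>

lemma vor_extreme_iff:
  "m extreme_point_of vor \<longleftrightarrow> m \<in> vor \<and> span (tight S m) = span S"
proof
  assume ex: "m extreme_point_of vor"
  then have m: "m \<in> vor" by (simp add: extreme_point_of_def)
  have sub: "span (tight S m) \<subseteq> span S" by (rule span_mono) (auto simp: tight_def)
  moreover have "span (tight S m) = span S"
  proof (rule ccontr)
    assume "span (tight S m) \<noteq> span S"
    then obtain d where d: "d \<noteq> 0" "d \<in> span S" "\<And>y. y \<in> span (tight S m) \<Longrightarrow> orthogonal d y"
      using orthogonal_to_subspace_exists_gen[of "tight S m" S] sub by (metis psubsetI)
    have d0: "d \<bullet> v = 0" if "v \<in> tight S m" for v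
      using d(3)[OF span_base[OF that]] by (simp add: orthogonal_def)
    obtain \<delta>1 where d1: "\<delta>1 > 0" "m + \<delta>1 *\<^sub>R d \<in> voronoi S"
      using voronoi_move[of m d] m d0 by (auto simp: vor_def)
    obtain \<delta>2 where d2: "\<delta>2 > 0" "m + \<delta>2 *\<^sub>R (-d) \<in> voronoi S"
      using voronoi_move[of m "-d"] m d0 by (auto simp: vor_def)
    have a: "m + \<delta>1 *\<^sub>R d \<in> vor" "m + \<delta>2 *\<^sub>R (-d) \<in> vor"
      using d1 d2 m d(2) by (auto simp: vor_def intro!: span_add span_diff span_scale)
    have "m \<in> open_segment (m + \<delta>1 *\<^sub>R d) (m + \<delta>2 *\<^sub>R (-d))"
    proof -
      have "\<delta>1 *\<^sub>R d \<noteq> \<delta>2 *\<^sub>R (-d)"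
      proof
        assume "\<delta>1 *\<^sub>R d = \<delta>2 *\<^sub>R (-d)"
        then have "(\<delta>1 + \<delta>2) *\<^sub>R d = 0" by (simp add: scaleR_add_left)
        then show False using d1 d2 d(1) by simp
      qed
      moreover have "m = (1 - \<delta>1/(\<delta>1+\<delta>2)) *\<^sub>R (m + \<delta>1 *\<^sub>R d) + (\<delta>1/(\<delta>1+\<delta>2)) *\<^sub>R (m + \<delta>2 *\<^sub>R (-d))"
      proof -
        have "(1 - \<delta>1/(\<delta>1+\<delta>2)) *\<^sub>R (m + \<delta>1 *\<^sub>R d) + (\<delta>1/(\<delta>1+\<delta>2)) *\<^sub>R (m + \<delta>2 *\<^sub>R (-d))
          = m + ((1 - \<delta>1/(\<delta>1+\<delta>2)) * \<delta>1 - (\<delta>1/(\<delta>1+\<delta>2)) * \<delta>2) *\<^sub>R d"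
          by (simp add: algebra_simps)
        moreover have "(1 - \<delta>1/(\<delta>1+\<delta>2)) * \<delta>1 - (\<delta>1/(\<delta>1+\<delta>2)) * \<delta>2 = 0"
          using d1 d2 by (simp add: field_simps)
        ultimately show ?thesis by simp
      qed
      moreover have "0 < \<delta>1/(\<delta>1+\<delta>2)" "\<delta>1/(\<delta>1+\<delta>2) < 1" using d1 d2 by auto
      moreover have "m + \<delta>1 *\<^sub>R d \<noteq> m + \<delta>2 *\<^sub>R (-d)" using calculation(1) by simp
      ultimately show ?thesis unfolding in_segment by blast
    qed
    then show False using ex a unfolding extreme_point_of_def by blast
  qed
  ultimately show "m \<in> vor \<and> span (tight S m) = span S" using m by blast
next
  assume asm: "m \<in> vor \<and> span (tight S m) = span S"
  have False if ab: "a \<in> vor" "b \<in> vor" "m \<in> open_segment a b" for a b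
  proof -
    obtain u where u: "a \<noteq> b" "0 < u" "u < 1" "m = (1-u) *\<^sub>R a + u *\<^sub>R b"
      using ab(3) unfolding in_segment by blast
    have "(a - b) \<bullet> v = 0" if v: "v \<in> tight S m" for v
    proof -
      have vS: "v \<in> S" "2 * (m \<bullet> v) = v \<bullet> v" using v by (auto simp: tight_def)
      have 1: "2 * (a \<bullet> v) \<le> v \<bullet> v" "2 * (b \<bullet> v) \<le> v \<bullet> v"
        using ab vS by (auto simp: vor_def voronoi_iff)
      have 2: "(1-u) * (v \<bullet> v - 2 * (a \<bullet> v)) + u * (v \<bullet> v - 2 * (b \<bullet> v)) = 0"
        using vS(2) u(4) by (simp add: inner_add_left algebra_simps)
      have "(1-u) * (v \<bullet> v - 2 * (a \<bullet> v)) \<ge> 0" "u * (v \<bullet> v - 2 * (b \<bullet> v)) \<ge> 0"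
        using 1 u by auto
      then have "(1-u) * (v \<bullet> v - 2 * (a \<bullet> v)) = 0" "u * (v \<bullet> v - 2 * (b \<bullet> v)) = 0"
        using 2 by linarith+
      then show ?thesis using u by (simp add: inner_diff_left)
    qed
    then have "(a - b) \<bullet> w = 0" if "w \<in> span (tight S m)" for w
      using that orthogonal_to_span[of w] by (auto simp: orthogonal_def)
    moreover have "a - b \<in> span (tight S m)"
      using ab asm by (auto simp: vor_def intro: span_diff)
    ultimately have "(a - b) \<bullet> (a - b) = 0" by blast
    then show False using u by simp
  qed
  then show "m extreme_point_of vor" using asm unfolding extreme_point_of_def by blast
qed

text \<open>The equations 2 (m \<bullet> v) = v \<bullet> v for \<open>v\<close> in a spanning
  \<open>T\<close> leave room for one solution in \<open>span S\<close>.\<close>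

lemma tight_inj:
  assumes "m \<in> span S" "m' \<in> span S" "T \<subseteq> tight S m" "T \<subseteq> tight S m'" "span T = span S"
  shows "m = m'"
proof -
  have "(m - m') \<bullet> v = 0" if "v \<in> T" for v
  proof -
    have "2 * (m \<bullet> v) = v \<bullet> v" "2 * (m' \<bullet> v) = v \<bullet> v" using that assms(3,4) unfolding tight_def by auto
    then show ?thesis by (simp add: inner_diff_left)
  qed
  then have "(m - m') \<bullet> w = 0" if "w \<in> span T" for w
    using that orthogonal_to_span[of w] by (auto simp: orthogonal_def)
  moreover have "m - m' \<in> span T" using assms by (auto intro: span_diff)
  ultimately have "(m - m') \<bullet> (m - m') = 0" by blast
  then show ?thesis by simp
qed

lemma face_tight: "{x\<in>vor. T \<subseteq> tight S x} face_of vor"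
proof -
  show ?thesis
    unfolding face_of_def
  proof (intro conjI ballI impI)
    show "convex {x \<in> vor. T \<subseteq> tight S x}"
    proof (rule convexI)
      fix x y and u v :: real
      assume *: "x \<in> {x \<in> vor. T \<subseteq> tight S x}" "y \<in> {x \<in> vor. T \<subseteq> tight S x}" "0 \<le> u" "0 \<le> v" "u + v = 1"
      have "u *\<^sub>R x + v *\<^sub>R y \<in> vor" using * convex_vor by (simp add: convexD)
      moreover have "2 * ((u *\<^sub>R x + v *\<^sub>R y) \<bullet> w) = w \<bullet> w" if "2 * (x \<bullet> w) = w \<bullet> w" "2 * (y \<bullet> w) = w \<bullet> w" for w
      proof -
        have "2 * ((u *\<^sub>R x + v *\<^sub>R y) \<bullet> w) = u * (2 * (x \<bullet> w)) + v * (2 * (y \<bullet> w))"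
          by (simp add: inner_add_left algebra_simps)
        also have "\<dots> = (u + v) * (w \<bullet> w)" using that by (simp add: algebra_simps)
        finally show ?thesis using * by simp
      qed
      ultimately show "u *\<^sub>R x + v *\<^sub>R y \<in> {x \<in> vor. T \<subseteq> tight S x}"
        using * by (auto simp: tight_def)
    qed
  next
    fix a b x
    assume *: "a \<in> vor" "b \<in> vor" "x \<in> {x \<in> vor. T \<subseteq> tight S x}" "x \<in> open_segment a b"
    obtain u where u: "0 < u" "u < 1" "x = (1-u) *\<^sub>R a + u *\<^sub>R b"
      using *(4) unfolding in_segment by blast
    have "2 * (a \<bullet> v) = v \<bullet> v \<and> 2 * (b \<bullet> v) = v \<bullet> v" if v: "v \<in> T" for v
    proof -
      have vS: "v \<in> S" "2 * (x \<bullet> v) = v \<bullet> v" using v * by (auto simp: tight_def)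
      have 1: "2 * (a \<bullet> v) \<le> v \<bullet> v" "2 * (b \<bullet> v) \<le> v \<bullet> v"
        using * vS by (auto simp: vor_def voronoi_iff)
      have 2: "(1-u) * (v \<bullet> v - 2 * (a \<bullet> v)) + u * (v \<bullet> v - 2 * (b \<bullet> v)) = 0"
        using vS(2) u(3) by (simp add: inner_add_left algebra_simps)
      have "(1-u) * (v \<bullet> v - 2 * (a \<bullet> v)) \<ge> 0" "u * (v \<bullet> v - 2 * (b \<bullet> v)) \<ge> 0"
        using 1 u by auto
      then have "(1-u) * (v \<bullet> v - 2 * (a \<bullet> v)) = 0" "u * (v \<bullet> v - 2 * (b \<bullet> v)) = 0"
        using 2 by linarith+
      then show ?thesis using u by simp
    qed
    then show "a \<in> {x \<in> vor. T \<subseteq> tight S x}" "b \<in> {x \<in> vor. T \<subseteq> tight S x}"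
      using * by (auto simp: tight_def)
  qed auto
qed

lemma extreme_in_face:
  assumes "F face_of vor" "F \<noteq> {}"
  obtains m where "m extreme_point_of vor" "m \<in> F"
proof -
  have "compact F" "convex F" using assms face_of_imp_compact[OF convex_vor compact_vor] face_of_imp_convex by blast+
  then obtain m where "m extreme_point_of F" using extreme_point_exists_convex assms(2) by blast
  then show ?thesis using that extreme_point_of_face[OF assms(1)] by blast
qed

text \<open>Passing to a vertex of the smallest face through \<open>m\<close> only adds tight
  vectors. Dually, a Delaunay polytope through 0 of lower dimension lies in one that spans.\<close>

lemma extend_tight:
  assumes "m \<in> vor"
  obtains m' where "m' extreme_point_of vor" "tight S m \<subseteq> tight S m'"
  using extreme_in_face[OF face_tight[of "tight S m"]] assms by blast

end

section \<open>Delaunay cells of quadratic forms\<close>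

text \<open>An empty sphere is encoded by an affine minorant of the form: with \<open>c\<close> its centre,
  \<open>norm (v - c)\<^sup>2 - r\<^sup>2 = v \<bullet> v - (m \<bullet> v + k)\<close> for \<open>m = 2 *\<^sub>R c\<close>. This keeps the lattice fixed
  while the form varies. The members are the vertex sets of the Delaunay polytopes.\<close>
definition dcells :: "(real^'n::finite) set \<Rightarrow> (real^'n \<Rightarrow> real) \<Rightarrow> (real^'n) set set" where
  "dcells L q = {Z. \<exists>m c. (\<forall>v\<in>L. m \<bullet> v + c \<le> q v) \<and> Z = {v\<in>L. q v = m \<bullet> v + c} \<and>
     affine hull Z = UNIV}"

definition star :: "(real^'n::finite) set \<Rightarrow> (real^'n \<Rightarrow> real) \<Rightarrow> (real^'n) set set" where
  "star L q = {Z \<in> dcells L q. 0 \<in> Z}"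

text \<open>The difference of the two minorants is affine, nonnegative on \<open>Z\<close> and
  nonpositive on \<open>Z'\<close>. Unless it vanishes identically, its zero set separates the
  hulls, and no interior point of one can lie in the other.\<close>

lemma dcells_unique:
  assumes Z: "Z \<in> dcells L q" and Z': "Z' \<in> dcells L q"
    and x: "x \<in> interior (convex hull Z)" "x \<in> convex hull Z'"
  shows "Z = Z'"
proof -
  obtain m c where m: "\<forall>v\<in>L. m \<bullet> v + c \<le> q v" "Z = {v\<in>L. q v = m \<bullet> v + c}"
    using Z unfolding dcells_def by blast
  obtain m' c' where m': "\<forall>v\<in>L. m' \<bullet> v + c' \<le> q v" "Z' = {v\<in>L. q v = m' \<bullet> v + c'}"
    using Z' unfolding dcells_def by blast
  define a b where "a = m - m'" and "b = c' - c"
  have "Z \<subseteq> {v. a \<bullet> v \<ge> b}"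
  proof
    fix v assume "v \<in> Z"
    then have "m' \<bullet> v + c' \<le> m \<bullet> v + c" using m m' by force
    then show "v \<in> {v. a \<bullet> v \<ge> b}" by (simp add: a_def b_def inner_diff_left)
  qed
  then have 1: "convex hull Z \<subseteq> {v. a \<bullet> v \<ge> b}" by (simp add: convex_halfspace_ge subset_hull)
  have "Z' \<subseteq> {v. a \<bullet> v \<le> b}"
  proof
    fix v assume "v \<in> Z'"
    then have "m \<bullet> v + c \<le> m' \<bullet> v + c'" using m m' by force
    then show "v \<in> {v. a \<bullet> v \<le> b}" by (simp add: a_def b_def inner_diff_left)
  qed
  then have 2: "convex hull Z' \<subseteq> {v. a \<bullet> v \<le> b}" by (simp add: convex_halfspace_le subset_hull)
  have eq: "a \<bullet> x = b" using 1 2 x interior_subset by (smt (verit) mem_Collect_eq subset_iff)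
  have "a = 0"
  proof (rule ccontr)
    assume a0: "a \<noteq> 0"
    have "interior (convex hull Z) \<subseteq> interior {v. a \<bullet> v \<ge> b}" using 1 by (rule interior_mono)
    then show False using x(1) a0 eq by (auto simp: interior_halfspace_ge)
  qed
  moreover have "b = 0" using eq calculation by simp
  ultimately have "m = m'" "c = c'" by (auto simp: a_def b_def)
  then show ?thesis using m m' by simp
qed

text \<open>Strict convexity of the form: if \<open>w\<close> were not in \<open>Z\<close>, the form
  would exceed its tangent at \<open>w\<close> strictly on \<open>Z\<close>, hence the affine
  function representing it on \<open>Z\<close> would exceed the form at \<open>w\<close>. So a cell
  contains every lattice point of its convex hull.\<close>

lemma conv_mem:
  fixes A :: "real^'n::finite \<Rightarrow> real^'n"
  assumes A: "linear A" "inj A" and Z: "\<And>v. v \<in> Z \<Longrightarrow> A v \<bullet> A v = m \<bullet> v + c"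
    and w: "w \<in> convex hull Z" "m \<bullet> w + c \<le> A w \<bullet> A w"
  shows "w \<in> Z"
proof (rule ccontr)
  assume nw: "w \<notin> Z"
  let ?a = "m - 2 *\<^sub>R adjoint A (A w)"
  have adj: "adjoint A (A w) \<bullet> v = A v \<bullet> A w" for v
    using adjoint_works[OF A(1)] by (metis inner_commute)
  have "Z \<subseteq> {v. ?a \<bullet> v > - c - A w \<bullet> A w}"
  proof
    fix v assume v: "v \<in> Z"
    then have "A v - A w \<noteq> 0" using nw A(2) by (auto dest: injD)
    then have "(A v - A w) \<bullet> (A v - A w) > 0" by simp
    then have "A v \<bullet> A v - 2 * (A v \<bullet> A w) + A w \<bullet> A w > 0"
      by (simp add: inner_diff_left inner_diff_right inner_commute)
    then show "v \<in> {v. ?a \<bullet> v > - c - A w \<bullet> A w}"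
      using Z[OF v] by (simp add: inner_diff_left adj)
  qed
  then have "convex hull Z \<subseteq> {v. ?a \<bullet> v > - c - A w \<bullet> A w}"
    by (simp add: convex_halfspace_gt subset_hull)
  then have "?a \<bullet> w > - c - A w \<bullet> A w" using w(1) by blast
  then show False using w(2) by (simp add: inner_diff_left adj)
qed

lemma dcells_image_aux:
  fixes A :: "real^'n::finite \<Rightarrow> real^'n"
  assumes A: "linear A" "bij A" and Z: "Z \<in> dcells L (q \<circ> A)"
  shows "A ` Z \<in> dcells (A ` L) q"
proof -
  obtain m c where m: "\<forall>v\<in>L. m \<bullet> v + c \<le> q (A v)" "Z = {v\<in>L. q (A v) = m \<bullet> v + c}" "affine hull Z = UNIV"
    using Z unfolding dcells_def by auto
  have inv: "linear (inv A)" using A by (simp add: bij_is_inj inj_linear_imp_inv_linear)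
  define m' where "m' = adjoint (inv A) m"
  have m'v: "m' \<bullet> A v = m \<bullet> v" for v
    using adjoint_works[OF inv, of "A v" m] A(2) by (simp add: m'_def inner_commute bij_is_inj)
  have "affine hull (A ` Z) = UNIV" using m(3) A
    by (simp add: affine_hull_linear_image[symmetric] bij_is_surj linear_conv_bounded_linear)
  moreover have "A ` Z = {v \<in> A ` L. q v = m' \<bullet> v + c}" using m(2) m'v by auto
  moreover have "\<forall>v\<in>A ` L. m' \<bullet> v + c \<le> q v" using m(1) m'v by auto
  ultimately show ?thesis unfolding dcells_def by blast
qed

lemma dcells_image:
  fixes A :: "real^'n::finite \<Rightarrow> real^'n"
  assumes A: "linear A" "bij A"
  shows "dcells (A ` L) q = (`) A ` dcells L (q \<circ> A)"
proof
  show "(`) A ` dcells L (q \<circ> A) \<subseteq> dcells (A ` L) q" using dcells_image_aux[OF A] by blast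
next
  have inv: "linear (inv A)" "bij (inv A)" using A
    by (simp_all add: bij_is_inj inj_linear_imp_inv_linear bij_imp_bij_inv)
  have 1: "inv A ` A ` X = X" "A ` inv A ` X = X" for X
    using A(2) by (simp_all add: bij_is_inj bij_is_surj image_inv_f_f image_f_inv_f)
  have 2: "q \<circ> A \<circ> inv A = q" using A(2) by (auto simp: fun_eq_iff bij_is_surj surj_f_inv_f)
  show "dcells (A ` L) q \<subseteq> (`) A ` dcells L (q \<circ> A)"
  proof
    fix Z assume "Z \<in> dcells (A ` L) q"
    then have "inv A ` Z \<in> dcells L (q \<circ> A)"
      using dcells_image_aux[OF inv, of Z "A ` L" "q \<circ> A"] 1 2 by simp
    then show "Z \<in> (`) A ` dcells L (q \<circ> A)" using 1(2)[of Z] by (metis image_eqI)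
  qed
qed

lemma star_image:
  fixes A :: "real^'n::finite \<Rightarrow> real^'n"
  assumes A: "linear A" "bij A"
  shows "star (A ` L) q = (`) A ` star L (q \<circ> A)"
proof -
  have "0 \<in> A ` Z \<longleftrightarrow> 0 \<in> Z" for Z
    using A by (metis bij_is_inj image_iff inj_image_mem_iff linear_0)
  then show ?thesis unfolding star_def dcells_image[OF A] by blast
qed

lemma convex_hull_Collect_face_of:
  fixes T :: "'a::euclidean_space set"
  assumes "finite T" "\<And>v. v \<in> T \<Longrightarrow> a \<bullet> v \<le> b"
  shows "convex hull {v\<in>T. a \<bullet> v = b} face_of convex hull T"
proof -
  let ?F = "convex hull T \<inter> {x. a \<bullet> x = b}"
  have "convex hull T \<subseteq> {x. a \<bullet> x \<le> b}" using assms(2)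
    by (intro hull_minimal) (auto simp: convex_halfspace_le)
  then have F: "?F face_of convex hull T"
    using face_of_Int_supporting_hyperplane_le[of "convex hull T" a b] by auto
  obtain T' where T': "T' \<subseteq> T" "?F = convex hull T'"
    by (rule face_of_convex_hull_subset[OF finite_imp_compact[OF assms(1)] F])
  have "T' \<subseteq> {v\<in>T. a \<bullet> v = b}" using T' hull_subset[of T' convex] by blast
  then have "?F \<subseteq> convex hull {v\<in>T. a \<bullet> v = b}" using T' by (metis hull_mono)
  moreover have "convex hull {v\<in>T. a \<bullet> v = b} \<subseteq> convex hull T" by (rule hull_mono) blast
  moreover have "convex hull {v\<in>T. a \<bullet> v = b} \<subseteq> {x. a \<bullet> x = b}"
    by (intro hull_minimal) (auto simp: convex_hyperplane)
  ultimately have "?F = convex hull {v\<in>T. a \<bullet> v = b}" by blast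
  then show ?thesis using F by simp
qed

section \<open>Empty spheres and the covering of space by Delaunay polytopes\<close>

context discrete_lattice begin

lemma finite_tight: "finite (tight S m)"
proof (rule finite_subset[OF _ fin[of "2 * norm m"]])
  show "tight S m \<subseteq> S \<inter> cball 0 (2 * norm m)"
  proof
    fix v assume v: "v \<in> tight S m"
    then have "norm v * norm v = 2 * (m \<bullet> v)" by (simp add: tight_def dot_square_norm power2_eq_square)
    also have "\<dots> \<le> 2 * (norm m * norm v)" using norm_cauchy_schwarz by simp
    finally have "norm v \<le> 2 * norm m"
      by (cases "norm v = 0") (auto simp: mult_le_cancel_right)
    then show "v \<in> S \<inter> cball 0 (2 * norm m)" using v by (simp add: tight_def)
  qed
qed

lemma nearest_add:
  assumes "u \<in> voronoi S" "w \<in> S"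
  shows "nearest S (u + w) = (+) w ` tight S u"
proof -
  have "v \<in> nearest S (u + w) \<longleftrightarrow> v - w \<in> nearest S u" for v
  proof -
    have "v \<in> S \<longleftrightarrow> v - w \<in> S" using assms(2) add diff by (metis diff_add_cancel)
    moreover have "(\<forall>x\<in>S. norm (u + w - v) \<le> norm (u + w - x)) \<longleftrightarrow> (\<forall>x\<in>S. norm (u - (v - w)) \<le> norm (u - x))"
    proof -
      have "u + w - v = u - (v - w)" "\<And>x. u + w - x = u - (x - w)" "\<And>x. u - x = u + w - (x + w)" by auto
      then show ?thesis using assms(2) add diff by metis
    qed
    ultimately show ?thesis unfolding nearest_def by blast
  qed
  then show ?thesis using nearest_voronoi[OF assms(1)] by (force simp: image_iff)
qed

text \<open>With \<open>nearest_add\<close> this reduces every empty sphere to one through 0 whose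
  centre is in the Voronoi polytope.\<close>

lemma nearest_diff_voronoi:
  assumes "w \<in> nearest S m" shows "m - w \<in> voronoi S"
proof -
  have "norm (m - w) \<le> norm (m - w - v)" if "v \<in> S" for v
    using assms that add[of w v] unfolding nearest_def by (auto simp: algebra_simps)
  then show ?thesis by (simp add: voronoi_def)
qed

lemma affine_hull_tight: "affine hull (tight S u) = span (tight S u)"
  by (rule affine_hull_span_0) (simp add: hull_inc zero_tight)

lemma affine_hull_nearest:
  assumes "u \<in> voronoi S" "w \<in> S" "span (tight S u) = span S"
  shows "affine hull (nearest S (u + w)) = span S"
proof -
  have "affine hull (nearest S (u + w)) = (+) w ` span S"
    using assms by (simp add: nearest_add affine_hull_translation affine_hull_tight)
  also have "\<dots> = span S"
  proof -
    have "v \<in> (+) w ` span S" if "v \<in> span S" for v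
      using that assms(2) by (intro image_eqI[of _ _ "v - w"]) (auto intro: span_diff span_base)
    then show ?thesis using assms(2) by (auto intro: span_add span_base)
  qed
  finally show ?thesis .
qed

text \<open>Minimise \<open>(dist m x)\<^sup>2 - (infdist m S)\<^sup>2\<close> over \<open>m\<close>: at a minimum, \<open>x\<close> cannot be separated from the
  lattice points nearest to \<open>m\<close>. The resulting cell is then enlarged to a full-dimensional one.\<close>
lemma cover:
  assumes x: "x \<in> span S"
  shows "\<exists>c\<in>span S. x \<in> convex hull (nearest S c) \<and> affine hull (nearest S c) = span S"
proof -
  obtain R where R: "\<And>u. u \<in> vor \<Longrightarrow> norm u \<le> R"
    using compact_imp_bounded[OF compact_vor] unfolding bounded_iff by blast
  have R0: "R \<ge> 0" using R[OF zero_vor] by simp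
  define F where "F m = (dist m x)^2 - (infdist m S)^2" for m
  have inf: "infdist m S = norm (m - v)" if "v \<in> nearest S m" for m v
  proof -
    have "S \<noteq> {}" using zero by blast
    moreover have "infdist m S \<le> norm (m - v)" using that infdist_le[of v S m] by (simp add: nearest_def dist_norm)
    moreover have "norm (m - v) \<le> infdist m S" unfolding infdist_def using that calculation(1)
      by (auto simp: nearest_def dist_norm intro!: cINF_greatest)
    ultimately show ?thesis by simp
  qed
  have le: "norm (m - v) \<le> R" if "v \<in> nearest S m" "m \<in> span S" for m v
    using that nearest_diff_voronoi[OF that(1)] R[of "m - v"]
    by (auto simp: vor_def nearest_def intro: span_diff span_base)
  have "compact (span S \<inter> cball x R)" by (simp add: closed_Int_compact closed_subspace)
  moreover have "x \<in> span S \<inter> cball x R" using x R0 by simp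
  moreover have "continuous_on (span S \<inter> cball x R) F" unfolding F_def
    by (intro continuous_intros)
  ultimately obtain m where m: "m \<in> span S" "\<And>y. y \<in> span S \<inter> cball x R \<Longrightarrow> F m \<le> F y"
    using continuous_attains_inf[of "span S \<inter> cball x R" F] by blast
  \<comment> \<open>\<open>R\<close> bounds the distance from a point of \<open>span S\<close> to
    its nearest lattice points. Farther than \<open>R\<close> from \<open>x\<close> the function
    \<open>F\<close> is therefore nonnegative, while \<open>F x\<close> is not positive, so the
    minimum over the ball is global.\<close>
  have min: "F m \<le> F y" if y: "y \<in> span S" for y
  proof (cases "dist x y \<le> R")
    case True then show ?thesis using m y by simp
  next
    case False
    obtain v where v: "v \<in> nearest S y" using nearest_nonempty by blast
    have "norm (y - v) \<le> dist y x" using le[OF v y] False by (simp add: dist_commute)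
    then have "F y \<ge> 0" unfolding F_def inf[OF v] by (simp add: power_mono)
    moreover have "F x \<le> 0" unfolding F_def by simp
    moreover have "F m \<le> F x" using m x R0 by simp
    ultimately show ?thesis by linarith
  qed
  let ?T = "nearest S m"
  obtain w where w: "w \<in> ?T" using nearest_nonempty by blast
  have wS: "w \<in> S" using w by (simp add: nearest_def)
  have u: "m - w \<in> vor" using nearest_diff_voronoi[OF w] m(1) wS by (auto simp: vor_def intro: span_diff span_base)
  have T: "?T = (+) w ` tight S (m - w)" using nearest_add[of "m - w" w] u wS by (simp add: vor_def)
  have finT: "finite ?T" unfolding T by (intro finite_imageI finite_tight)
  have xT: "x \<in> convex hull ?T"
  proof (rule ccontr)
    assume "x \<notin> convex hull ?T"
    then obtain a b where ab: "a \<bullet> x < b" "\<And>v. v \<in> convex hull ?T \<Longrightarrow> a \<bullet> v > b"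
      using separating_hyperplane_closed_point[of "convex hull ?T" x] finT
      by (auto simp: compact_imp_closed finite_imp_compact_convex_hull)
    \<comment> \<open>The centre has to stay in \<open>span S\<close>. The component
      \<open>y\<close> of the normal in this span separates equally well, since \<open>x\<close> and
      the lattice lie there.\<close>
    obtain y z where yz: "y \<in> span S" "\<And>w. w \<in> span S \<Longrightarrow> orthogonal z w" "a = y + z"
      using orthogonal_subspace_decomp_exists[of S a] by blast
    have y: "y \<bullet> v = a \<bullet> v" if "v \<in> span S" for v
      using yz that by (simp add: inner_add_left orthogonal_def)
    have yv: "y \<bullet> x < y \<bullet> v" if "v \<in> ?T" for v
    proof -
      have "b < a \<bullet> v" using ab(2) that by (simp add: hull_inc)
      moreover have "v \<in> span S" using that by (simp add: nearest_def span_base)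
      ultimately show ?thesis using ab(1) y x by simp
    qed
    then have y0: "y \<noteq> 0" using w by force
    obtain \<delta>0 where d0: "\<delta>0 > 0" "\<And>m'. dist m' m < \<delta>0 \<Longrightarrow> nearest S m' \<subseteq> ?T"
      using nearest_stable[of m] by blast
    define \<delta> where "\<delta> = \<delta>0 / (2 * norm y)"
    have \<delta>: "\<delta> > 0" "\<delta> * norm y < \<delta>0" using d0 y0 by (auto simp: \<delta>_def)
    let ?m = "m - \<delta> *\<^sub>R y"
    have "dist ?m m < \<delta>0" using \<delta> by (simp add: dist_norm)
    then have sub: "nearest S ?m \<subseteq> ?T" using d0 by blast
    obtain v where v: "v \<in> nearest S ?m" using nearest_nonempty by blast
    have F1: "F ?m = (?m - x) \<bullet> (?m - x) - (?m - v) \<bullet> (?m - v)"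
      unfolding F_def inf[OF v] by (simp add: dist_norm dot_square_norm)
    have F2: "F m = (m - x) \<bullet> (m - x) - (m - v) \<bullet> (m - v)"
      using sub v unfolding F_def by (subst inf[of v]) (auto simp: dist_norm dot_square_norm)
    \<comment> \<open>As \<open>v\<close> is nearest to both centres, the squares of the centre
      cancel, and \<open>F\<close> changes linearly along the move.\<close>
    have "F ?m - F m = 2 * \<delta> * (y \<bullet> x - y \<bullet> v)"
      unfolding F1 F2 by (simp add: inner_diff_left inner_diff_right inner_commute algebra_simps)
    also have "\<dots> < 0"
    proof (rule mult_pos_neg)
      show "y \<bullet> x - y \<bullet> v < 0" using yv[of v] sub v by auto
    qed (use \<delta>(1) in simp)
    finally have "F ?m < F m" by simp
    moreover have "?m \<in> span S" using m(1) yz(1) by (intro span_diff span_scale)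
    ultimately show False using min[of ?m] by linarith
  qed
  obtain u' where u': "u' extreme_point_of vor" "tight S (m - w) \<subseteq> tight S u'" using extend_tight[OF u] .
  then have u'': "u' \<in> voronoi S" "u' \<in> span S" "span (tight S u') = span S"
    using vor_extreme_iff by (auto simp: vor_def)
  have "?T \<subseteq> nearest S (u' + w)" using T nearest_add[OF u''(1) wS] u'(2) by blast
  then have "x \<in> convex hull (nearest S (u' + w))" using xT hull_mono by blast
  moreover have "u' + w \<in> span S" using u''(2) wS by (simp add: span_add span_base)
  ultimately show ?thesis using affine_hull_nearest[OF u''(1) wS u''(3)] by blast
qed

text \<open>On the points tight at \<open>m'\<close> the functional \<open>m - m'\<close> is
  nonpositive, and it vanishes exactly where \<open>m\<close> is tight too: it exposes the
  face.\<close>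

lemma tight_face_of:
  assumes "m \<in> voronoi S" "m' \<in> voronoi S" "tight S m \<subseteq> tight S m'"
  shows "convex hull (tight S m) face_of convex hull (tight S m')"
proof -
  have 1: "2 * (m \<bullet> v) \<le> v \<bullet> v" if "v \<in> tight S m'" for v
    using that assms(1) by (simp add: tight_def voronoi_iff)
  have "tight S m = {v \<in> tight S m'. (m - m') \<bullet> v = 0}"
    using assms(3) by (auto simp: tight_def inner_diff_left)
  moreover have "(m - m') \<bullet> v \<le> 0" if "v \<in> tight S m'" for v
    using 1[OF that] that by (simp add: tight_def inner_diff_left)
  ultimately show ?thesis using convex_hull_Collect_face_of[OF finite_tight, of m' "m - m'" 0] by simp
qed

text \<open>Vertices are determined by their tight sets, and these are subsets of one finite set
  because a tight vector has length at most twice that of \<open>m\<close>.\<close>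

lemma finite_vor_extreme: "finite {m. m extreme_point_of vor}"
proof -
  obtain R where R: "\<And>u. u \<in> vor \<Longrightarrow> norm u \<le> R"
    using compact_imp_bounded[OF compact_vor] unfolding bounded_iff by blast
  have "inj_on (tight S) {m. m extreme_point_of vor}"
  proof (rule inj_onI, clarify)
    fix x y assume "x extreme_point_of vor" "y extreme_point_of vor" "tight S x = tight S y"
    then have "x \<in> span S" "y \<in> span S" "tight S x = tight S y" "span (tight S x) = span S"
      unfolding vor_extreme_iff unfolding vor_def by auto
    then show "x = y" using tight_inj[of x y "tight S x"] by simp
  qed
  moreover have "tight S ` {m. m extreme_point_of vor} \<subseteq> Pow (S \<inter> cball 0 (2 * R))"
  proof clarify
    fix m v assume m: "m extreme_point_of vor" and v: "v \<in> tight S m"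
    then have "norm v * norm v = 2 * (m \<bullet> v)" by (simp add: tight_def dot_square_norm power2_eq_square)
    also have "\<dots> \<le> 2 * (norm m * norm v)" using norm_cauchy_schwarz by simp
    finally have "norm v \<le> 2 * norm m"
      by (cases "norm v = 0") (auto simp: mult_le_cancel_right)
    moreover have "norm m \<le> R" using m R by (simp add: extreme_point_of_def)
    ultimately show "v \<in> S \<inter> cball 0 (2 * R)" using v by (simp add: tight_def)
  qed
  moreover have "finite (Pow (S \<inter> cball 0 (2 * R)))" by (simp only: finite_Pow_iff fin)
  ultimately show ?thesis by (rule inj_on_finite)
qed

lemma polytope_vor: "polytope vor"
  unfolding polytope_def using finite_vor_extreme Krein_Milman_Minkowski[OF compact_vor convex_vor] by blast

end

section \<open>Lattices of full rank: the star and the vertices of the Voronoi polytope\<close>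

locale full_lattice = discrete_lattice S for S :: "(real^'n::finite) set" +
  assumes full: "span S = UNIV"
begin

lemma vor_eq: "vor = voronoi S" by (simp add: vor_def full)

lemma nearest_dcells:
  assumes "affine hull (nearest S c) = UNIV"
  shows "nearest S c \<in> dcells S (\<lambda>v. v \<bullet> v)"
proof -
  obtain w where w: "w \<in> nearest S c" using nearest_nonempty by blast
  let ?b = "w \<bullet> w - 2 * (c \<bullet> w)"
  have iff: "norm (c - v) \<le> norm (c - x) \<longleftrightarrow> v \<bullet> v - 2 * (c \<bullet> v) \<le> x \<bullet> x - 2 * (c \<bullet> x)" for v x
    by (auto simp: norm_le inner_diff_left inner_diff_right inner_commute)
  have le: "(2 *\<^sub>R c) \<bullet> v + ?b \<le> v \<bullet> v" if "v \<in> S" for v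
    using w that unfolding nearest_def iff by auto
  moreover have "nearest S c = {v\<in>S. v \<bullet> v = (2 *\<^sub>R c) \<bullet> v + ?b}"
  proof (intro set_eqI iffI)
    fix v assume v: "v \<in> nearest S c"
    then have "v \<bullet> v - 2 * (c \<bullet> v) \<le> ?b" using w unfolding nearest_def iff by auto
    then show "v \<in> {v\<in>S. v \<bullet> v = (2 *\<^sub>R c) \<bullet> v + ?b}" using le[of v] v by (auto simp: nearest_def)
  next
    fix v assume v: "v \<in> {v\<in>S. v \<bullet> v = (2 *\<^sub>R c) \<bullet> v + ?b}"
    then have "v \<bullet> v - 2 * (c \<bullet> v) = ?b" "v \<in> S" by auto
    then show "v \<in> nearest S c" using le unfolding nearest_def iff by fastforce
  qed
  ultimately show ?thesis using assms unfolding dcells_def by blast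
qed

lemma cover_dcells: "\<exists>Z\<in>dcells S (\<lambda>v. v \<bullet> v). x \<in> convex hull Z"
  using cover[of x] full nearest_dcells by auto

text \<open>The minorant of a cell through 0 has constant term 0, and half of its linear part is the
  vertex dual to the cell.\<close>

lemma star_eq: "star S (\<lambda>v. v \<bullet> v) = tight S ` {m. m extreme_point_of voronoi S}"
proof (intro set_eqI iffI)
  fix Z assume "Z \<in> star S (\<lambda>v. v \<bullet> v)"
  then obtain m c where m: "\<forall>v\<in>S. m \<bullet> v + c \<le> v \<bullet> v" "Z = {v\<in>S. v \<bullet> v = m \<bullet> v + c}" "affine hull Z = UNIV" "0 \<in> Z"
    unfolding star_def dcells_def by blast
  have c: "c = 0" using m by auto
  let ?m = "m /\<^sub>R 2"
  have Z: "Z = tight S ?m" using m c by (auto simp: tight_def)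
  have "?m \<in> voronoi S" using m c by (simp add: voronoi_iff)
  moreover have "span (tight S ?m) = span S" using m(3) Z affine_hull_tight[of ?m] full by simp
  ultimately have "?m extreme_point_of voronoi S" using vor_extreme_iff[unfolded vor_eq] by blast
  then show "Z \<in> tight S ` {m. m extreme_point_of voronoi S}" using Z by blast
next
  fix Z assume "Z \<in> tight S ` {m. m extreme_point_of voronoi S}"
  then obtain m where m: "m extreme_point_of voronoi S" "Z = tight S m" by blast
  then have "m \<in> voronoi S" "span (tight S m) = UNIV" using vor_extreme_iff[unfolded vor_eq] full by auto
  then have "\<forall>v\<in>S. (2 *\<^sub>R m) \<bullet> v + 0 \<le> v \<bullet> v" "Z = {v\<in>S. v \<bullet> v = (2 *\<^sub>R m) \<bullet> v + 0}" "affine hull Z = UNIV" "0 \<in> Z"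
    using m(2) affine_hull_tight[of m] zero_tight by (auto simp: voronoi_iff tight_def)
  then show "Z \<in> star S (\<lambda>v. v \<bullet> v)" unfolding star_def dcells_def by blast
qed

lemma inj_tight: "inj_on (tight S) {m. m extreme_point_of voronoi S}"
proof (rule inj_onI, clarify)
  fix x y assume "x extreme_point_of voronoi S" "y extreme_point_of voronoi S" "tight S x = tight S y"
  then show "x = y" using tight_inj[of x y "tight S x"] vor_extreme_iff[unfolded vor_eq] full by auto
qed

text \<open>The cones at 0 over the star cells cover space; membership of \<open>x\<close> in such a
  cone is stated dually. The cell belongs to a vertex \<open>m\<close> maximising \<open>x\<close>
  over the Voronoi polytope: a functional \<open>d\<close> nonpositive on the cell is a feasible
  direction at \<open>m\<close>, so \<open>x\<close> cannot increase along it.\<close>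

lemma cover_cone: "\<exists>Z\<in>star S (\<lambda>v. v \<bullet> v). \<forall>d. (\<forall>v\<in>Z. d \<bullet> v \<le> 0) \<longrightarrow> d \<bullet> x \<le> 0"
proof -
  have "continuous_on vor ((\<bullet>) x)" by (intro continuous_intros)
  then obtain m0 where m0: "m0 \<in> vor" "\<And>m. m \<in> vor \<Longrightarrow> x \<bullet> m \<le> x \<bullet> m0"
    using continuous_attains_sup[OF compact_vor, of "(\<bullet>) x"] zero_vor by blast
  let ?F = "vor \<inter> {m. x \<bullet> m = x \<bullet> m0}"
  have "?F face_of vor" using face_of_Int_supporting_hyperplane_le[OF convex_vor] m0 by blast
  moreover have "?F \<noteq> {}" using m0 by blast
  ultimately obtain m where m: "m extreme_point_of vor" "m \<in> ?F" by (rule extreme_in_face)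
  have "d \<bullet> x \<le> 0" if d: "\<forall>v\<in>tight S m. d \<bullet> v \<le> 0" for d
  proof -
    have "m \<in> voronoi S" using m vor_eq by blast
    then obtain \<delta> where "\<delta> > 0" "m + \<delta> *\<^sub>R d \<in> voronoi S" using voronoi_move d by blast
    then have "x \<bullet> (m + \<delta> *\<^sub>R d) \<le> x \<bullet> m" using m0 m vor_eq by auto
    then have "\<delta> * (d \<bullet> x) \<le> 0" by (simp add: inner_add_right inner_commute)
    then show ?thesis using \<open>\<delta> > 0\<close> by (simp add: mult_le_0_iff)
  qed
  then show ?thesis using m star_eq vor_eq by auto
qed

end

text \<open>For a unit vector \<open>e\<close> and t = \<epsilon> (2 + \<epsilon>) this is the
  squared length of the \<epsilon>-extended vector.\<close>

definition qe :: "real^'n::finite \<Rightarrow> real \<Rightarrow> real^'n \<Rightarrow> real" where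
  "qe e t v = v \<bullet> v + t * (e \<bullet> v)\<^sup>2"

lemma qe_zero: "qe e 0 = (\<lambda>v. v \<bullet> v)"
  by (simp add: qe_def fun_eq_iff)

lemma linear_extend: "linear (extend \<epsilon> e)"
  by (intro linearI) (simp_all add: extend_def inner_add_right algebra_simps)

lemma extend_symmetric: "extend \<epsilon> e u \<bullet> v = u \<bullet> extend \<epsilon> e v"
  by (simp add: extend_def inner_add_left inner_add_right inner_commute)

lemma extend_fixes: "e \<bullet> v = 0 \<Longrightarrow> extend \<epsilon> e v = v"
  by (simp add: extend_def)

lemma dcells_diff:
  assumes "\<And>x y. x \<in> S \<Longrightarrow> y \<in> S \<Longrightarrow> x + y \<in> S" "\<And>x y. x \<in> S \<Longrightarrow> y \<in> S \<Longrightarrow> x - y \<in> S"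
  assumes Z: "Z \<in> dcells S (qe e t)" and w: "w \<in> S"
  shows "(\<lambda>v. v - w) ` Z \<in> dcells S (qe e t)"
proof -
  obtain m c where m: "\<forall>v\<in>S. m \<bullet> v + c \<le> qe e t v" "Z = {v\<in>S. qe e t v = m \<bullet> v + c}" "affine hull Z = UNIV"
    using Z unfolding dcells_def by blast
  \<comment> \<open>From the expansion of \<open>qe e t (v + w)\<close>: its mixed term in
    \<open>v\<close> and \<open>w\<close> goes into the linear part, its value at \<open>w\<close>
    into the constant.\<close>
  define m' c' where "m' = m - 2 *\<^sub>R (w + (t * (e \<bullet> w)) *\<^sub>R e)" and "c' = m \<bullet> w + c - qe e t w"
  have q: "qe e t v - m' \<bullet> v - c' = qe e t (v + w) - m \<bullet> (v + w) - c" for v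
    unfolding qe_def m'_def c'_def
    by (simp add: inner_add_left inner_add_right inner_diff_left inner_commute power2_eq_square algebra_simps)
  have "m' \<bullet> v + c' \<le> qe e t v" if "v \<in> S" for v
    using m(1)[rule_format, OF assms(1)[OF that w]] q[of v] by linarith
  moreover have "(\<lambda>v. v - w) ` Z = {v\<in>S. qe e t v = m' \<bullet> v + c'}"
  proof (intro set_eqI iffI)
    fix x assume "x \<in> (\<lambda>v. v - w) ` Z"
    then have x: "x + w \<in> Z" by auto
    then have "x + w \<in> S" "qe e t (x + w) = m \<bullet> (x + w) + c" using m(2) by blast+
    moreover have "x \<in> S" using assms(2)[OF calculation(1) w] by simp
    ultimately show "x \<in> {v\<in>S. qe e t v = m' \<bullet> v + c'}" using q[of x] by simp
  next
    fix x assume x: "x \<in> {v\<in>S. qe e t v = m' \<bullet> v + c'}"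
    then have "x + w \<in> Z" using m(2) q[of x] assms(1)[OF _ w] by auto
    then show "x \<in> (\<lambda>v. v - w) ` Z" by force
  qed
  moreover have "affine hull ((\<lambda>v. v - w) ` Z) = UNIV"
  proof -
    have "(\<lambda>v. v - w) ` Z = (+) (- w) ` Z" by auto
    then have "affine hull ((\<lambda>v. v - w) ` Z) = (+) (- w) ` UNIV"
      using m(3) affine_hull_translation[of "-w" Z] by simp
    then show ?thesis using surj_plus[of "-w"] by simp
  qed
  ultimately show ?thesis unfolding dcells_def by blast
qed

lemma interior_convex_hull_nonempty:
  fixes Z :: "'a::euclidean_space set"
  assumes "affine hull Z = UNIV" shows "interior (convex hull Z) \<noteq> {}"
proof -
  have "affine hull (convex hull Z) = UNIV" using assms by (simp add: affine_hull_convex_hull)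
  then have "interior (convex hull Z) = rel_interior (convex hull Z)" by (simp add: rel_interior_interior)
  moreover have "Z \<noteq> {}" using assms by auto
  ultimately show ?thesis by (simp add: rel_interior_eq_empty)
qed

lemma interior_convex_zero_point:
  fixes K :: "'a::euclidean_space set"
  assumes K: "convex K" and p: "p \<in> interior K" and z: "z \<in> K" and pz: "(e \<bullet> p) * (e \<bullet> z) < 0"
  shows "\<exists>x\<in>interior K. e \<bullet> x = 0"
proof -
  let ?s = "(e \<bullet> z) / (e \<bullet> z - e \<bullet> p)"
  have "(e \<bullet> z > 0 \<and> e \<bullet> p < 0) \<or> (e \<bullet> z < 0 \<and> e \<bullet> p > 0)" using pz by (auto simp: mult_less_0_iff)
  then have s: "0 < ?s" "?s \<le> 1" "e \<bullet> z - e \<bullet> p \<noteq> 0"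
    by (auto simp: zero_less_divide_iff divide_le_eq)
  have "z - ?s *\<^sub>R (z - p) \<in> interior K" using mem_interior_convex_shrink[OF K p z s(1,2)] .
  moreover have "e \<bullet> (z - ?s *\<^sub>R (z - p)) = 0" using s(3) by (simp add: inner_diff_right)
  ultimately show ?thesis by blast
qed

context discrete_lattice begin

text \<open>A radius smaller than the distance from the centre to \<open>S\<close> gives the empty
  hull, of dimension -1; \<open>0 \<le> k\<close> excludes it, so the sphere is determined by its
  centre.\<close>

lemma delaunay_cells_iff:
  assumes "0 \<le> k"
  shows "P \<in> delaunay_cells S A k \<longleftrightarrow> (\<exists>c\<in>A. P = convex hull (nearest S c) \<and> aff_dim P = k)"
proof
  assume "P \<in> delaunay_cells S A k"
  then obtain c r where c: "c \<in> A" "\<forall>x\<in>S. r \<le> dist c x" "P = convex hull {x\<in>S. dist c x = r}" "aff_dim P = k"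
    unfolding delaunay_cells_def by blast
  have "{x\<in>S. dist c x = r} \<noteq> {}"
  proof
    assume "{x\<in>S. dist c x = r} = {}"
    then have "P = {}" using c(3) by simp
    then show False using assms c(4) by simp
  qed
  then have "{x\<in>S. dist c x = r} = nearest S c" using c(2) unfolding nearest_def dist_norm by force
  then show "\<exists>c\<in>A. P = convex hull (nearest S c) \<and> aff_dim P = k" using c by auto
next
  assume "\<exists>c\<in>A. P = convex hull (nearest S c) \<and> aff_dim P = k"
  then obtain c where c: "c \<in> A" "P = convex hull (nearest S c)" "aff_dim P = k" by blast
  obtain w where w: "w \<in> nearest S c" using nearest_nonempty by blast
  have "nearest S c = {x\<in>S. dist c x = dist c w}" "\<forall>x\<in>S. dist c w \<le> dist c x"
    using w unfolding nearest_def dist_norm by force+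
  then show "P \<in> delaunay_cells S A k" using c unfolding delaunay_cells_def by auto
qed

end

context full_lattice begin

lemma dcells_norm_iff:
  "Z \<in> dcells S (\<lambda>v. v \<bullet> v) \<longleftrightarrow> affine hull Z = UNIV \<and> (\<exists>c. Z = nearest S c)"
proof
  assume "Z \<in> dcells S (\<lambda>v. v \<bullet> v)"
  then obtain m c where m: "\<forall>v\<in>S. m \<bullet> v + c \<le> v \<bullet> v" "Z = {v\<in>S. v \<bullet> v = m \<bullet> v + c}" "affine hull Z = UNIV"
    unfolding dcells_def by blast
  let ?c = "m /\<^sub>R 2"
  have iff: "norm (?c - v) \<le> norm (?c - x) \<longleftrightarrow> v \<bullet> v - m \<bullet> v \<le> x \<bullet> x - m \<bullet> x" for v x
    by (auto simp: norm_le inner_diff_left inner_diff_right inner_commute)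
  obtain z where "z \<in> Z" using m(3) by fastforce
  then have "Z = nearest S ?c" unfolding nearest_def iff using m by force
  then show "affine hull Z = UNIV \<and> (\<exists>c. Z = nearest S c)" using m by blast
next
  assume "affine hull Z = UNIV \<and> (\<exists>c. Z = nearest S c)"
  then show "Z \<in> dcells S (\<lambda>v. v \<bullet> v)" using nearest_dcells by blast
qed

lemma delaunay_cells_eq: "delaunay_cells S UNIV (int CARD('n)) = (hull) convex ` dcells S (\<lambda>v. v \<bullet> v)"
proof -
  have "aff_dim (convex hull X) = int CARD('n) \<longleftrightarrow> affine hull X = UNIV" for X :: "(real^'n) set"
    using aff_dim_eq_full[of "convex hull X"] by (simp add: affine_hull_convex_hull)
  then have "P \<in> delaunay_cells S UNIV (int CARD('n)) \<longleftrightarrow> P \<in> (hull) convex ` dcells S (\<lambda>v. v \<bullet> v)" for P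
    using nearest_dcells by (auto simp: delaunay_cells_iff) (auto simp: dcells_norm_iff)
  then show ?thesis by blast
qed

text \<open>After a translation by \<open>w\<close> the sphere passes through 0, and a vertex of the
  smallest face of the Voronoi polytope through \<open>c - w\<close> is the centre of a cell that
  spans.\<close>

lemma face_extend: "\<exists>Z\<in>dcells S (\<lambda>v. v \<bullet> v). convex hull (nearest S c) face_of convex hull Z"
proof -
  obtain w where w: "w \<in> nearest S c" using nearest_nonempty by blast
  have wS: "w \<in> S" using w by (simp add: nearest_def)
  have u: "c - w \<in> voronoi S" using nearest_diff_voronoi[OF w] .
  then obtain u' where u': "u' extreme_point_of vor" "tight S (c - w) \<subseteq> tight S u'"
    using extend_tight[of "c - w"] vor_eq by blast
  have u'': "u' \<in> voronoi S" "span (tight S u') = span S" using u'(1) vor_extreme_iff[of u'] vor_eq by auto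
  have "convex hull (tight S (c - w)) face_of convex hull (tight S u')"
    using tight_face_of u u'' u'(2) by blast
  then have "(+) w ` (convex hull (tight S (c - w))) face_of (+) w ` (convex hull (tight S u'))"
    by (simp add: face_of_translation_eq)
  then have "convex hull (nearest S (c - w + w)) face_of convex hull (nearest S (u' + w))"
    by (simp only: nearest_add[OF u wS] nearest_add[OF u''(1) wS] convex_hull_translation)
  moreover have "nearest S (u' + w) \<in> dcells S (\<lambda>v. v \<bullet> v)"
    using affine_hull_nearest[OF u''(1) wS u''(2)] full dcells_norm_iff by auto
  ultimately show ?thesis by auto
qed

end

section \<open>Lattices stretched along a unit vector\<close>

locale lattice_direction = full_lattice S for S :: "(real^'n::finite) set" +
  fixes e :: "real^'n"
  assumes unit: "norm e = 1"
begin

text \<open>The inverse of \<epsilon> \<mapsto> \<epsilon> (2 + \<epsilon>) on the nonnegative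
  reals.\<close>

definition eps :: "real \<Rightarrow> real" where "eps t = sqrt (1 + t) - 1"

lemma ee: "e \<bullet> e = 1" using unit by (simp add: dot_square_norm)

lemma extend_norm: "extend \<epsilon> e v \<bullet> extend \<epsilon> e v = qe e (\<epsilon> * (2 + \<epsilon>)) v"
  by (simp add: extend_def qe_def inner_add_left inner_add_right ee inner_commute power2_eq_square algebra_simps)

lemma eps: "0 \<le> t \<Longrightarrow> 0 \<le> eps t \<and> eps t * (2 + eps t) = t"
  by (simp add: eps_def algebra_simps)

lemma bij_extend: assumes "0 \<le> \<epsilon>" shows "bij (extend \<epsilon> e)"
proof -
  have "extend \<epsilon> e v = 0 \<Longrightarrow> v = 0" for v
  proof -
    assume "extend \<epsilon> e v = 0"
    then have "v \<bullet> v + \<epsilon> * (2 + \<epsilon>) * (e \<bullet> v)\<^sup>2 = 0" using extend_norm[of \<epsilon> v] by (simp add: qe_def)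
    moreover have "\<epsilon> * (2 + \<epsilon>) * (e \<bullet> v)\<^sup>2 \<ge> 0" using assms by simp
    ultimately have "v \<bullet> v \<le> 0" by linarith
    then show "v = 0" using inner_ge_zero[of v] by auto
  qed
  then have "inj (extend \<epsilon> e)" using linear_injective_0[OF linear_extend, of \<epsilon> e] by blast
  then show ?thesis using linear_injective_imp_surjective[OF linear_extend] by (simp add: bij_def)
qed

lemma full_lattice_extend: assumes "0 \<le> \<epsilon>" shows "full_lattice (extend \<epsilon> e ` S)"
proof
  have lin: "linear (extend \<epsilon> e)" by (rule linear_extend)
  show "0 \<in> extend \<epsilon> e ` S" using zero linear_0[OF lin] by force
  show "x - y \<in> extend \<epsilon> e ` S" if "x \<in> extend \<epsilon> e ` S" "y \<in> extend \<epsilon> e ` S" for x y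
    using that diff linear_diff[OF lin] by (auto simp: image_iff) metis
  show "finite (extend \<epsilon> e ` S \<inter> cball 0 r)" for r
  proof (rule finite_subset)
    show "extend \<epsilon> e ` S \<inter> cball 0 r \<subseteq> extend \<epsilon> e ` (S \<inter> cball 0 r)"
    proof -
      have "norm v \<le> norm (extend \<epsilon> e v)" for v
        using assms by (simp add: norm_le extend_norm qe_def)
      then have "x \<in> cball 0 r" if "extend \<epsilon> e x \<in> cball 0 r" for x
        using that by (metis mem_cball_0 order_trans)
      then show ?thesis by blast
    qed
    show "finite (extend \<epsilon> e ` (S \<inter> cball 0 r))" using fin by blast
  qed
  have "span (extend \<epsilon> e ` S) = extend \<epsilon> e ` UNIV" using linear_span_image[OF lin, of S] full by simp
  then show "span (extend \<epsilon> e ` S) = UNIV" using bij_is_surj[OF bij_extend[OF assms]] by simp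
qed

lemma comp_extend: "(\<lambda>v. v \<bullet> v) \<circ> extend \<epsilon> e = qe e (\<epsilon> * (2 + \<epsilon>))"
  by (simp add: fun_eq_iff extend_norm)

lemma dcells_extend: "0 \<le> \<epsilon> \<Longrightarrow> dcells (extend \<epsilon> e ` S) (\<lambda>v. v \<bullet> v) = (`) (extend \<epsilon> e) ` dcells S (qe e (\<epsilon> * (2 + \<epsilon>)))"
  using dcells_image[OF linear_extend bij_extend, of \<epsilon> S "\<lambda>v. v \<bullet> v"] comp_extend by simp

lemma star_extend: "0 \<le> \<epsilon> \<Longrightarrow> star (extend \<epsilon> e ` S) (\<lambda>v. v \<bullet> v) = (`) (extend \<epsilon> e) ` star S (qe e (\<epsilon> * (2 + \<epsilon>)))"
  using star_image[OF linear_extend bij_extend, of \<epsilon> S "\<lambda>v. v \<bullet> v"] comp_extend by simp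

lemma dcells_translate: "Z \<in> dcells S (qe e t) \<Longrightarrow> w \<in> S \<Longrightarrow> (\<lambda>v. v - w) ` Z \<in> dcells S (qe e t)"
  by (rule dcells_diff) (use add diff in auto)

lemma cover_qe: assumes "0 \<le> t" shows "\<exists>Z\<in>dcells S (qe e t). x \<in> convex hull Z"
proof -
  interpret E: full_lattice "extend (eps t) e ` S" using eps[OF assms] full_lattice_extend by blast
  obtain Z where Z: "Z \<in> dcells S (qe e t)" "extend (eps t) e x \<in> convex hull (extend (eps t) e ` Z)"
    using E.cover_dcells[of "extend (eps t) e x"] dcells_extend[of "eps t"] eps[OF assms] by auto
  then have "extend (eps t) e x \<in> extend (eps t) e ` (convex hull Z)"
    by (simp add: convex_hull_linear_image[OF linear_extend])
  then have "x \<in> convex hull Z" using bij_is_inj[OF bij_extend] eps[OF assms] by (metis inj_image_mem_iff)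
  then show ?thesis using Z by blast
qed

lemma cover_cone_qe:
  assumes "0 \<le> t"
  shows "\<exists>Z\<in>star S (qe e t). \<forall>d. (\<forall>v\<in>Z. d \<bullet> v \<le> 0) \<longrightarrow> d \<bullet> x \<le> 0"
proof -
  interpret E: full_lattice "extend (eps t) e ` S" using eps[OF assms] full_lattice_extend by blast
  obtain Z where Z: "Z \<in> star S (qe e t)"
    "\<And>d. (\<forall>v\<in>Z. d \<bullet> extend (eps t) e v \<le> 0) \<Longrightarrow> d \<bullet> extend (eps t) e x \<le> 0"
    using E.cover_cone[of "extend (eps t) e x"] star_extend[of "eps t"] eps[OF assms] by auto
  have "d \<bullet> x \<le> 0" if d: "\<forall>v\<in>Z. d \<bullet> v \<le> 0" for d
  proof -
    \<comment> \<open>The extension is symmetric and onto, so every functional is one on the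
      stretched space, pulled back.\<close>
    obtain d' where "d = extend (eps t) e d'"
      using bij_is_surj[OF bij_extend] eps[OF assms] by (metis surjD)
    then show ?thesis using d Z(2)[of d'] by (simp add: extend_symmetric)
  qed
  then show ?thesis using Z by blast
qed

lemma conv_mem_qe:
  assumes "0 \<le> t" "Z \<in> dcells S (qe e t)" "w \<in> S" "w \<in> convex hull Z"
  shows "w \<in> Z"
proof -
  obtain m c where m: "\<forall>v\<in>S. m \<bullet> v + c \<le> qe e t v" "Z = {v\<in>S. qe e t v = m \<bullet> v + c}"
    using assms unfolding dcells_def by blast
  have q: "extend (eps t) e v \<bullet> extend (eps t) e v = qe e t v" for v
    using extend_norm eps[OF assms(1)] by simp
  show ?thesis
    by (rule conv_mem[OF linear_extend bij_is_inj[OF bij_extend], of "eps t" Z m c])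
      (use m q eps[OF assms(1)] assms in auto)
qed

text \<open>A cell is recovered from its polytope as the set of all lattice points in it, whatever
  the parameter.\<close>

lemma inj_convex_hull_dcells:
  assumes "0 \<le> t" "Z \<in> dcells S (qe e t)" "0 \<le> t'" "Z' \<in> dcells S (qe e t')" "convex hull Z = convex hull Z'"
  shows "Z = Z'"
proof -
  have "Z \<subseteq> S" "Z' \<subseteq> S" using assms unfolding dcells_def by auto
  then show ?thesis using conv_mem_qe assms hull_inc[of _ Z convex] hull_inc[of _ Z' convex]
    by (intro set_eqI) (metis subsetD)
qed

lemma finite_star: assumes "0 \<le> t" shows "finite (star S (qe e t))"
proof -
  interpret E: full_lattice "extend (eps t) e ` S" using eps[OF assms] full_lattice_extend by blast
  have "finite ((`) (extend (eps t) e) ` star S (qe e t))"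
    using E.star_eq E.finite_vor_extreme E.vor_eq star_extend[of "eps t"] eps[OF assms] by simp
  moreover have "inj_on ((`) (extend (eps t) e)) X" for X
    using bij_is_inj[OF bij_extend] eps[OF assms] by (meson inj_on_def inj_image_eq_iff)
  ultimately show ?thesis using finite_image_iff by blast
qed

lemma finite_in_star: assumes "0 \<le> t" "Z \<in> star S (qe e t)" shows "finite Z"
proof -
  interpret E: full_lattice "extend (eps t) e ` S" using eps[OF assms(1)] full_lattice_extend by blast
  have "extend (eps t) e ` Z \<in> star (extend (eps t) e ` S) (\<lambda>v. v \<bullet> v)"
    using assms star_extend[of "eps t"] eps[OF assms(1)] by simp
  then have "finite (extend (eps t) e ` Z)" unfolding E.star_eq using E.finite_tight by auto
  then show ?thesis using bij_is_inj[OF bij_extend] eps[OF assms(1)] by (meson finite_imageD inj_on_subset subset_UNIV)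
qed

end

section \<open>Laminae and stretched forms\<close>

locale lattice_hyperplane = lattice_direction S e for S :: "(real^'n::finite) set" and e +
  assumes span_hyperplane: "span (S \<inter> {x. e \<bullet> x = 0}) = {x. e \<bullet> x = 0}"
begin

abbreviation H :: "(real^'n) set" where "H \<equiv> {x. e \<bullet> x = 0}"

sublocale h: discrete_lattice "S \<inter> H"
proof
  show "0 \<in> S \<inter> H" using zero by simp
  show "x - y \<in> S \<inter> H" if "x \<in> S \<inter> H" "y \<in> S \<inter> H" for x y
    using that diff by (simp add: inner_diff_right)
  show "finite (S \<inter> H \<inter> cball 0 r)" for r
    by (rule finite_subset[OF _ fin[of r]]) auto
qed

lemma e_nonzero: "e \<noteq> 0" using unit by auto

lemma aff_dim_hyperplane_e: "aff_dim H = int CARD('n) - 1"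
  using aff_dim_hyperplane[OF e_nonzero, of 0] by simp

lemma card_pos: "0 \<le> int CARD('n) - 1" by (simp add: Suc_leI)

lemma affine_hull_imp_cell:
  assumes "c \<in> H" "affine hull (nearest (S \<inter> H) c) = H"
  shows "convex hull (nearest (S \<inter> H) c) \<in> delaunay_cells (S \<inter> H) H (int CARD('n) - 1)"
proof -
  have "aff_dim (convex hull (nearest (S \<inter> H) c)) = int CARD('n) - 1"
    using assms(2) aff_dim_hyperplane_e by (metis aff_dim_affine_hull aff_dim_convex_hull)
  then show ?thesis using assms(1) h.delaunay_cells_iff[OF card_pos] by blast
qed

text \<open>Otherwise a translate of \<open>H\<close> meets the interior of the cell; but \<open>H\<close> is covered by faces of cells.\<close>
lemma lamina_slab:
  assumes lam: "lamina S H" and Z: "Z \<in> dcells S (qe e 0)" and uvw: "v \<in> S" "u \<in> Z" "w \<in> Z"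
  shows "\<not> (e \<bullet> u < e \<bullet> v \<and> e \<bullet> v < e \<bullet> w)"
proof
  assume *: "e \<bullet> u < e \<bullet> v \<and> e \<bullet> v < e \<bullet> w"
  let ?Z = "(\<lambda>x. x - v) ` Z"
  have Z': "?Z \<in> dcells S (qe e 0)" using dcells_translate Z uvw by blast
  then have aff: "affine hull ?Z = UNIV" unfolding dcells_def by blast
  obtain p where p: "p \<in> interior (convex hull ?Z)" using interior_convex_hull_nonempty[OF aff] by blast
  have uw: "u - v \<in> convex hull ?Z" "w - v \<in> convex hull ?Z" using uvw by (auto intro!: hull_inc)
  have "\<exists>x\<in>interior (convex hull ?Z). e \<bullet> x = 0"
  proof (cases "e \<bullet> p" "0::real" rule: linorder_cases)
    case equal then show ?thesis using p by blast
  next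
    case less
    then have "(e \<bullet> p) * (e \<bullet> (w - v)) < 0" using * by (intro mult_neg_pos) (auto simp: inner_diff_right)
    then show ?thesis using interior_convex_zero_point[OF convex_convex_hull p uw(2)] by blast
  next
    case greater
    then have "(e \<bullet> p) * (e \<bullet> (u - v)) < 0" using * by (intro mult_pos_neg) (auto simp: inner_diff_right)
    then show ?thesis using interior_convex_zero_point[OF convex_convex_hull p uw(1)] by blast
  qed
  then obtain x where x: "x \<in> interior (convex hull ?Z)" "x \<in> H" by blast
  obtain c where c: "c \<in> H" "x \<in> convex hull (nearest (S \<inter> H) c)" "affine hull (nearest (S \<inter> H) c) = H"
    using h.cover[of x] x(2) span_hyperplane by auto
  let ?P = "convex hull (nearest (S \<inter> H) c)"
  have P: "?P \<in> delaunay_cells (S \<inter> H) H (int CARD('n) - 1)" using affine_hull_imp_cell c by blast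
  then obtain Z2 where Z2: "Z2 \<in> dcells S (qe e 0)" "?P face_of convex hull Z2"
    using lam delaunay_cells_eq unfolding lamina_def qe_zero by auto
  have "x \<in> convex hull Z2" using c(2) Z2(2) face_of_imp_subset by blast
  then have eq: "?Z = Z2" using dcells_unique[OF Z' Z2(1) x(1)] by blast
  \<comment> \<open>The affine hulls show that \<open>?P\<close> is a proper face, which cannot meet
    the interior.\<close>
  have "affine hull (convex hull ?Z) \<noteq> affine hull ?P"
  proof -
    have "affine hull ?P = H" "affine hull (convex hull ?Z) = UNIV"
      using c(3) aff by (auto simp: affine_hull_convex_hull)
    moreover have "e \<notin> H" using ee by simp
    ultimately show ?thesis by blast
  qed
  then have "?P \<noteq> convex hull ?Z" by metis
  then have "?P \<inter> interior (convex hull ?Z) = {}" using face_of_disjoint_interior Z2(2) eq by blast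
  then show False using c(2) x(1) by blast
qed

text \<open>On a cell, \<open>e \<bullet> v\<close> takes only two values \<open>\<alpha>\<close>, \<open>\<beta>\<close>, and \<open>(e \<bullet> v - \<alpha>) * (e \<bullet> v - \<beta>)\<close>, which is
  nonnegative on the lattice, can be added to the defining inequality.\<close>
lemma lamina_imp_subset:
  assumes lam: "lamina S H" and t: "0 \<le> t"
  shows "dcells S (qe e 0) \<subseteq> dcells S (qe e t)"
proof
  fix Z assume Z: "Z \<in> dcells S (qe e 0)"
  obtain m c where m: "\<forall>v\<in>S. m \<bullet> v + c \<le> qe e 0 v" "Z = {v\<in>S. qe e 0 v = m \<bullet> v + c}" "affine hull Z = UNIV"
    using Z unfolding dcells_def by blast
  have "\<exists>z1\<in>Z. \<exists>z2\<in>Z. e \<bullet> z1 < e \<bullet> z2"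
  proof (rule ccontr)
    assume "\<not> (\<exists>z1\<in>Z. \<exists>z2\<in>Z. e \<bullet> z1 < e \<bullet> z2)"
    then have *: "\<And>z1 z2. z1 \<in> Z \<Longrightarrow> z2 \<in> Z \<Longrightarrow> e \<bullet> z1 = e \<bullet> z2" by (meson linorder_neqE)
    obtain z where "z \<in> Z" using m(3) by fastforce
    then have "Z \<subseteq> {x. e \<bullet> x = e \<bullet> z}" using * by blast
    then have "UNIV \<subseteq> {x. e \<bullet> x = e \<bullet> z}" using hull_minimal[of Z _ affine] affine_hyperplane m(3) by metis
    then have "e \<bullet> (z + e) = e \<bullet> z" by blast
    then show False using ee by (simp add: inner_add_right)
  qed
  then obtain z1 z2 where z: "z1 \<in> Z" "z2 \<in> Z" "e \<bullet> z1 < e \<bullet> z2" by blast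
  have zS: "z1 \<in> S" "z2 \<in> S" using z m(2) by auto
  let ?a = "e \<bullet> z1" and ?b = "e \<bullet> z2"
  have Zab: "e \<bullet> v = ?a \<or> e \<bullet> v = ?b" if "v \<in> Z" for v
  proof -
    have "v \<in> S" using that m(2) by blast
    then show ?thesis using lamina_slab[OF lam Z] z zS that by (metis linorder_neqE)
  qed
  have S0: "(e \<bullet> v - ?a) * (e \<bullet> v - ?b) \<ge> 0" if "v \<in> S" for v
  proof -
    have "e \<bullet> v \<le> ?a \<or> e \<bullet> v \<ge> ?b" using lamina_slab[OF lam Z that z(1,2)] by linarith
    then show ?thesis using z(3) by (auto simp: zero_le_mult_iff)
  qed
  \<comment> \<open>In the product (e \<bullet> v - ?a) (e \<bullet> v - ?b) all terms but the
    square of e \<bullet> v are affine in \<open>v\<close>; they are absorbed by the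
    minorant.\<close>
  define m' c' where "m' = m + (t * (?a + ?b)) *\<^sub>R e" and "c' = c - t * (?a * ?b)"
  have eq: "qe e t v - m' \<bullet> v - c' = (qe e 0 v - m \<bullet> v - c) + t * ((e \<bullet> v - ?a) * (e \<bullet> v - ?b))" for v
    by (simp add: m'_def c'_def qe_def inner_add_left power2_eq_square algebra_simps)
  have S1: "t * ((e \<bullet> v - ?a) * (e \<bullet> v - ?b)) \<ge> 0" if "v \<in> S" for v
    using S0[OF that] t by simp
  have "m' \<bullet> v + c' \<le> qe e t v" if "v \<in> S" for v
    using eq[of v] S1[OF that] m(1) that by (smt (verit))
  moreover have "Z = {v\<in>S. qe e t v = m' \<bullet> v + c'}"
  proof (intro set_eqI iffI)
    fix v assume v: "v \<in> Z"
    then have "(e \<bullet> v - ?a) * (e \<bullet> v - ?b) = 0" using Zab by auto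
    then show "v \<in> {v\<in>S. qe e t v = m' \<bullet> v + c'}" using eq[of v] v m(2) by auto
  next
    fix v assume v: "v \<in> {v\<in>S. qe e t v = m' \<bullet> v + c'}"
    then have "qe e 0 v - m \<bullet> v - c \<le> 0" using eq[of v] S1[of v] by auto
    then show "v \<in> Z" using m v by force
  qed
  ultimately show "Z \<in> dcells S (qe e t)" using m(3) unfolding dcells_def by blast
qed

text \<open>The cells for parameter 0 already cover space and are cells for \<open>t\<close> by the
  previous lemma. An interior point of any cell for \<open>t\<close> lies in one of them, so the two
  coincide.\<close>

lemma lamina_imp_dcells:
  assumes lam: "lamina S H" and t: "0 \<le> t"
  shows "dcells S (qe e t) = dcells S (qe e 0)"
proof
  show "dcells S (qe e t) \<subseteq> dcells S (qe e 0)"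
  proof
    fix Z assume Z: "Z \<in> dcells S (qe e t)"
    then obtain p where p: "p \<in> interior (convex hull Z)"
      using interior_convex_hull_nonempty[of Z] unfolding dcells_def by blast
    obtain Z2 where Z2: "Z2 \<in> dcells S (qe e 0)" "p \<in> convex hull Z2" using cover_qe[of 0 p] by auto
    then have "Z = Z2" using dcells_unique[OF Z _ p] lamina_imp_subset[OF lam t] by blast
    then show "Z \<in> dcells S (qe e 0)" using Z2 by simp
  qed
qed (rule lamina_imp_subset[OF lam t])

lemma large_stretch:
  assumes c: "c \<in> H"
  shows "\<exists>t\<ge>0. \<forall>v\<in>S. e \<bullet> v \<noteq> 0 \<longrightarrow> r < (c - v) \<bullet> (c - v) + t * (e \<bullet> v)\<^sup>2"
proof -
  \<comment> \<open>Outside this ball the distance to \<open>c\<close> alone is large enough; inside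
    it there are finitely many points off \<open>H\<close>, and \<open>t\<close> is chosen above all
    their quotients.\<close>
  let ?B = "{v \<in> S \<inter> cball c (sqrt \<bar>r\<bar>). e \<bullet> v \<noteq> 0}"
  have "finite ?B" by (rule finite_subset[OF _ fin_cball]) auto
  then have "bdd_above ((\<lambda>v. \<bar>r\<bar> / (e \<bullet> v)\<^sup>2) ` ?B)" by (intro bdd_above_finite finite_imageI)
  then obtain M where M: "\<And>v. v \<in> ?B \<Longrightarrow> \<bar>r\<bar> / (e \<bullet> v)\<^sup>2 \<le> M" by (auto simp: bdd_above_def)
  define t where "t = max M 0 + 1"
  have "r < (c - v) \<bullet> (c - v) + t * (e \<bullet> v)\<^sup>2" if v: "v \<in> S" "e \<bullet> v \<noteq> 0" for v
  proof (cases "v \<in> ?B")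
    case True
    have "\<bar>r\<bar> / (e \<bullet> v)\<^sup>2 < t" using M[OF True] unfolding t_def by linarith
    then have "\<bar>r\<bar> < t * (e \<bullet> v)\<^sup>2" using v(2) by (simp add: divide_less_eq)
    moreover have "0 \<le> (c - v) \<bullet> (c - v)" by simp
    ultimately show ?thesis by linarith
  next
    case False
    then have "sqrt \<bar>r\<bar> < norm (c - v)" using v by (auto simp: dist_norm)
    then have "\<bar>r\<bar> < (c - v) \<bullet> (c - v)"
      by (simp add: norm_eq_sqrt_inner)
    moreover have "0 \<le> t * (e \<bullet> v)\<^sup>2" by (simp add: t_def)
    ultimately show ?thesis by linarith
  qed
  then show ?thesis by (intro exI[of _ t]) (auto simp: t_def)
qed

text \<open>For large \<open>t\<close> the lattice points off \<open>H\<close> are so far away that every empty sphere of the section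
  \<open>S \<inter> H\<close>, with centre in \<open>H\<close>, is empty in the whole lattice.\<close>
lemma dcells_imp_lamina:
  assumes eq: "\<And>t. 0 \<le> t \<Longrightarrow> dcells S (qe e t) = dcells S (qe e 0)"
  shows "lamina S H"
  unfolding lamina_def
proof
  fix P assume "P \<in> delaunay_cells (S \<inter> H) H (int CARD('n) - 1)"
  then obtain c where c: "c \<in> H" "P = convex hull (nearest (S \<inter> H) c)"
    using h.delaunay_cells_iff[OF card_pos] by blast
  obtain w where w: "w \<in> nearest (S \<inter> H) c" using h.nearest_nonempty by blast
  obtain t where t: "0 \<le> t" "\<And>v. v \<in> S \<Longrightarrow> e \<bullet> v \<noteq> 0 \<Longrightarrow> (c - w) \<bullet> (c - w) < (c - v) \<bullet> (c - v) + t * (e \<bullet> v)\<^sup>2"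
    using large_stretch[OF c(1)] by meson
  let ?A = "extend (eps t) e"
  interpret E: full_lattice "?A ` S" using eps[OF t(1)] full_lattice_extend by blast
  have norm_A: "(c - ?A v) \<bullet> (c - ?A v) = (c - v) \<bullet> (c - v) + t * (e \<bullet> v)\<^sup>2" for v
  proof -
    have "?A (c - v) = ?A c - ?A v" by (rule linear_diff[OF linear_extend])
    then have "c - ?A v = ?A (c - v)" using extend_fixes[of e c] c(1) by simp
    then have "(c - ?A v) \<bullet> (c - ?A v) = qe e t (c - v)" using extend_norm[of "eps t"] eps[OF t(1)] by simp
    then show ?thesis using c(1) by (simp add: qe_def inner_diff_right)
  qed
  have wSH: "w \<in> S" "e \<bullet> w = 0" using w by (auto simp: nearest_def)
  have le: "(c - w) \<bullet> (c - w) \<le> (c - ?A v) \<bullet> (c - ?A v)" if "v \<in> S" for v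
  proof (cases "e \<bullet> v = 0")
    case True
    then show ?thesis using w that unfolding norm_A nearest_def by (auto simp: norm_le)
  next
    case False then show ?thesis using t(2)[OF that False] unfolding norm_A by simp
  qed
  have "nearest (?A ` S) c = ?A ` nearest (S \<inter> H) c"
  proof (intro set_eqI iffI)
    fix y assume "y \<in> nearest (?A ` S) c"
    then obtain v where v: "v \<in> S" "y = ?A v" "norm (c - ?A v) \<le> norm (c - ?A w)"
      using wSH unfolding nearest_def by auto
    have "?A w = w" by (rule extend_fixes[OF wSH(2)])
    then have le2: "(c - v) \<bullet> (c - v) + t * (e \<bullet> v)\<^sup>2 \<le> (c - w) \<bullet> (c - w)"
      using v(3) by (simp add: norm_le norm_A[symmetric])
    then have ev: "e \<bullet> v = 0" using t(2)[OF v(1)] by force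
    then have "norm (c - v) \<le> norm (c - w)" using le2 by (simp add: norm_le)
    moreover have "norm (c - w) \<le> norm (c - x)" if "x \<in> S \<inter> H" for x
      using w that unfolding nearest_def by blast
    ultimately have "norm (c - v) \<le> norm (c - x)" if "x \<in> S \<inter> H" for x
      using that by (meson order_trans)
    then have "v \<in> nearest (S \<inter> H) c" using v(1) ev unfolding nearest_def by simp
    then show "y \<in> ?A ` nearest (S \<inter> H) c" using v(2) by blast
  next
    fix y assume "y \<in> ?A ` nearest (S \<inter> H) c"
    then obtain v where v: "v \<in> nearest (S \<inter> H) c" "y = ?A v" by blast
    then have vS: "v \<in> S" "e \<bullet> v = 0" by (auto simp: nearest_def)
    then have yv: "y = v" using v(2) by (simp add: extend_fixes)
    have "norm (c - y) \<le> norm (c - w)" using v(1) w yv by (auto simp: nearest_def)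
    then have "(c - y) \<bullet> (c - y) \<le> (c - ?A x) \<bullet> (c - ?A x)" if "x \<in> S" for x
      using le[OF that] by (simp add: norm_le)
    then show "y \<in> nearest (?A ` S) c" unfolding nearest_def using v(2) vS(1) by (auto simp: norm_le)
  qed
  \<comment> \<open>The section is fixed by the stretching, so its polytope is a face of a stretched
    cell. Pulled back, this is a cell for \<open>t\<close>, hence by assumption one of the original
    cells.\<close>
  then obtain Z' where Z': "Z' \<in> dcells (?A ` S) (\<lambda>v. v \<bullet> v)" "convex hull (?A ` nearest (S \<inter> H) c) face_of convex hull Z'"
    using E.face_extend[of c] by auto
  then obtain Z where Z: "Z \<in> dcells S (qe e t)" "Z' = ?A ` Z" using dcells_extend[of "eps t"] eps[OF t(1)] by auto
  have inj_A: "inj ?A" using eps[OF t(1)] bij_is_inj[OF bij_extend, of "eps t"] by simp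
  have "?A ` (convex hull (nearest (S \<inter> H) c)) face_of ?A ` (convex hull Z)"
    using Z'(2) Z(2) by (simp add: convex_hull_linear_image[OF linear_extend])
  then have "P face_of convex hull Z"
    by (simp only: c(2) face_of_linear_image[OF linear_extend inj_A])
  moreover have "Z \<in> dcells S (\<lambda>v. v \<bullet> v)" using Z(1) unfolding eq[OF t(1)] qe_zero .
  ultimately show "\<exists>Q\<in>delaunay_cells S UNIV (int CARD('n)). P face_of Q"
    using delaunay_cells_eq by blast
qed

lemma lamina_iff_dcells: "lamina S H \<longleftrightarrow> (\<forall>t\<ge>0. dcells S (qe e t) = dcells S (qe e 0))"
  using lamina_imp_dcells dcells_imp_lamina by blast

end

section \<open>Face posets of Voronoi polytopes\<close>

text \<open>Faces of two different polytopes are compared only through their codes, which form one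
  common family.\<close>

lemma poset_iso_from_embeddings:
  fixes f :: "'a set \<Rightarrow> 'c set" and g :: "'b set \<Rightarrow> 'c set"
  assumes f: "\<And>F F'. F \<in> X \<Longrightarrow> F' \<in> X \<Longrightarrow> F \<subseteq> F' \<longleftrightarrow> f F \<subseteq> f F'"
    and g: "\<And>F F'. F \<in> Y \<Longrightarrow> F' \<in> Y \<Longrightarrow> F \<subseteq> F' \<longleftrightarrow> g F \<subseteq> g F'"
    and eq: "f ` X = g ` Y"
  shows "\<exists>\<phi>. bij_betw \<phi> X Y \<and> (\<forall>F\<in>X. \<forall>F'\<in>X. F \<subseteq> F' \<longleftrightarrow> \<phi> F \<subseteq> \<phi> F')"
proof -
  have "inj_on f X" by (rule inj_onI) (metis f order_antisym order_refl)
  then have bf: "bij_betw f X (g ` Y)" using eq by (simp add: bij_betw_def)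
  have "inj_on g Y" by (rule inj_onI) (metis g order_antisym order_refl)
  then have bg: "bij_betw (inv_into Y g) (g ` Y) Y" by (intro bij_betw_inv_into) (simp add: bij_betw_def)
  let ?\<phi> = "inv_into Y g \<circ> f"
  have b: "bij_betw ?\<phi> X Y" using bij_betw_trans[OF bf bg] .
  have g\<phi>: "g (?\<phi> F) = f F" if "F \<in> X" for F
    using that eq by (metis comp_apply f_inv_into_f imageI)
  have "F \<subseteq> F' \<longleftrightarrow> ?\<phi> F \<subseteq> ?\<phi> F'" if "F \<in> X" "F' \<in> X" for F F'
    using f[OF that] g[of "?\<phi> F" "?\<phi> F'"] g\<phi>[OF that(1)] g\<phi>[OF that(2)] b that bij_betw_apply by metis
  then show ?thesis using b by blast
qed

text \<open>Extreme points are the atoms above the least face \<open>{}\<close>, a notion that an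
  order isomorphism preserves.\<close>

lemma same_face_poset_card_extreme:
  assumes P: "compact P" "convex P" and Q: "compact Q" "convex Q" and iso: "same_face_poset P Q"
  shows "card {x. x extreme_point_of P} = card {x. x extreme_point_of Q}"
proof -
  define faces where "faces R = {F. F face_of R}" for R :: "(real^'a) set"
  define atoms where "atoms R = {F \<in> faces R. F \<noteq> {} \<and> (\<forall>F'\<in>faces R. F' \<subseteq> F \<longrightarrow> F' = {} \<or> F' = F)}"
    for R :: "(real^'a) set"
  have atoms_eq: "atoms R = (\<lambda>x. {x}) ` {x. x extreme_point_of R}" if R: "compact R" "convex R" for R
  proof (intro set_eqI iffI)
    fix F assume F: "F \<in> atoms R"
    then have F': "F face_of R" "F \<noteq> {}" by (auto simp: atoms_def faces_def)
    then obtain x where x: "x extreme_point_of F"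
      using extreme_point_exists_convex[of F] face_of_imp_compact[OF R(2,1)] face_of_imp_convex by blast
    then have "x extreme_point_of R" "x \<in> F" using extreme_point_of_face[OF F'(1)] by auto
    moreover have "{x} \<in> faces R" using calculation(1) by (simp add: faces_def face_of_singleton)
    ultimately have "F = {x}" using F unfolding atoms_def by blast
    then show "F \<in> (\<lambda>x. {x}) ` {x. x extreme_point_of R}" using \<open>x extreme_point_of R\<close> by blast
  next
    fix F assume "F \<in> (\<lambda>x. {x}) ` {x. x extreme_point_of R}"
    then show "F \<in> atoms R" by (auto simp: atoms_def faces_def face_of_singleton)
  qed
  from iso[unfolded same_face_poset_def, folded faces_def] obtain \<phi>
    where \<phi>: "bij_betw \<phi> (faces P) (faces Q) \<and> (\<forall>F\<in>faces P. \<forall>F'\<in>faces P. F \<subseteq> F' \<longleftrightarrow> \<phi> F \<subseteq> \<phi> F')"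
    by (rule exE)
  then have bij: "bij_betw \<phi> (faces P) (faces Q)" by (rule conjunct1)
  have ord: "F \<subseteq> F' \<longleftrightarrow> \<phi> F \<subseteq> \<phi> F'" if "F \<in> faces P" "F' \<in> faces P" for F F'
    using \<phi> that by simp
  have inj: "inj_on \<phi> (faces P)" and im: "\<phi> ` faces P = faces Q" using bij by (auto simp: bij_betw_def)
  have e: "{} \<in> faces P" "{} \<in> faces Q" by (auto simp: faces_def)
  have \<phi>e: "\<phi> {} = {}"
  proof -
    have "{} \<in> \<phi> ` faces P" using im e(2) by simp
    then obtain F where "F \<in> faces P" "\<phi> F = {}" by auto
    then show ?thesis using ord[OF e(1)] by blast
  qed
  have atom_iff: "\<phi> F \<in> atoms Q \<longleftrightarrow> F \<in> atoms P" if F: "F \<in> faces P" for F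
  proof -
    have Fe: "\<phi> F = {} \<longleftrightarrow> F = {}" using inj_on_eq_iff[OF inj F e(1)] \<phi>e by simp
    have "(\<forall>G\<in>faces Q. G \<subseteq> \<phi> F \<longrightarrow> G = {} \<or> G = \<phi> F) \<longleftrightarrow> (\<forall>F'\<in>faces P. \<phi> F' \<subseteq> \<phi> F \<longrightarrow> \<phi> F' = {} \<or> \<phi> F' = \<phi> F)"
      unfolding im[symmetric] by blast
    also have "\<dots> \<longleftrightarrow> (\<forall>F'\<in>faces P. F' \<subseteq> F \<longrightarrow> F' = {} \<or> F' = F)"
    proof (rule ball_cong[OF refl])
      fix F' assume F': "F' \<in> faces P"
      have "F' \<subseteq> F \<longleftrightarrow> \<phi> F' \<subseteq> \<phi> F" "\<phi> F' = \<phi> F \<longleftrightarrow> F' = F" "\<phi> F' = {} \<longleftrightarrow> F' = {}"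
        using ord[OF F' F] inj_on_eq_iff[OF inj F' F] inj_on_eq_iff[OF inj F' e(1)] \<phi>e by simp_all
      then show "(\<phi> F' \<subseteq> \<phi> F \<longrightarrow> \<phi> F' = {} \<or> \<phi> F' = \<phi> F) \<longleftrightarrow> (F' \<subseteq> F \<longrightarrow> F' = {} \<or> F' = F)"
        by (simp only:)
    qed
    finally have R: "(\<forall>G\<in>faces Q. G \<subseteq> \<phi> F \<longrightarrow> G = {} \<or> G = \<phi> F) \<longleftrightarrow> (\<forall>F'\<in>faces P. F' \<subseteq> F \<longrightarrow> F' = {} \<or> F' = F)" .
    have "\<phi> F \<in> faces Q" using F im by blast
    then show ?thesis unfolding atoms_def mem_Collect_eq R using Fe F by (simp only: simp_thms)
  qed
  have "bij_betw \<phi> (atoms P) (atoms Q)"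
    unfolding bij_betw_def
  proof
    show "inj_on \<phi> (atoms P)" using inj by (rule inj_on_subset) (auto simp: atoms_def)
    show "\<phi> ` atoms P = atoms Q"
    proof (intro set_eqI iffI)
      fix G assume "G \<in> \<phi> ` atoms P" then show "G \<in> atoms Q" using atom_iff by (auto simp: atoms_def)
    next
      fix G assume G: "G \<in> atoms Q"
      then have "G \<in> \<phi> ` faces P" using im by (auto simp: atoms_def)
      then show "G \<in> \<phi> ` atoms P" using atom_iff G by blast
    qed
  qed
  then have "card (atoms P) = card (atoms Q)" by (rule bij_betw_same_card)
  then show ?thesis by (simp add: atoms_eq P Q card_image)
qed

context full_lattice begin

text \<open>A face is encoded by the star cells dual to its vertices; by \<open>cells_at_faces\<close> below the possible codes
  depend only on the star, so lattices with corresponding stars have isomorphic face posets.\<close>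
definition cells_at :: "(real^'n) set \<Rightarrow> (real^'n) set set" where
  "cells_at F = tight S ` {m. m extreme_point_of voronoi S \<and> m \<in> F}"

text \<open>A face is the convex hull of its vertices, and vertices are determined by their dual
  cells.\<close>

lemma cells_at_subset_iff:
  assumes "F face_of voronoi S" "F' face_of voronoi S"
  shows "F \<subseteq> F' \<longleftrightarrow> cells_at F \<subseteq> cells_at F'"
proof
  show "F \<subseteq> F' \<Longrightarrow> cells_at F \<subseteq> cells_at F'" unfolding cells_at_def by blast
next
  assume sub: "cells_at F \<subseteq> cells_at F'"
  have comp: "compact F" "convex F" "convex F'"
    using assms face_of_imp_compact[OF convex_vor compact_vor] face_of_imp_convex unfolding vor_eq by blast+
  have "{x. x extreme_point_of F} \<subseteq> F'"
  proof
    fix m assume "m \<in> {x. x extreme_point_of F}"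
    then have m: "m extreme_point_of voronoi S" "m \<in> F" using extreme_point_of_face[OF assms(1)] by auto
    then have "tight S m \<in> cells_at F'" using sub unfolding cells_at_def by blast
    then obtain m' where m': "m' extreme_point_of voronoi S" "m' \<in> F'" "tight S m = tight S m'"
      unfolding cells_at_def by blast
    then show "m \<in> F'" using inj_tight m by (metis inj_onD mem_Collect_eq)
  qed
  then have "convex hull {x. x extreme_point_of F} \<subseteq> F'" using comp(3) by (simp add: subset_hull)
  then show "F \<subseteq> F'" using Krein_Milman_Minkowski[OF comp(1,2)] by simp
qed

text \<open>Take \<open>T\<close> to be the tight set of a relative interior point
  \<open>m0\<close>. Constraints tight at \<open>m0\<close> are tight on all of \<open>F\<close>.
  Conversely, from a point \<open>x\<close> at which they are tight, the segment to
  \<open>m0\<close> can be prolonged beyond \<open>m0\<close>, so the face property puts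
  \<open>x\<close> into \<open>F\<close>.\<close>

lemma face_eq_tight:
  assumes F: "F face_of voronoi S" "F \<noteq> {}"
  obtains T where "T \<subseteq> S" "F = {x \<in> voronoi S. T \<subseteq> tight S x}"
proof -
  have conv: "convex F" using F face_of_imp_convex by blast
  then obtain m0 where m0: "m0 \<in> rel_interior F" using F rel_interior_eq_empty by blast
  then have m0F: "m0 \<in> F" using rel_interior_subset by blast
  have FV: "F \<subseteq> voronoi S" using F face_of_imp_subset by blast
  have "F = {x \<in> voronoi S. tight S m0 \<subseteq> tight S x}"
  proof (intro set_eqI iffI)
    fix x assume x: "x \<in> F"
    obtain s where s: "s > 1" "(1 - s) *\<^sub>R x + s *\<^sub>R m0 \<in> F" using m0 x convex_rel_interior_iff[OF conv F(2)] by blast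
    have "tight S m0 \<subseteq> tight S x"
    proof
      fix v assume "v \<in> tight S m0"
      then have v: "v \<in> S" "2 * (m0 \<bullet> v) = v \<bullet> v" by (auto simp: tight_def)
      have "2 * (((1 - s) *\<^sub>R x + s *\<^sub>R m0) \<bullet> v) \<le> v \<bullet> v" using s(2) FV v(1) voronoi_iff by blast
      then have "(1 - s) * (2 * (x \<bullet> v)) + s * (v \<bullet> v) \<le> v \<bullet> v"
        unfolding v(2)[symmetric] by (simp add: inner_add_left algebra_simps)
      then have "0 \<le> (s - 1) * (2 * (x \<bullet> v) - v \<bullet> v)" by (simp add: algebra_simps)
      then have "v \<bullet> v \<le> 2 * (x \<bullet> v)" using s(1) by (simp add: zero_le_mult_iff)
      moreover have "2 * (x \<bullet> v) \<le> v \<bullet> v" using x FV v(1) voronoi_iff by blast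
      ultimately show "v \<in> tight S x" using v(1) by (simp add: tight_def)
    qed
    then show "x \<in> {x \<in> voronoi S. tight S m0 \<subseteq> tight S x}" using x FV by blast
  next
    fix x assume x: "x \<in> {x \<in> voronoi S. tight S m0 \<subseteq> tight S x}"
    show "x \<in> F"
    proof (cases "x = m0")
      case False
      have "(m0 - x) \<bullet> v \<le> 0" if "v \<in> tight S m0" for v
      proof -
        have "2 * (m0 \<bullet> v) = v \<bullet> v" "2 * (x \<bullet> v) = v \<bullet> v" using that x by (auto simp: tight_def)
        then show ?thesis by (simp add: inner_diff_left)
      qed
      then obtain \<delta> where d: "\<delta> > 0" "m0 + \<delta> *\<^sub>R (m0 - x) \<in> voronoi S"
        using voronoi_move[of m0 "m0 - x"] m0F FV by blast
      let ?y = "m0 + \<delta> *\<^sub>R (m0 - x)" and ?u = "1 / (1 + \<delta>)"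
      have "x \<noteq> ?y"
      proof
        assume "x = ?y"
        then have "(1 + \<delta>) *\<^sub>R (m0 - x) = 0" by (simp add: algebra_simps)
        then show False using d(1) False by simp
      qed
      moreover have "m0 = (1 - ?u) *\<^sub>R x + ?u *\<^sub>R ?y"
      proof -
        have "(1 - ?u) *\<^sub>R x + ?u *\<^sub>R ?y = x + ?u *\<^sub>R ((1 + \<delta>) *\<^sub>R (m0 - x))" by (simp add: algebra_simps)
        also have "\<dots> = x + (?u * (1 + \<delta>)) *\<^sub>R (m0 - x)" by (simp only: scaleR_scaleR)
        also have "\<dots> = m0" using d(1) by simp
        finally show ?thesis by simp
      qed
      moreover have "0 < ?u" "?u < 1" using d(1) by auto
      ultimately have "m0 \<in> open_segment x ?y" unfolding in_segment by blast
      then show ?thesis using face_ofD[OF F(1)] m0F x d(2) by blast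
    qed (use m0F in simp)
  qed
  moreover have "tight S m0 \<subseteq> S" by (auto simp: tight_def)
  ultimately show ?thesis using that by blast
qed

lemma cells_at_tight: "cells_at {x \<in> voronoi S. T \<subseteq> tight S x} = {Z \<in> star S (\<lambda>v. v \<bullet> v). T \<subseteq> Z}"
  unfolding cells_at_def star_eq by (auto simp: extreme_point_of_def)

text \<open>One side of the tightness equation is linear in \<open>v\<close> and the other
  quadratic, so \<open>v\<close> and \<open>v + v\<close> are both tight only if
  \<open>v = 0\<close>. Hence \<open>T = S\<close> yields the code of the empty face.\<close>

lemma not_subset_tight: "\<not> S \<subseteq> tight S m"
proof
  assume sub: "S \<subseteq> tight S m"
  have "v = 0" if "v \<in> S" for v
  proof -
    have "v + v \<in> S" using add that by blast
    then have "2 * (m \<bullet> (v + v)) = (v + v) \<bullet> (v + v)" "2 * (m \<bullet> v) = v \<bullet> v" using sub that by (auto simp: tight_def)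
    then have "v \<bullet> v = 0" unfolding inner_add_right inner_add_left by argo
    then show ?thesis by simp
  qed
  then have "span S \<subseteq> {0}" by (intro span_minimal) (auto simp: subspace_def)
  moreover have "axis undefined 1 \<in> span S" "axis undefined 1 \<noteq> (0::real^'n)" using full by (auto simp: axis_eq_0_iff)
  ultimately show False by blast
qed

lemma cells_at_faces:
  "cells_at ` {F. F face_of voronoi S} = (\<lambda>T. {Z \<in> star S (\<lambda>v. v \<bullet> v). T \<subseteq> Z}) ` Pow S"
proof (intro set_eqI iffI)
  fix C assume "C \<in> cells_at ` {F. F face_of voronoi S}"
  then obtain F where F: "F face_of voronoi S" "C = cells_at F" by blast
  show "C \<in> (\<lambda>T. {Z \<in> star S (\<lambda>v. v \<bullet> v). T \<subseteq> Z}) ` Pow S"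
  proof (cases "F = {}")
    case True
    then have "C = {Z \<in> star S (\<lambda>v. v \<bullet> v). S \<subseteq> Z}" using F not_subset_tight star_eq by (auto simp: cells_at_def)
    then show ?thesis by blast
  next
    case False
    then obtain T where "T \<subseteq> S" "F = {x \<in> voronoi S. T \<subseteq> tight S x}" using face_eq_tight F(1) by blast
    then show ?thesis using F(2) cells_at_tight by blast
  qed
next
  fix C assume "C \<in> (\<lambda>T. {Z \<in> star S (\<lambda>v. v \<bullet> v). T \<subseteq> Z}) ` Pow S"
  then obtain T where "T \<subseteq> S" "C = {Z \<in> star S (\<lambda>v. v \<bullet> v). T \<subseteq> Z}" by blast
  then have "C = cells_at {x \<in> voronoi S. T \<subseteq> tight S x}" using cells_at_tight by simp
  moreover have "{x \<in> voronoi S. T \<subseteq> tight S x} face_of voronoi S" using face_tight[of T] vor_eq by simp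
  ultimately show "C \<in> cells_at ` {F. F face_of voronoi S}" by blast
qed

lemma card_extreme: "card {m. m extreme_point_of voronoi S} = card (star S (\<lambda>v. v \<bullet> v))"
  using card_image[OF inj_tight] star_eq by simp

end

context lattice_direction begin

lemma inj_on_image_extend: "0 \<le> \<epsilon> \<Longrightarrow> inj ((`) (extend \<epsilon> e))"
  using bij_is_inj[OF bij_extend] by (meson inj_def inj_image_eq_iff)

lemma card_star_extend:
  assumes "0 \<le> \<epsilon>"
  shows "card {m. m extreme_point_of voronoi (extend \<epsilon> e ` S)} = card (star S (qe e (\<epsilon> * (2 + \<epsilon>))))"
proof -
  interpret E: full_lattice "extend \<epsilon> e ` S" using assms full_lattice_extend by blast
  show ?thesis unfolding E.card_extreme star_extend[OF assms]
    using card_image inj_on_image_extend[OF assms] inj_on_subset by blast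
qed

lemma same_Ltype_imp_card:
  assumes "0 \<le> \<epsilon>" "same_Ltype (extend \<epsilon> e ` S) S"
  shows "card (star S (qe e (\<epsilon> * (2 + \<epsilon>)))) = card (star S (qe e 0))"
proof -
  interpret E: full_lattice "extend \<epsilon> e ` S" using assms full_lattice_extend by blast
  have "card {m. m extreme_point_of voronoi (extend \<epsilon> e ` S)} = card {m. m extreme_point_of voronoi S}"
    using same_face_poset_card_extreme assms(2) E.convex_vor E.compact_vor convex_vor compact_vor
    unfolding E.vor_eq vor_eq same_Ltype_def by blast
  then show ?thesis unfolding card_star_extend[OF assms(1)] card_extreme qe_zero .
qed

lemma star_eq_imp_same_Ltype:
  assumes \<epsilon>: "0 \<le> \<epsilon>" and st: "star S (qe e (\<epsilon> * (2 + \<epsilon>))) = star S (\<lambda>v. v \<bullet> v)"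
  shows "same_Ltype (extend \<epsilon> e ` S) S"
proof -
  interpret E: full_lattice "extend \<epsilon> e ` S" using \<epsilon> full_lattice_extend by blast
  let ?A = "extend \<epsilon> e"
  have injA: "inj ?A" using bij_is_inj[OF bij_extend[OF \<epsilon>]] .
  have "{Z \<in> star (?A ` S) (\<lambda>v. v \<bullet> v). ?A ` T \<subseteq> Z} = (`) ?A ` {Z \<in> star S (\<lambda>v. v \<bullet> v). T \<subseteq> Z}" for T
    unfolding star_extend[OF \<epsilon>] st using inj_image_subset_iff[OF injA] by blast
  then have "(\<lambda>T. {Z \<in> star (?A ` S) (\<lambda>v. v \<bullet> v). T \<subseteq> Z}) ` Pow (?A ` S)
     = ((\<lambda>C. (`) ?A ` C) \<circ> (\<lambda>T. {Z \<in> star S (\<lambda>v. v \<bullet> v). T \<subseteq> Z})) ` Pow S"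
    unfolding image_Pow_surj[OF refl, symmetric] by (simp add: image_image)
  then have "E.cells_at ` {F. F face_of voronoi (?A ` S)} = ((\<lambda>C. (`) ?A ` C) \<circ> cells_at) ` {F. F face_of voronoi S}"
    unfolding E.cells_at_faces by (simp only: image_comp[symmetric] cells_at_faces)
  then show ?thesis unfolding same_Ltype_def same_face_poset_def
    using poset_iso_from_embeddings[of "{F. F face_of voronoi (?A ` S)}" E.cells_at "{F. F face_of voronoi S}" "(\<lambda>C. (`) ?A ` C) \<circ> cells_at"]
      E.cells_at_subset_iff cells_at_subset_iff inj_image_subset_iff[OF inj_on_image_extend[OF \<epsilon>]]
    by auto
qed

end

section \<open>Stars of equal size\<close>

lemma star_obtain:
  assumes "Z \<in> star S q" "q 0 = 0"
  obtains m where "\<And>v. v \<in> S \<Longrightarrow> m \<bullet> v \<le> q v" "Z = {v\<in>S. q v = m \<bullet> v}"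
proof -
  obtain m c where m: "\<forall>v\<in>S. m \<bullet> v + c \<le> q v" "Z = {v\<in>S. q v = m \<bullet> v + c}" "0 \<in> Z"
    using assms(1) unfolding star_def dcells_def by blast
  then have "c = 0" using assms(2) by simp
  show ?thesis by (rule that[of m]) (use m \<open>c = 0\<close> in auto)
qed

lemma star_intro:
  assumes "0 \<in> S" "q 0 = 0" "\<And>v. v \<in> S \<Longrightarrow> m \<bullet> v \<le> q v" "affine hull {v\<in>S. q v = m \<bullet> v} = UNIV"
  shows "{v\<in>S. q v = m \<bullet> v} \<in> star S q"
proof -
  have "{v\<in>S. q v = m \<bullet> v} \<in> dcells S q" unfolding dcells_def
    using assms(3,4) by (intro CollectI exI[of _ m] exI[of _ 0]) simp
  then show ?thesis using assms(1,2) by (simp add: star_def)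
qed

lemma qe_0: "qe e t 0 = 0" by (simp add: qe_def)

lemma affine_hull_orthogonal:
  assumes "affine hull X = UNIV" "\<And>v. v \<in> X \<Longrightarrow> d \<bullet> v = 0"
  shows "d = 0"
proof -
  have "X \<subseteq> {v. d \<bullet> v = 0}" using assms(2) by blast
  then have "affine hull X \<subseteq> {v. d \<bullet> v = 0}" by (intro hull_minimal affine_hyperplane)
  then have "d \<in> {v. d \<bullet> v = 0}" using assms(1) by blast
  then show ?thesis by simp
qed

lemma star_affine_hull: "Z \<in> star S q \<Longrightarrow> affine hull Z = UNIV"
  by (auto simp: star_def dcells_def)

lemma star_sub_unique:
  assumes "Z1 \<in> star S (qe e t)" "Z2 \<in> star S (qe e t)" "X \<subseteq> Z1" "X \<subseteq> Z2" "affine hull X = UNIV"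
  shows "Z1 = Z2"
proof -
  obtain m1 where m1: "Z1 = {v\<in>S. qe e t v = m1 \<bullet> v}" using star_obtain[OF assms(1) qe_0] by blast
  obtain m2 where m2: "Z2 = {v\<in>S. qe e t v = m2 \<bullet> v}" using star_obtain[OF assms(2) qe_0] by blast
  have "(m1 - m2) \<bullet> v = 0" if "v \<in> X" for v
  proof -
    have "qe e t v = m1 \<bullet> v" "qe e t v = m2 \<bullet> v" using that assms(3,4) m1 m2 by blast+
    then show ?thesis by (simp add: inner_diff_left)
  qed
  then have "m1 - m2 = 0" using affine_hull_orthogonal[OF assms(5)] by blast
  then show ?thesis using m1 m2 by simp
qed

text \<open>The closed convex cone spanned by \<open>Z\<close>, described as a bipolar so that no Farkas lemma is needed.\<close>
definition bipolar :: "(real^'n::finite) set \<Rightarrow> (real^'n) set" where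
  "bipolar Z = {x. \<forall>d. (\<forall>v\<in>Z. d \<bullet> v \<le> 0) \<longrightarrow> d \<bullet> x \<le> 0}"

text \<open>The interior of the cone over \<open>Z\<close>, again in dual form: no nonzero
  functional nonpositive on \<open>Z\<close> vanishes at \<open>x\<close>.\<close>

definition interior_direction :: "(real^'n::finite) set \<Rightarrow> real^'n \<Rightarrow> bool" where
  "interior_direction Z x \<longleftrightarrow> (\<forall>d. d \<noteq> 0 \<longrightarrow> (\<forall>v\<in>Z. d \<bullet> v \<le> 0) \<longrightarrow> d \<bullet> x < 0)"

lemma bipolar_mono: "Z \<subseteq> Z' \<Longrightarrow> bipolar Z \<subseteq> bipolar Z'"
  unfolding bipolar_def by blast

lemma interior_direction_sum:
  assumes "finite Z" "affine hull Z = UNIV" shows "interior_direction Z (\<Sum>v\<in>Z. v)"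
  unfolding interior_direction_def
proof (intro allI impI)
  fix d :: "real^'a" assume d: "d \<noteq> 0" "\<forall>v\<in>Z. d \<bullet> v \<le> 0"
  obtain v where v: "v \<in> Z" "d \<bullet> v \<noteq> 0" using affine_hull_orthogonal[OF assms(2)] d(1) by blast
  have "d \<bullet> (\<Sum>v\<in>Z. v) = (\<Sum>v\<in>Z. d \<bullet> v)" by (rule inner_sum_right)
  also have "\<dots> < (\<Sum>v\<in>Z. 0)"
    using d(2) v by (intro sum_strict_mono_ex1[OF assms(1)]) force+
  finally show "d \<bullet> (\<Sum>v\<in>Z. v) < 0" by simp
qed

lemma interior_direction_add:
  assumes "interior_direction Z x" "z \<in> Z" "\<eta> > 0"
  shows "interior_direction Z (z + \<eta> *\<^sub>R x)"
  using assms unfolding interior_direction_def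
  by (auto simp: inner_add_right intro!: add_nonpos_neg mult_pos_neg)

text \<open>The conic analogue of \<open>dcells_unique\<close>: the difference of the two linear
  minorants separates the cones.\<close>

lemma star_cone_unique:
  assumes "Z \<in> star S (qe e t)" "Z' \<in> star S (qe e t)" "interior_direction Z x" "x \<in> bipolar Z'"
  shows "Z = Z'"
proof -
  obtain m where m: "\<And>v. v \<in> S \<Longrightarrow> m \<bullet> v \<le> qe e t v" "Z = {v\<in>S. qe e t v = m \<bullet> v}"
    using star_obtain[OF assms(1) qe_0] by blast
  obtain m' where m': "\<And>v. v \<in> S \<Longrightarrow> m' \<bullet> v \<le> qe e t v" "Z' = {v\<in>S. qe e t v = m' \<bullet> v}"
    using star_obtain[OF assms(2) qe_0] by blast
  have 1: "(m' - m) \<bullet> v \<le> 0" if "v \<in> Z" for v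
  proof -
    have "m' \<bullet> v \<le> qe e t v" "qe e t v = m \<bullet> v" using that m(2) m'(1)[of v] by auto
    then show ?thesis by (simp add: inner_diff_left)
  qed
  have "(m - m') \<bullet> v \<le> 0" if "v \<in> Z'" for v
  proof -
    have "m \<bullet> v \<le> qe e t v" "qe e t v = m' \<bullet> v" using that m'(2) m(1)[of v] by auto
    then show ?thesis by (simp add: inner_diff_left)
  qed
  then have "(m - m') \<bullet> x \<le> 0" using assms(4) unfolding bipolar_def by blast
  then have "\<not> (m' - m) \<bullet> x < 0" by (simp add: inner_diff_left)
  then have "m' - m = 0" using assms(3) 1 unfolding interior_direction_def by blast
  then show ?thesis using m(2) m'(2) by simp
qed

section \<open>Variation of the star with the stretching parameter\<close>

context lattice_direction begin

lemma star_translate: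
  assumes "Z \<in> star S (qe e t)" "w \<in> Z"
  shows "(\<lambda>v. v - w) ` Z \<in> star S (qe e t)"
proof -
  have "w \<in> S" using assms by (auto simp: star_def dcells_def)
  then show ?thesis using dcells_translate[of Z t w] assms by (force simp: star_def)
qed

text \<open>Translating a cell by any of its vertices moves it into the star, for every parameter in
  the same way.\<close>

lemma dcells_eq_if_star_eq:
  assumes "star S (qe e t) = star S (qe e t')" shows "dcells S (qe e t) = dcells S (qe e t')"
proof -
  have "Z \<in> dcells S (qe e s')" if eq: "star S (qe e s) = star S (qe e s')" and Z: "Z \<in> dcells S (qe e s)" for Z s s'
  proof -
    have "Z \<noteq> {}" using Z unfolding dcells_def by force
    then obtain w where w: "w \<in> Z" by blast
    have wS: "w \<in> S" using w Z unfolding dcells_def by blast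
    have "(\<lambda>v. v - w) ` Z \<in> star S (qe e s)" using dcells_translate[OF Z wS] w by (force simp: star_def)
    then have "(\<lambda>v. v - w) ` Z \<in> star S (qe e s')" using eq by simp
    then have "(\<lambda>v. v - w) ` Z \<in> dcells S (qe e s')" unfolding star_def by blast
    then have "(\<lambda>v. v - (-w)) ` (\<lambda>v. v - w) ` Z \<in> dcells S (qe e s')" using dcells_translate neg[OF wS] by blast
    then show ?thesis by (simp add: image_image)
  qed
  then show ?thesis using assms by (metis subsetI subset_antisym)
qed

lemma qe_mono: "t \<le> t' \<Longrightarrow> qe e t v \<le> qe e t' v"
  by (simp add: qe_def mult_right_mono)

lemma qe_ge: "0 \<le> t \<Longrightarrow> v \<bullet> v \<le> qe e t v"
  by (simp add: qe_def)

text \<open>The pairs \<open>(t, m)\<close> for which \<open>m\<close> is a minorant touching a given \<open>X\<close> form a compact set, and only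
  finitely many \<open>X\<close> occur near \<open>t0\<close>.\<close>
lemma star_refine:
  assumes t0: "0 \<le> t0"
  shows "\<exists>\<delta>>0. \<forall>t\<ge>0. \<bar>t - t0\<bar> < \<delta> \<longrightarrow> (\<forall>Z\<in>star S (qe e t). \<exists>Z'\<in>star S (qe e t0). Z \<subseteq> Z')"
proof -
  \<comment> \<open>A minorant of \<open>qe e t\<close> with t \<le> \<open>?T\<close> is also one
    of \<open>qe e ?T\<close>, so one bound \<open>R\<close> serves all parameters
    considered.\<close>
  let ?T = "t0 + 1"
  have "bounded {m \<in> span S. \<forall>v\<in>S. m \<bullet> v \<le> qe e ?T v}" by (rule bounded_functionals)
  then obtain R where R: "\<And>m. (\<forall>v\<in>S. m \<bullet> v \<le> qe e ?T v) \<Longrightarrow> norm m \<le> R"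
    unfolding bounded_iff full by auto
  define K where "K X = {p. 0 \<le> fst p \<and> fst p \<le> ?T \<and> (\<forall>v\<in>S. snd p \<bullet> v \<le> qe e (fst p) v) \<and>
      (\<forall>v\<in>X. snd p \<bullet> v = qe e (fst p) v)}" for X
  have compK: "compact (fst ` K X)" for X
  proof -
    have "K X = {p. 0 \<le> fst p} \<inter> {p. fst p \<le> ?T} \<inter> (\<Inter>v\<in>S. {p. snd p \<bullet> v \<le> qe e (fst p) v}) \<inter>
       (\<Inter>v\<in>X. {p. snd p \<bullet> v = qe e (fst p) v})" unfolding K_def by auto
    moreover have "closed \<dots>" unfolding qe_def
      by (intro closed_Int closed_INT ballI closed_Collect_le closed_Collect_eq continuous_intros)
    ultimately have "closed (K X)" by simp
    moreover have "bounded (K X)"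
    proof (rule bounded_subset)
      show "bounded ({0..?T} \<times> cball (0::real^'n) R)" by (intro bounded_Times) auto
      show "K X \<subseteq> {0..?T} \<times> cball 0 R"
      proof
        fix p assume p: "p \<in> K X"
        then have "\<forall>v\<in>S. snd p \<bullet> v \<le> qe e ?T v" unfolding K_def using qe_mono by (auto intro: order_trans)
        then have "norm (snd p) \<le> R" by (rule R)
        then show "p \<in> {0..?T} \<times> cball 0 R" using p unfolding K_def by (cases p) auto
      qed
    qed
    ultimately have "compact (K X)" using compact_eq_bounded_closed by blast
    then show ?thesis by (intro compact_continuous_image continuous_intros)
  qed
  have in_K: "t \<in> fst ` K Z \<and> Z \<subseteq> S \<inter> cball 0 R" if Z: "Z \<in> star S (qe e t)" and t: "0 \<le> t" "t \<le> ?T" for Z t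
  proof -
    obtain m where m: "\<And>v. v \<in> S \<Longrightarrow> m \<bullet> v \<le> qe e t v" "Z = {v\<in>S. qe e t v = m \<bullet> v}"
      using star_obtain[OF Z qe_0] by blast
    have "(t, m) \<in> K Z" unfolding K_def using m t by auto
    then have "t \<in> fst ` K Z" by force
    moreover have "\<forall>v\<in>S. m \<bullet> v \<le> qe e ?T v" using m(1) qe_mono[OF t(2)] order_trans by blast
    then have mR: "norm m \<le> R" by (rule R)
    have "norm v \<le> R" if "v \<in> Z" for v
    proof -
      have "norm v * norm v = v \<bullet> v" by (simp add: dot_square_norm power2_eq_square)
      also have "\<dots> \<le> m \<bullet> v" using qe_ge[OF t(1), of v] that m(2) by auto
      also have "\<dots> \<le> norm m * norm v" by (rule norm_cauchy_schwarz)
      finally have "norm v \<le> norm m" by (cases "norm v = 0") (auto simp: mult_le_cancel_right)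
      then show ?thesis using mR by linarith
    qed
    ultimately show ?thesis using m(2) by auto
  qed
  \<comment> \<open>Sets that admit no touching minorant at \<open>t0\<close>. There are finitely
    many, with closed parameter sets that miss \<open>t0\<close>, so they do not occur near
    \<open>t0\<close>.\<close>
  define Bad where "Bad = {X \<in> Pow (S \<inter> cball 0 R). t0 \<notin> fst ` K X}"
  have "finite Bad" unfolding Bad_def by (rule finite_subset[of _ "Pow (S \<inter> cball 0 R)"]) (auto simp only: finite_Pow_iff fin)
  then have "closed (\<Union>X\<in>Bad. fst ` K X)" using compK compact_imp_closed by (intro closed_UN) auto
  then have "open (- (\<Union>X\<in>Bad. fst ` K X))" by (rule open_Compl)
  moreover have "t0 \<in> - (\<Union>X\<in>Bad. fst ` K X)" unfolding Bad_def by blast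
  ultimately obtain \<delta>0 where d0: "0 < \<delta>0" "ball t0 \<delta>0 \<subseteq> - (\<Union>X\<in>Bad. fst ` K X)"
    by (rule openE)
  have "\<exists>Z'\<in>star S (qe e t0). Z \<subseteq> Z'" if t: "0 \<le> t" "\<bar>t - t0\<bar> < min \<delta>0 1" and Z: "Z \<in> star S (qe e t)" for t Z
  proof -
    have "t \<le> ?T" using t(2) by linarith
    then have 1: "t \<in> fst ` K Z" "Z \<subseteq> S \<inter> cball 0 R" using in_K[OF Z t(1)] by blast+
    have "t \<in> ball t0 \<delta>0" using t(2) by (simp add: dist_real_def abs_minus_commute)
    then have "Z \<notin> Bad" using d0(2) 1(1) by blast
    then have "t0 \<in> fst ` K Z" using 1(2) unfolding Bad_def by blast
    then obtain m where m: "\<forall>v\<in>S. m \<bullet> v \<le> qe e t0 v" "\<forall>v\<in>Z. m \<bullet> v = qe e t0 v" unfolding K_def by auto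
    let ?Z = "{v\<in>S. qe e t0 v = m \<bullet> v}"
    have sub: "Z \<subseteq> ?Z" using m(2) 1(2) by force
    then have "affine hull ?Z = UNIV" using star_affine_hull[OF Z] hull_mono by (metis top.extremum_uniqueI)
    then have "?Z \<in> star S (qe e t0)" using star_intro[of S "qe e t0" m] zero qe_0 m(1) by blast
    then show ?thesis using sub by blast
  qed
  then show ?thesis using d0(1) by (intro exI[of _ "min \<delta>0 1"]) auto
qed

text \<open>Equal cardinality makes \<open>Z \<mapsto> f Z \<supseteq> Z\<close> a bijection of the two stars. Hence the cones of \<open>Z\<close> and \<open>f Z\<close>
  agree at every vertex \<open>w\<close> of \<open>Z\<close>, and a point of \<open>f Z\<close> outside \<open>Z\<close> could be separated from \<open>Z\<close>.\<close>
lemma star_eq_if_card_eq: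
  assumes t: "0 \<le> t" and t0: "0 \<le> t0"
    and ref: "\<And>Z. Z \<in> star S (qe e t) \<Longrightarrow> \<exists>Z'\<in>star S (qe e t0). Z \<subseteq> Z'"
    and card: "card (star S (qe e t)) = card (star S (qe e t0))"
  shows "star S (qe e t) = star S (qe e t0)"
proof -
  let ?D = "star S (qe e t)" and ?E = "star S (qe e t0)"
  have "\<forall>Z\<in>?D. \<exists>Z'. Z' \<in> ?E \<and> Z \<subseteq> Z'" using ref by blast
  from bchoice[OF this] obtain f where f: "\<And>Z. Z \<in> ?D \<Longrightarrow> f Z \<in> ?E \<and> Z \<subseteq> f Z" by blast
  have f_eq: "f Z = Z'" if "Z \<in> ?D" "Z' \<in> ?E" "Z \<subseteq> Z'" for Z Z'
    using star_sub_unique[of "f Z" S e t0 Z' Z] f[OF that(1)] that star_affine_hull by blast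
  have cover: "\<exists>Z\<in>?D. x \<in> bipolar Z \<and> f Z = Z'" if "Z' \<in> ?E" "interior_direction Z' x" for Z' x
  proof -
    obtain Z where Z: "Z \<in> ?D" "x \<in> bipolar Z" using cover_cone_qe[OF t, of x] unfolding bipolar_def by blast
    then have "x \<in> bipolar (f Z)" using f bipolar_mono by blast
    then have "Z' = f Z" using star_cone_unique[OF that(1) _ that(2)] f Z(1) by blast
    then show ?thesis using Z by blast
  qed
  \<comment> \<open>Each cell at \<open>t0\<close> has an interior direction, and the cell at
    \<open>t\<close> whose cone contains this direction must be sent to it.\<close>
  have "f ` ?D = ?E"
  proof
    show "?E \<subseteq> f ` ?D"
    proof
      fix Z' assume Z': "Z' \<in> ?E"
      then have "interior_direction Z' (\<Sum>v\<in>Z'. v)"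
        using interior_direction_sum finite_in_star[OF t0] star_affine_hull by blast
      then show "Z' \<in> f ` ?D" using cover Z' by blast
    qed
  qed (use f in blast)
  then have inj: "inj_on f ?D" using eq_card_imp_inj_on[OF finite_star[OF t], of f] card by simp
  have "f Z \<subseteq> Z" if Z: "Z \<in> ?D" for Z
  proof
    fix z assume z: "z \<in> f Z"
    show "z \<in> Z"
    proof (rule ccontr)
      assume nz: "z \<notin> Z"
      have zS: "z \<in> S" using z f[OF Z] by (auto simp: star_def dcells_def)
      have finZ: "finite Z" using finite_in_star[OF t Z] .
      have "z \<notin> convex hull Z" using conv_mem_qe[OF t _ zS] nz Z by (auto simp: star_def)
      then obtain a b where ab: "a \<bullet> z < b" "\<And>v. v \<in> convex hull Z \<Longrightarrow> b < a \<bullet> v"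
        using separating_hyperplane_closed_point[of "convex hull Z" z] finZ
        by (auto simp: compact_imp_closed finite_imp_compact_convex_hull)
      have "Z \<noteq> {}" using Z by (auto simp: star_def)
      \<comment> \<open>Seen from this vertex \<open>w\<close> the whole of \<open>Z\<close> lies
        where \<open>- a\<close> is nonpositive, whereas \<open>- a\<close> is positive on
        \<open>z - w\<close>.\<close>
      from finite_has_min[OF finZ this, of "\<lambda>v. a \<bullet> v"]
      obtain w where w: "w \<in> Z" "\<And>v. v \<in> Z \<Longrightarrow> a \<bullet> w \<le> a \<bullet> v" by (elim bexE) simp
      let ?Z = "(\<lambda>v. v - w) ` Z" and ?Z' = "(\<lambda>v. v - w) ` f Z"
      have Zw: "?Z \<in> ?D" using star_translate Z w(1) by blast
      have Zw': "?Z' \<in> ?E" using star_translate f[OF Z] w(1) by blast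
      have fZ: "f ?Z = ?Z'" using f_eq[OF Zw Zw'] f[OF Z] by blast
      define x where "x = (\<Sum>v\<in>?Z'. v)"
      have x: "interior_direction ?Z' x" unfolding x_def
        using interior_direction_sum finite_in_star[OF t0 Zw'] star_affine_hull[OF Zw'] by blast
      have zw: "z - w \<in> ?Z'" using z by blast
      \<comment> \<open>The vector \<open>z - w\<close> may lie on the boundary of the cone over
        \<open>?Z'\<close>, where cells are not determined; a small multiple of \<open>x\<close>
        pushes it inside.\<close>
      have le: "(-a) \<bullet> (z - w + \<eta> *\<^sub>R x) \<le> 0" if "\<eta> > 0" for \<eta>
      proof -
        have "interior_direction ?Z' (z - w + \<eta> *\<^sub>R x)" using interior_direction_add[OF x zw that] .
        then obtain Z1 where Z1: "Z1 \<in> ?D" "z - w + \<eta> *\<^sub>R x \<in> bipolar Z1" "f Z1 = ?Z'" using cover[OF Zw'] by blast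
        then have "Z1 = ?Z" using inj fZ Zw by (metis inj_onD)
        then have "z - w + \<eta> *\<^sub>R x \<in> bipolar ?Z" using Z1(2) by simp
        moreover have "\<forall>v\<in>?Z. (-a) \<bullet> v \<le> 0" using w(2) by (auto simp: inner_diff_right)
        ultimately show ?thesis unfolding bipolar_def by blast
      qed
      let ?g = "a \<bullet> w - a \<bullet> z"
      have "a \<bullet> w > b" using ab(2) w(1) by (simp add: hull_inc)
      then have g: "?g > 0" using ab(1) by linarith
      \<comment> \<open>Chosen so that the perturbation costs at most half of the gap
        \<open>?g\<close>.\<close>
      let ?\<eta> = "?g / (2 * (\<bar>a \<bullet> x\<bar> + 1))"
      have "?\<eta> > 0" using g by simp
      then have "?g \<le> ?\<eta> * (a \<bullet> x)" using le by (fastforce simp: inner_diff_right inner_add_right)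
      also have "\<dots> \<le> ?\<eta> * (\<bar>a \<bullet> x\<bar> + 1)" using \<open>?\<eta> > 0\<close> by (intro mult_left_mono) auto
      also have "\<dots> = ?g / 2" by (simp add: field_simps)
      finally show False using g by argo
    qed
  qed
  then have "?D \<subseteq> ?E" using f by (metis subsetI subset_antisym)
  then show ?thesis using card_subset_eq[OF finite_star[OF t0]] card by blast
qed

lemma star_constant:
  assumes "\<And>t. 0 \<le> t \<Longrightarrow> card (star S (qe e t)) = card (star S (qe e 0))" and t: "0 \<le> t"
  shows "star S (qe e t) = star S (qe e 0)"
proof -
  have "star S (qe e 0) = star S (qe e t)"
  proof (rule connected_equivalence_relation[where S = "{0::real..}" and R = "\<lambda>a b. star S (qe e a) = star S (qe e b)"])
    show "connected {0::real..}" by (simp add: convex_connected)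
    fix a :: real assume a: "a \<in> {0..}"
    obtain \<delta> where d: "\<delta> > 0" "\<And>s. 0 \<le> s \<Longrightarrow> \<bar>s - a\<bar> < \<delta> \<Longrightarrow> \<forall>Z\<in>star S (qe e s). \<exists>Z'\<in>star S (qe e a). Z \<subseteq> Z'"
      using star_refine[of a] a by auto
    show "\<exists>T. openin (top_of_set {0..}) T \<and> a \<in> T \<and> (\<forall>x\<in>T. star S (qe e a) = star S (qe e x))"
    proof (intro exI[of _ "{0..} \<inter> ball a \<delta>"] conjI ballI)
      fix s assume s: "s \<in> {0..} \<inter> ball a \<delta>"
      then have s0: "0 \<le> s" "\<bar>s - a\<bar> < \<delta>" by (auto simp: dist_real_def)
      have a0: "0 \<le> a" using a by simp
      have "card (star S (qe e s)) = card (star S (qe e a))"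
        by (rule trans[OF assms(1)[OF s0(1)] assms(1)[OF a0, symmetric]])
      then have "star S (qe e s) = star S (qe e a)"
        using star_eq_if_card_eq[OF s0(1) a0] d(2)[OF s0] by blast
      then show "star S (qe e a) = star S (qe e s)" by simp
    qed (use a d in auto)
  qed (use t in auto)
  then show ?thesis by simp
qed

lemma same_Ltype_iff_dcells:
  "(\<forall>\<epsilon>>0. same_Ltype (extend \<epsilon> e ` S) S) \<longleftrightarrow> (\<forall>t\<ge>0. dcells S (qe e t) = dcells S (qe e 0))"
proof
  assume L: "\<forall>\<epsilon>>0. same_Ltype (extend \<epsilon> e ` S) S"
  have "card (star S (qe e t)) = card (star S (qe e 0))" if t: "0 \<le> t" for t
  proof (cases "t = 0")
    case False
    then have "eps t > 0" using t by (simp add: eps_def)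
    then show ?thesis using same_Ltype_imp_card[of "eps t"] L eps[OF t] by simp
  qed simp
  then show "\<forall>t\<ge>0. dcells S (qe e t) = dcells S (qe e 0)" using star_constant dcells_eq_if_star_eq by blast
next
  assume D: "\<forall>t\<ge>0. dcells S (qe e t) = dcells S (qe e 0)"
  show "\<forall>\<epsilon>>0. same_Ltype (extend \<epsilon> e ` S) S"
  proof (intro allI impI)
    fix \<epsilon> :: real assume "\<epsilon> > 0"
    then have \<epsilon>: "0 \<le> \<epsilon>" "0 \<le> \<epsilon> * (2 + \<epsilon>)" by auto
    have "dcells S (qe e (\<epsilon> * (2 + \<epsilon>))) = dcells S (\<lambda>v. v \<bullet> v)"
      using D[rule_format, OF \<epsilon>(2)] unfolding qe_zero .
    then have "star S (qe e (\<epsilon> * (2 + \<epsilon>))) = star S (\<lambda>v. v \<bullet> v)" by (simp only: star_def)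
    then show "same_Ltype (extend \<epsilon> e ` S) S" by (rule star_eq_imp_same_Ltype[OF \<epsilon>(1)])
  qed
qed

end

section \<open>Zones of polytopes\<close>

lemma extreme_points_not_collinear:
  fixes a :: "'a::euclidean_space"
  assumes "a extreme_point_of K" "b extreme_point_of K" "c extreme_point_of K" "a \<noteq> b" "a \<noteq> c" "b \<noteq> c"
  shows "\<not> collinear {a, b, c}"
proof
  have K: "a \<in> K" "b \<in> K" "c \<in> K" using assms by (auto simp: extreme_point_of_def)
  assume "collinear {a, b, c}"
  then have "a \<in> open_segment b c \<or> b \<in> open_segment c a \<or> c \<in> open_segment a b"
    using assms(4-6) unfolding collinear_between_cases between_mem_segment open_segment_def by blast
  then show False using assms(1-3) K unfolding extreme_point_of_def by blast
qed

text \<open>The vertex-edge step of the simplex algorithm. In a minimal face \<open>X\<close> through \<open>g\<close> on which \<open>a\<close> exceeds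
  \<open>a \<bullet> g\<close>, if \<open>X\<close> were not an edge, a short chord near \<open>g\<close>, parallel to the hyperplane \<open>u\<close> exposing \<open>g\<close>,
  would have both ends in proper faces through \<open>g\<close>.\<close>
lemma improving_edge:
  fixes K :: "'a::euclidean_space set"
  assumes K: "polytope K" and g: "g extreme_point_of K" and x: "x \<in> K" "a \<bullet> g < a \<bullet> x"
  shows "\<exists>E. E face_of K \<and> aff_dim E = 1 \<and> g \<in> E \<and> (\<exists>y\<in>E. a \<bullet> g < a \<bullet> y)"
proof -
  let ?P = "\<lambda>F. F face_of K \<and> g \<in> F \<and> (\<exists>y\<in>F. a \<bullet> g < a \<bullet> y)"
  have "?P K" using K g x polytope_imp_convex by (auto simp: face_of_refl_eq extreme_point_of_def)
  then obtain X where X: "?P X" and least: "\<And>F. ?P F \<Longrightarrow> nat (aff_dim X) \<le> nat (aff_dim F)"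
    using ex_has_least_nat[of ?P K "\<lambda>F. nat (aff_dim F)"] by blast
  obtain y where y: "y \<in> X" "a \<bullet> g < a \<bullet> y" using X by blast
  have gX: "g \<in> X" and XK: "X face_of K" using X by auto
  have polyX: "polytope X" using face_of_polytope_polytope K XK by blast
  have convX: "convex X" using polytope_imp_convex polyX by blast
  \<comment> \<open>By minimality of \<open>X\<close>, its proper faces through \<open>g\<close>
    contain no improving point.\<close>
  have nonopt: "a \<bullet> z \<le> a \<bullet> g" if Y: "Y face_of X" "Y \<noteq> X" "g \<in> Y" "z \<in> Y" for Y z
  proof (rule ccontr)
    assume "\<not> a \<bullet> z \<le> a \<bullet> g"
    then have "a \<bullet> g < a \<bullet> z" by simp
    moreover have "Y face_of K" using face_of_trans[OF Y(1) XK] .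
    ultimately have "nat (aff_dim X) \<le> nat (aff_dim Y)" using least[of Y] Y(3,4) by blast
    moreover have "aff_dim Y < aff_dim X" using face_of_aff_dim_lt[OF convX Y(1,2)] .
    moreover have "0 \<le> aff_dim Y" using Y(3) aff_dim_negative_iff[of Y] by (metis empty_iff linorder_not_less)
    ultimately show False by linarith
  qed
  have gy: "g \<noteq> y" using y(2) by auto
  have "aff_dim {g, y} \<le> aff_dim X" using gX y(1) by (intro aff_dim_subset) auto
  then have ge1: "1 \<le> aff_dim X" using gy by simp
  have "aff_dim X = 1"
  proof (rule ccontr)
    assume "aff_dim X \<noteq> 1"
    then have gt1: "1 < aff_dim X" using ge1 by linarith
    have "\<not> X \<subseteq> affine hull {g, y}"
    proof
      assume "X \<subseteq> affine hull {g, y}"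
      then have "aff_dim X \<le> aff_dim {g, y}" using aff_dim_subset by (metis aff_dim_affine_hull)
      then show False using gt1 gy by simp
    qed
    then obtain y2 where y2: "y2 \<in> X" "y2 \<notin> affine hull {g, y}" by blast
    have "g extreme_point_of X" using extreme_point_of_face[OF XK] g gX by blast
    then have "{g} exposed_face_of X"
      using exposed_face_of_polyhedron[OF polytope_imp_polyhedron[OF polyX]] by (simp add: face_of_singleton)
    then obtain u b0 where u: "X \<subseteq> {x. u \<bullet> x \<le> b0}" "{g} = X \<inter> {x. u \<bullet> x = b0}"
      unfolding exposed_face_of_def by blast
    have ug: "u \<bullet> z < u \<bullet> g" if "z \<in> X" "z \<noteq> g" for z
    proof -
      have "u \<bullet> g = b0" using u(2) by blast
      moreover have "u \<bullet> z \<noteq> b0" "u \<bullet> z \<le> b0" using that u by blast+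
      ultimately show ?thesis by linarith
    qed
    have y2g: "y2 \<noteq> g" using y2(2) hull_inc[of g "{g, y}" affine] by auto
    \<comment> \<open>\<open>d\<close> is the combination of the chords from \<open>g\<close> to
      \<open>y\<close> and \<open>y2\<close> that \<open>u\<close> annihilates; it is nonzero
      because \<beta> is and \<open>y2\<close> is off the line through \<open>g\<close> and
      \<open>y\<close>.\<close>
    define \<alpha> \<beta> d where "\<alpha> = u \<bullet> (y2 - g)" and "\<beta> = u \<bullet> (y - g)" and "d = \<alpha> *\<^sub>R (y - g) - \<beta> *\<^sub>R (y2 - g)"
    have \<beta>: "\<beta> < 0" using ug[OF y(1)] gy by (simp add: \<beta>_def inner_diff_right)
    have ud: "u \<bullet> d = 0" by (simp add: d_def \<alpha>_def \<beta>_def inner_diff_right algebra_simps)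
    have d0: "d \<noteq> 0"
    proof
      assume "d = 0"
      then have "\<beta> *\<^sub>R (y2 - g) = \<alpha> *\<^sub>R (y - g)" by (simp add: d_def)
      then have "inverse \<beta> *\<^sub>R \<beta> *\<^sub>R (y2 - g) = inverse \<beta> *\<^sub>R \<alpha> *\<^sub>R (y - g)" by simp
      then have "y2 - g = (inverse \<beta> * \<alpha>) *\<^sub>R (y - g)" using \<beta> by simp
      then have "y2 = g + (inverse \<beta> * \<alpha>) *\<^sub>R (y - g)" by (simp add: algebra_simps)
      then show False using y2(2) unfolding affine_hull_2_alt by blast
    qed
    have aff: "p + s *\<^sub>R d \<in> affine hull X" if "p \<in> affine hull X" for p s
    proof -
      have 1: "g \<in> affine hull X" "y \<in> affine hull X" "y2 \<in> affine hull X"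
        using gX y(1) y2(1) by (auto intro: hull_inc)
      have "p + (s * \<alpha>) *\<^sub>R (y - g) \<in> affine hull X"
        using mem_affine_3_minus[OF affine_affine_hull that 1(2,1)] .
      then have "p + (s * \<alpha>) *\<^sub>R (y - g) + (- s * \<beta>) *\<^sub>R (y2 - g) \<in> affine hull X"
        using mem_affine_3_minus[OF affine_affine_hull _ 1(3,1)] by blast
      then show ?thesis by (simp add: d_def algebra_simps)
    qed
    \<comment> \<open>The faces missing \<open>g\<close> stay below a level \<mu> < u \<bullet> g.
      With \<delta> small, the chord through \<open>?p\<close> along \<open>d\<close>, on which
      \<open>u\<close> is constant, runs above that level and avoids them.\<close>
    let ?U = "\<Union>{Y. Y face_of X \<and> g \<notin> Y}"
    have "compact ?U"
      using finite_subset[OF _ finite_polytope_faces[OF polyX], of "{Y. Y face_of X \<and> g \<notin> Y}"]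
        face_of_imp_compact[OF convX polytope_imp_compact[OF polyX]]
      by (intro compact_Union) auto
    have "\<exists>\<mu>. \<mu> < u \<bullet> g \<and> (\<forall>z\<in>?U. u \<bullet> z \<le> \<mu>)"
    proof (cases "?U = {}")
      case True
      then show ?thesis by (intro exI[of _ "u \<bullet> g - 1"]) (simp only: ball_empty, simp)
    next
      case False
      have "continuous_on ?U ((\<bullet>) u)" by (intro continuous_intros)
      then obtain z0 where z0: "z0 \<in> ?U" "\<And>z. z \<in> ?U \<Longrightarrow> u \<bullet> z \<le> u \<bullet> z0"
        using continuous_attains_sup[OF \<open>compact ?U\<close> False] by blast
      then have "z0 \<in> X" "z0 \<noteq> g" using face_of_imp_subset by blast+
      then show ?thesis using ug z0(2) by blast
    qed
    then obtain \<mu> where \<mu>: "\<mu> < u \<bullet> g" "\<And>z. z \<in> ?U \<Longrightarrow> u \<bullet> z \<le> \<mu>" by blast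
    define \<delta> where "\<delta> = min (1/2) ((u \<bullet> g - \<mu>) / (2 * (- \<beta>)))"
    have \<delta>: "0 < \<delta>" "\<delta> < 1" "\<delta> * (- \<beta>) < u \<bullet> g - \<mu>"
    proof -
      have "0 < (u \<bullet> g - \<mu>) / (2 * (- \<beta>))" using \<mu>(1) \<beta> by (intro divide_pos_pos) auto
      then show "0 < \<delta>" "\<delta> < 1" unfolding \<delta>_def by linarith+
      have "\<delta> * (- \<beta>) \<le> (u \<bullet> g - \<mu>) / (2 * (- \<beta>)) * (- \<beta>)" using \<beta>
        by (intro mult_right_mono) (auto simp: \<delta>_def)
      also have "\<dots> = (u \<bullet> g - \<mu>) / 2" using \<beta> by simp
      also have "\<dots> < u \<bullet> g - \<mu>" using \<mu>(1) by simp
      finally show "\<delta> * (- \<beta>) < u \<bullet> g - \<mu>" .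
    qed
    let ?p = "g + \<delta> *\<^sub>R (y - g)"
    have p_seg: "?p \<in> open_segment g y"
      unfolding in_segment using gy \<delta>(1,2) by (intro conjI exI[of _ \<delta>]) (auto simp: algebra_simps)
    have pX: "?p \<in> X" using convX gX y(1) p_seg convex_contains_open_segment by blast
    have up: "u \<bullet> ?p > \<mu>" using \<delta>(3) by (simp add: inner_add_right \<beta>_def)
    have frontier: "rel_frontier X = \<Union>{F. F face_of X \<and> F \<noteq> X}"
      using rel_frontier_of_polyhedron_alt[OF polytope_imp_polyhedron[OF polyX]] .
    have p_int: "?p \<in> rel_interior X"
    proof (rule ccontr)
      assume "?p \<notin> rel_interior X"
      then have "?p \<in> rel_frontier X" using pX closure_subset unfolding rel_frontier_def by blast
      then obtain Y where Y: "Y face_of X" "Y \<noteq> X" "?p \<in> Y" using frontier by blast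
      then have "g \<in> Y" "y \<in> Y" using face_ofD[OF Y(1) p_seg gX y(1)] by auto
      then show False using nonopt[OF Y(1,2)] y(2) by fastforce
    qed
    have exit_le: "\<exists>s>0. a \<bullet> (?p + s *\<^sub>R l) \<le> a \<bullet> g" if l: "l = d \<or> l = - d" for l
    proof -
      have ph: "?p \<in> affine hull X" using pX by (rule hull_inc)
      have "?p + l \<in> affine hull X" "l \<noteq> 0"
        using l d0 aff[OF ph, of 1] aff[OF ph, of "-1"] by auto
      then obtain s where s: "0 < s" "?p + s *\<^sub>R l \<in> rel_frontier X"
        by (rule ray_to_rel_frontier[OF polytope_imp_bounded[OF polyX] p_int]) blast
      then obtain Y where Y: "Y face_of X" "Y \<noteq> X" "?p + s *\<^sub>R l \<in> Y" using frontier by blast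
      have "u \<bullet> l = 0" using l ud by auto
      then have "u \<bullet> (?p + s *\<^sub>R l) = u \<bullet> ?p" by (simp add: inner_add_right)
      then have "?p + s *\<^sub>R l \<notin> ?U" using \<mu>(2)[of "?p + s *\<^sub>R l"] up by linarith
      then have "g \<in> Y" using Y by blast
      then show ?thesis using nonopt[OF Y(1,2) _ Y(3)] s(1) by blast
    qed
    obtain s1 where s1: "s1 > 0" "a \<bullet> (?p + s1 *\<^sub>R d) \<le> a \<bullet> g" using exit_le by blast
    obtain s2 where s2: "s2 > 0" "a \<bullet> (?p + s2 *\<^sub>R (-d)) \<le> a \<bullet> g" using exit_le by blast
    \<comment> \<open>The function \<open>a\<close> is affine on the chord: it cannot be at most a
      \<bullet> g at both ends and larger at \<open>?p\<close> between them.\<close>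
    let ?q = "a \<bullet> ?p - a \<bullet> g"
    have 1: "?q + s1 * (a \<bullet> d) \<le> 0" "?q - s2 * (a \<bullet> d) \<le> 0" using s1(2) s2(2)
      by (simp_all add: inner_add_right inner_diff_right)
    have "?q = \<delta> * (a \<bullet> y - a \<bullet> g)" by (simp add: inner_add_right inner_diff_right algebra_simps)
    then have "?q > 0" using \<delta>(1) y(2) by simp
    then have "s1 * (a \<bullet> d) < 0" "0 < s2 * (a \<bullet> d)" using 1 by linarith+
    then show False using s1(1) s2(1) by (simp add: mult_less_0_iff zero_less_mult_iff)
  qed
  then show ?thesis using X by blast
qed

section \<open>Projection of a polytope along a unit vector\<close>

definition proj_along :: "real^'n::finite \<Rightarrow> real^'n \<Rightarrow> real^'n" where
  "proj_along e x = x - (e \<bullet> x) *\<^sub>R e"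

lemma linear_proj_along: "linear (proj_along e)"
  by (intro linearI) (simp_all add: proj_along_def inner_add_right algebra_simps)

lemma inner_proj_along: "a \<bullet> e = 0 \<Longrightarrow> a \<bullet> proj_along e x = a \<bullet> x"
  by (simp add: proj_along_def inner_diff_right)

lemma proj_along_eq_iff: "e \<bullet> e = 1 \<Longrightarrow> proj_along e x = proj_along e y \<longleftrightarrow> (\<exists>t. x - y = t *\<^sub>R e)"
proof
  assume "proj_along e x = proj_along e y"
  then have "x - y = (e \<bullet> x - e \<bullet> y) *\<^sub>R e" by (simp add: proj_along_def algebra_simps)
  then show "\<exists>t. x - y = t *\<^sub>R e" by blast
next
  assume ee: "e \<bullet> e = 1" and "\<exists>t. x - y = t *\<^sub>R e"
  then obtain t where "x = y + t *\<^sub>R e" by (metis add.commute diff_add_cancel)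
  then show "proj_along e x = proj_along e y" using ee by (simp add: proj_along_def inner_add_right algebra_simps)
qed

locale directed_polytope =
  fixes V :: "(real^'n::finite) set" and e :: "real^'n"
  assumes poly: "polytope V" and nonempty: "V \<noteq> {}" and unit_e: "e \<bullet> e = 1"
begin

abbreviation p :: "real^'n \<Rightarrow> real^'n" where "p \<equiv> proj_along e"

definition fibre :: "real^'n \<Rightarrow> (real^'n) set" where "fibre c = {x\<in>V. p x = c}"

definition long :: "real^'n \<Rightarrow> bool" where "long c \<longleftrightarrow> (\<exists>x\<in>V. \<exists>y\<in>V. x \<noteq> y \<and> p x = c \<and> p y = c)"

lemma long_fibre: "long c \<longleftrightarrow> (\<exists>x\<in>fibre c. \<exists>y\<in>fibre c. x \<noteq> y)"
  by (auto simp: long_def fibre_def)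

lemma convex_V: "convex V" using poly polytope_imp_convex by blast

lemma poly_image: "polytope (p ` V)" using polytope_linear_image[OF linear_proj_along poly] .

lemma affine_hull_proj: "p ` (affine hull Q) = affine hull (p ` Q)"
  by (rule affine_hull_linear_image) (use linear_proj_along linear_conv_bounded_linear in blast)

lemma face_preimage:
  assumes "X face_of p ` V" shows "{x\<in>V. p x \<in> X} face_of V"
proof -
  have conv: "convex {x\<in>V. p x \<in> X}"
  proof -
    have "{x\<in>V. p x \<in> X} = V \<inter> p -` X" by blast
    then show ?thesis using convex_V convex_linear_vimage[OF linear_proj_along face_of_imp_convex[OF assms]]
      by (simp add: convex_Int)
  qed
  have "x1 \<in> {x\<in>V. p x \<in> X} \<and> x2 \<in> {x\<in>V. p x \<in> X}"
    if x: "x1 \<in> V" "x2 \<in> V" "z \<in> {x\<in>V. p x \<in> X}" "z \<in> open_segment x1 x2" for x1 x2 z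
  proof -
    obtain u where u: "0 < u" "u < 1" "z = (1-u) *\<^sub>R x1 + u *\<^sub>R x2" using x(4) unfolding in_segment by blast
    have pz: "p z = (1-u) *\<^sub>R p x1 + u *\<^sub>R p x2" unfolding u(3)
      by (simp add: linear_add[OF linear_proj_along] linear_scale[OF linear_proj_along])
    show ?thesis
    proof (cases "p x1 = p x2")
      case True
      then have "p z = p x1" using pz by (simp add: scaleR_left_diff_distrib)
      then show ?thesis using True x by simp
    next
      case False
      then have "p z \<in> open_segment (p x1) (p x2)" unfolding in_segment using u pz by blast
      then show ?thesis using face_ofD[OF assms] x by blast
    qed
  qed
  then show ?thesis unfolding face_of_def using conv by blast
qed

text \<open>A functional exposing \<open>F\<close> is constant on \<open>F\<close>. As
  \<open>F\<close> contains two points of one fibre, it annihilates \<open>e\<close> and factors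
  through the projection; hence \<open>F\<close> is the full preimage of a face.\<close>

lemma vertical_face:
  assumes F: "F face_of V" and xy: "x \<in> F" "y \<in> F" "x \<noteq> y" "p x = p y"
  shows "p ` F face_of p ` V" "\<And>z. z \<in> V \<Longrightarrow> p z \<in> p ` F \<Longrightarrow> z \<in> F"
proof -
  have "F exposed_face_of V" using exposed_face_of_polyhedron[OF polytope_imp_polyhedron[OF poly]] F by blast
  then obtain a b where ab: "V \<subseteq> {x. a \<bullet> x \<le> b}" "F = V \<inter> {x. a \<bullet> x = b}" unfolding exposed_face_of_def by blast
  obtain t where t: "x - y = t *\<^sub>R e" using xy(4) proj_along_eq_iff[OF unit_e] by blast
  have "a \<bullet> (x - y) = 0" using xy ab(2) by (auto simp: inner_diff_right)
  then have ae: "a \<bullet> e = 0" using t xy(3) by auto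
  have ap: "a \<bullet> p z = a \<bullet> z" for z using inner_proj_along[OF ae] .
  have "p ` F = p ` V \<inter> {x. a \<bullet> x = b}" unfolding ab(2) using ap by auto
  moreover have "p ` V \<inter> {x. a \<bullet> x = b} face_of p ` V"
  proof (rule face_of_Int_supporting_hyperplane_le[OF polytope_imp_convex[OF poly_image]])
    fix z assume "z \<in> p ` V"
    then obtain v where "v \<in> V" "z = p v" by blast
    then show "a \<bullet> z \<le> b" using ab(1) ap by auto
  qed
  ultimately show "p ` F face_of p ` V" by simp
  show "z \<in> F" if z: "z \<in> V" "p z \<in> p ` F" for z
  proof -
    obtain x' where "x' \<in> F" "p z = p x'" using z(2) by blast
    then have "a \<bullet> z = b" using ab(2) ap[of z] ap[of x'] by simp
    then show ?thesis using z(1) ab(2) by simp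
  qed
qed

lemma fibre_face: "c extreme_point_of p ` V \<Longrightarrow> fibre c face_of V"
  using face_preimage[of "{c}"] by (simp add: face_of_singleton fibre_def)

lemma fibre_zone:
  assumes c: "c extreme_point_of p ` V" "long c" shows "fibre c \<in> zone V e"
proof -
  obtain x y where xy: "x \<in> fibre c" "y \<in> fibre c" "x \<noteq> y" using c(2) long_fibre by blast
  have par: "parallel_to (fibre c) e"
    unfolding parallel_to_def fibre_def by (simp add: proj_along_eq_iff[OF unit_e, symmetric])
  obtain t where t: "y - x = t *\<^sub>R e" using par xy unfolding parallel_to_def by blast
  then have t0: "t \<noteq> 0" using xy(3) by auto
  have "fibre c \<subseteq> affine hull {x, y}"
  proof
    fix z assume "z \<in> fibre c"
    then obtain s where "z - x = s *\<^sub>R e" using par xy unfolding parallel_to_def by blast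
    then have "z = x + (s / t) *\<^sub>R (y - x)" using t t0 by (simp add: algebra_simps)
    then show "z \<in> affine hull {x, y}" unfolding affine_hull_2_alt by blast
  qed
  then have "aff_dim (fibre c) \<le> 1" using aff_dim_subset[of "fibre c" "affine hull {x, y}"] xy(3) by simp
  moreover have "aff_dim {x, y} \<le> aff_dim (fibre c)" using xy by (intro aff_dim_subset) auto
  ultimately have "aff_dim (fibre c) = 1" using xy(3) by simp
  then show ?thesis using fibre_face[OF c(1)] par by (simp add: zone_def edges_of_def)
qed

text \<open>Together with \<open>fibre_zone\<close> this turns statements on zone edges into
  statements on vertices of the projection.\<close>

lemma zone_fibre:
  assumes "F \<in> zone V e"
  shows "\<exists>c. c extreme_point_of p ` V \<and> long c \<and> F = fibre c"
proof -
  have F: "F face_of V" "aff_dim F = 1" "parallel_to F e" using assms by (auto simp: zone_def edges_of_def)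
  have "F \<noteq> {}" using F(2) by auto
  then obtain x where x: "x \<in> F" by blast
  have "F \<noteq> {x}" using F(2) by auto
  then obtain y where y: "y \<in> F" "x \<noteq> y" using x by blast
  have pF: "p z = p x" if "z \<in> F" for z using that x F(3) proj_along_eq_iff[OF unit_e] unfolding parallel_to_def by blast
  then have im: "p ` F = {p x}" using x by blast
  have "p ` F face_of p ` V" using vertical_face(1)[OF F(1) x y(1,2)] pF[OF y(1)] by simp
  then have ex: "p x extreme_point_of p ` V" using im by (simp add: face_of_singleton)
  have FV: "F \<subseteq> V" using F(1) face_of_imp_subset by blast
  have "long (p x)" unfolding long_def using x y pF FV by blast
  moreover have "F = fibre (p x)"
    using vertical_face(2)[OF F(1) x y(1,2)] pF y(1) im FV unfolding fibre_def by auto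
  ultimately show ?thesis using ex by blast
qed

lemma closed_zone_if_long:
  assumes all: "\<And>c. c extreme_point_of p ` V \<Longrightarrow> long c"
  shows "has_closed_zone V e"
proof -
  have "compact (p ` V)" "convex (p ` V)" "p ` V \<noteq> {}"
    using poly_image polytope_imp_compact polytope_imp_convex nonempty by blast+
  then obtain c0 where "c0 extreme_point_of p ` V" using extreme_point_exists_convex by blast
  then have ne: "zone V e \<noteq> {}" using fibre_zone all by blast
  have "card {F \<in> zone V e. F \<subseteq> G} \<in> {0, 2}" if G: "G face_of V" "aff_dim G = 2" for G
  proof (cases "{F \<in> zone V e. F \<subseteq> G} = {}")
    case False
    then obtain F where F: "F \<in> zone V e" "F \<subseteq> G" by blast
    then obtain c where c: "c extreme_point_of p ` V" "long c" "F = fibre c" using zone_fibre by blast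
    then obtain x y where xy: "x \<in> fibre c" "y \<in> fibre c" "x \<noteq> y" using long_fibre by blast
    have xyG: "x \<in> G" "y \<in> G" "p x = c" "p y = c" using xy F(2) c(3) by (auto simp: fibre_def)
    have vert: "p ` G face_of p ` V" "\<And>z. z \<in> V \<Longrightarrow> p z \<in> p ` G \<Longrightarrow> z \<in> G"
      using vertical_face[OF G(1) xyG(1,2) xy(3)] xyG by auto
    let ?X = "p ` G"
    have GV: "G \<subseteq> V" using G(1) face_of_imp_subset by blast
    have compX: "compact ?X" "convex ?X"
      using face_of_imp_compact[OF \<open>convex (p ` V)\<close> \<open>compact (p ` V)\<close> vert(1)] face_of_imp_convex[OF vert(1)] by auto
    have exX: "q extreme_point_of ?X \<longleftrightarrow> q extreme_point_of p ` V \<and> q \<in> ?X" for q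
      using extreme_point_of_face[OF vert(1)] .
    have cX: "c extreme_point_of ?X" using exX c(1) xyG by blast
    have "\<exists>c'. c' extreme_point_of ?X \<and> c' \<noteq> c"
    proof (rule ccontr)
      assume "\<nexists>c'. c' extreme_point_of ?X \<and> c' \<noteq> c"
      then have "{q. q extreme_point_of ?X} \<subseteq> {c}" by blast
      then have "convex hull {q. q extreme_point_of ?X} \<subseteq> convex hull {c}" by (rule hull_mono)
      then have "?X \<subseteq> {c}" using Krein_Milman_Minkowski[OF compX] by simp
      then have "G \<subseteq> fibre c" using GV by (auto simp: fibre_def)
      then have "aff_dim G \<le> aff_dim F" using c(3) aff_dim_subset by blast
      then show False using F(1) G(2) by (simp add: zone_def edges_of_def)
    qed
    then obtain c' where c': "c' extreme_point_of ?X" "c' \<noteq> c" by blast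
    then have c'V: "c' extreme_point_of p ` V" using exX by blast
    have F': "fibre c' \<in> zone V e" using fibre_zone[OF c'V all[OF c'V]] .
    have fib_sub: "fibre q \<subseteq> G" if "q \<in> ?X" for q using that vert(2) by (auto simp: fibre_def)
    have F'G: "fibre c' \<subseteq> G" using fib_sub c'(1) by (auto simp: extreme_point_of_def)
    obtain w where w: "w \<in> G" "p w = c'" using c'(1) by (auto simp: extreme_point_of_def)
    have "F3 = F \<or> F3 = fibre c'" if F3: "F3 \<in> zone V e" "F3 \<subseteq> G" for F3
    proof (rule ccontr)
      assume neq: "\<not> (F3 = F \<or> F3 = fibre c')"
      obtain c3 where c3: "c3 extreme_point_of p ` V" "long c3" "F3 = fibre c3" using zone_fibre F3(1) by blast
      obtain z where z: "z \<in> G" "p z = c3" using c3 F3(2) long_fibre unfolding fibre_def by blast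
      have c3X: "c3 extreme_point_of ?X" using exX c3(1) z by blast
      have ne3: "c3 \<noteq> c" "c3 \<noteq> c'" using neq c3(3) c(3) by auto
      \<comment> \<open>A third vertex of \<open>?X\<close> would not be collinear with
        \<open>c\<close> and \<open>c'\<close>. Points above \<open>c'\<close> and \<open>c3\<close>
        together with the vertical pair \<open>x\<close>, \<open>y\<close> would be four affinely
        independent points in a face of dimension 2.\<close>
      have nc: "c3 \<notin> affine hull {c, c'}"
        using extreme_points_not_collinear[OF cX c'(1) c3X] c'(2) ne3 affine_hull_3_imp_collinear by metis
      have "w \<notin> affine hull {x, y}"
      proof
        assume "w \<in> affine hull {x, y}"
        then have "p w \<in> affine hull (p ` {x, y})" using affine_hull_proj by blast
        then show False using xyG w(2) c'(2) by simp
      qed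
      then have a2: "aff_dim {w, x, y} = 2" using aff_dim_insert[of w "{x, y}"] xy(3) by simp
      have "z \<notin> affine hull {w, x, y}"
      proof
        assume "z \<in> affine hull {w, x, y}"
        then have "p z \<in> affine hull (p ` {w, x, y})" using affine_hull_proj by blast
        then show False using xyG w(2) z(2) nc by (simp add: insert_commute)
      qed
      then have "aff_dim {z, w, x, y} = 3" using aff_dim_insert[of z "{w, x, y}"] a2 by simp
      moreover have "aff_dim {z, w, x, y} \<le> aff_dim G" using z w xyG by (intro aff_dim_subset) auto
      ultimately show False using G(2) by simp
    qed
    then have "{F \<in> zone V e. F \<subseteq> G} = {F, fibre c'}" using F F' F'G by blast
    moreover have "F \<noteq> fibre c'" using xy(1) c(3) c'(2) by (auto simp: fibre_def)
    ultimately show ?thesis by simp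
  next
    case True
    show ?thesis unfolding True by simp
  qed
  then show ?thesis using ne unfolding has_closed_zone_def by blast
qed

text \<open>Closedness of the zone carries \<open>long\<close> across the edges of the projected polytope, and \<open>improving_edge\<close>
  connects its vertices.\<close>
lemma long_if_closed_zone:
  assumes cz: "has_closed_zone V e" and c1: "c1 extreme_point_of p ` V"
  shows "long c1"
proof (rule ccontr)
  assume bad: "\<not> long c1"
  let ?Good = "{c. c extreme_point_of p ` V \<and> long c}"
  have "finite ?Good" using finite_polyhedron_extreme_points[OF polytope_imp_polyhedron[OF poly_image]] by simp
  have "?Good \<noteq> {}" using cz zone_fibre unfolding has_closed_zone_def by blast
  have Gsub: "convex hull ?Good \<subseteq> p ` V"
    using polytope_imp_convex[OF poly_image] by (intro hull_minimal) (auto simp: extreme_point_of_def)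
  \<comment> \<open>\<open>c1\<close> is extreme in a larger set, so in this hull it would be
    extreme and thus one of the generators.\<close>
  have "c1 \<notin> convex hull ?Good"
  proof
    assume "c1 \<in> convex hull ?Good"
    then have "c1 extreme_point_of convex hull ?Good" using c1 Gsub unfolding extreme_point_of_def by blast
    then show False using extreme_point_of_convex_hull bad by blast
  qed
  then obtain a b where ab: "a \<bullet> c1 < b" "\<And>q. q \<in> convex hull ?Good \<Longrightarrow> b < a \<bullet> q"
    using separating_hyperplane_closed_point[of "convex hull ?Good" c1] \<open>finite ?Good\<close>
    by (auto simp: compact_imp_closed finite_imp_compact_convex_hull)
  \<comment> \<open>Among the good vertices \<open>g\<close> goes farthest along \<open>- a\<close>.
    Since \<open>c1\<close> goes farther, some edge leaves \<open>g\<close> in that direction;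
    closedness provides a second zone edge over it, at a good vertex that beats
    \<open>g\<close>.\<close>
  from finite_has_min[OF \<open>finite ?Good\<close> \<open>?Good \<noteq> {}\<close>, of "\<lambda>v. a \<bullet> v"]
  obtain g where g: "g \<in> ?Good" "\<And>q. q \<in> ?Good \<Longrightarrow> a \<bullet> g \<le> a \<bullet> q" by (elim bexE) simp
  have gex: "g extreme_point_of p ` V" "long g" using g(1) by auto
  have "b < a \<bullet> g" by (rule ab(2)[OF hull_inc[OF g(1)]])
  then have less: "(-a) \<bullet> g < (-a) \<bullet> c1" using ab(1) by simp
  have c1V: "c1 \<in> p ` V" using c1 by (simp add: extreme_point_of_def)
  obtain E x where E: "E face_of p ` V" "aff_dim E = 1" "g \<in> E" "x \<in> E" "(-a) \<bullet> g < (-a) \<bullet> x"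
    using improving_edge[OF poly_image gex(1) c1V less] by blast
  have gx: "g \<noteq> x" using E(5) by auto
  have Eline: "\<exists>u. q = g + u *\<^sub>R (x - g)" if q: "q \<in> E" for q
  proof -
    have "q \<in> affine hull {g, x}"
    proof (rule ccontr)
      assume "q \<notin> affine hull {g, x}"
      then have "aff_dim {q, g, x} = 2" using aff_dim_insert[of q "{g, x}"] gx by simp
      moreover have "aff_dim {q, g, x} \<le> aff_dim E" using q E(3,4) by (intro aff_dim_subset) auto
      ultimately show False using E(2) by simp
    qed
    then show ?thesis unfolding affine_hull_2_alt by blast
  qed
  \<comment> \<open>The preimage of the edge has dimension 2: it is spanned by the vertical pair
    \<open>y1\<close>, \<open>y2\<close> and one point \<open>w\<close> above
    \<open>x\<close>.\<close>
  let ?G = "{y\<in>V. p y \<in> E}"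
  have Gface: "?G face_of V" using face_preimage[OF E(1)] .
  obtain y1 y2 where y: "y1 \<in> fibre g" "y2 \<in> fibre g" "y1 \<noteq> y2" using gex(2) long_fibre by blast
  have yG: "y1 \<in> ?G" "y2 \<in> ?G" "p y1 = g" "p y2 = g" using y E(3) by (auto simp: fibre_def)
  obtain t where t: "y2 - y1 = t *\<^sub>R e" using yG(3,4) proj_along_eq_iff[OF unit_e] by metis
  have t0: "t \<noteq> 0" using t y(3) by auto
  have "x \<in> p ` V" using E(1,4) face_of_imp_subset by blast
  then obtain w where w: "w \<in> V" "p w = x" by blast
  have "?G \<subseteq> affine hull {y1, y2, w}"
  proof
    fix z assume z: "z \<in> ?G"
    then obtain u where u: "p z = g + u *\<^sub>R (x - g)" using Eline by blast
    have "p z = p (y1 + u *\<^sub>R (w - y1))"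
      using u yG(3) w(2) by (simp add: linear_add[OF linear_proj_along] linear_diff[OF linear_proj_along] linear_scale[OF linear_proj_along])
    then obtain s where "z - (y1 + u *\<^sub>R (w - y1)) = s *\<^sub>R e" using proj_along_eq_iff[OF unit_e] by blast
    moreover have "s *\<^sub>R e = (s / t) *\<^sub>R (y2 - y1)" using t t0 by simp
    ultimately have "z = y1 + u *\<^sub>R (w - y1) + (s / t) *\<^sub>R (y2 - y1)" by (simp add: algebra_simps)
    also have "\<dots> = (1 - u - s / t) *\<^sub>R y1 + (s / t) *\<^sub>R y2 + u *\<^sub>R w" by (simp add: algebra_simps)
    finally show "z \<in> affine hull {y1, y2, w}" unfolding affine_hull_3
      by (intro CollectI exI[of _ "1 - u - s / t"] exI[of _ "s / t"] exI[of _ u]) simp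
  qed
  then have "aff_dim ?G \<le> aff_dim {y1, y2, w}" by (metis aff_dim_affine_hull aff_dim_subset)
  moreover have "aff_dim {y1, y2, w} \<le> aff_dim ?G" using yG w E(4) by (intro aff_dim_subset) auto
  moreover have "aff_dim {y1, y2, w} = 2"
  proof -
    have "w \<notin> affine hull {y1, y2}"
    proof
      assume "w \<in> affine hull {y1, y2}"
      then have "p w \<in> affine hull (p ` {y1, y2})" using affine_hull_proj by blast
      then show False using yG w(2) gx by simp
    qed
    then have "aff_dim {w, y1, y2} = 2" using aff_dim_insert[of w "{y1, y2}"] y(3) by simp
    then show ?thesis by (simp add: insert_commute)
  qed
  ultimately have "aff_dim ?G = 2" by simp
  then have "card {F \<in> zone V e. F \<subseteq> ?G} \<in> {0, 2}" using cz Gface unfolding has_closed_zone_def by blast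
  moreover have "fibre g \<in> {F \<in> zone V e. F \<subseteq> ?G}" using fibre_zone[OF gex] E(3) by (auto simp: fibre_def)
  moreover have "finite {F \<in> zone V e. F \<subseteq> ?G}"
    by (rule finite_subset[of _ "fibre ` ?Good"]) (use zone_fibre \<open>finite ?Good\<close> in auto)
  ultimately have "card {F \<in> zone V e. F \<subseteq> ?G} = 2" using card_eq_0_iff by auto
  then have "{F \<in> zone V e. F \<subseteq> ?G} \<noteq> {fibre g}" by auto
  then obtain F' where F': "F' \<in> zone V e" "F' \<subseteq> ?G" "F' \<noteq> fibre g"
    using \<open>fibre g \<in> {F \<in> zone V e. F \<subseteq> ?G}\<close> by blast
  then obtain c' where c': "c' extreme_point_of p ` V" "long c'" "F' = fibre c'" using zone_fibre by blast
  have c'g: "c' \<noteq> g" using F'(3) c'(3) by auto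
  obtain z where "z \<in> fibre c'" using c'(2) long_fibre by blast
  then have c'E: "c' \<in> E" using F'(2) c'(3) by (auto simp: fibre_def)
  then obtain u where u: "c' = g + u *\<^sub>R (x - g)" using Eline by blast
  \<comment> \<open>Otherwise \<open>g\<close> would lie strictly between \<open>c'\<close> and
    \<open>x\<close>, although it is extreme.\<close>
  have "u > 0"
  proof (rule ccontr)
    assume "\<not> u > 0"
    then have "u < 0" using u c'g by (cases "u = 0") auto
    let ?s = "- u / (1 - u)"
    have "0 < - u" "- u < 1 - u" "0 < 1 - u" using \<open>u < 0\<close> by auto
    then have s: "0 < ?s" "?s < 1" by (auto simp only: divide_less_eq_1_pos intro!: divide_pos_pos)
    have "(1 - ?s) *\<^sub>R c' + ?s *\<^sub>R x = g + ((1 - ?s) * u + ?s) *\<^sub>R (x - g)"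
      unfolding u by (simp add: algebra_simps)
    also have "(1 - ?s) * u + ?s = 0" using \<open>u < 0\<close> by (simp add: field_simps)
    finally have "g = (1 - ?s) *\<^sub>R c' + ?s *\<^sub>R x" by simp
    moreover have "c' \<noteq> x"
    proof
      assume "c' = x"
      then have "x - g = u *\<^sub>R (x - g)" using u by (metis add_diff_cancel_left')
      then have "(1 - u) *\<^sub>R (x - g) = 0" unfolding scaleR_left_diff_distrib by simp
      then show False using gx \<open>u < 0\<close> by simp
    qed
    ultimately have "g \<in> open_segment c' x" unfolding in_segment using s by blast
    moreover have "c' \<in> p ` V" "x \<in> p ` V" using c'E E(1,4) face_of_imp_subset by blast+
    ultimately show False using gex(1) unfolding extreme_point_of_def by blast
  qed
  then have "u * (a \<bullet> x - a \<bullet> g) < 0" using E(5) by (intro mult_pos_neg) auto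
  then have "a \<bullet> c' < a \<bullet> g" unfolding u by (simp add: inner_add_right inner_diff_right)
  moreover have "a \<bullet> g \<le> a \<bullet> c'" using g(2) c' by blast
  ultimately show False by linarith
qed

lemma closed_zone_iff: "has_closed_zone V e \<longleftrightarrow> (\<forall>c. c extreme_point_of p ` V \<longrightarrow> long c)"
  using closed_zone_if_long long_if_closed_zone by blast

end

section \<open>Laminae and closed zones\<close>

context lattice_hyperplane begin

sublocale dp: directed_polytope "voronoi S" e
  using polytope_vor vor_eq zero_vor ee by unfold_locales auto

lemma h_vor_eq: "h.vor = voronoi (S \<inter> H) \<inter> H"
  by (simp add: h.vor_def span_hyperplane)

lemma proj_hyperplane: "proj_along e x \<in> H"
  by (simp add: proj_along_def inner_diff_right ee)

lemma proj_id: "x \<in> H \<Longrightarrow> proj_along e x = x"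
  by (simp add: proj_along_def)

lemma inner_proj: "v \<in> H \<Longrightarrow> proj_along e x \<bullet> v = x \<bullet> v"
  by (simp add: proj_along_def inner_diff_left)

lemma affine_hull_tight_imp_H:
  assumes "c extreme_point_of h.vor"
  shows "affine hull (tight (S \<inter> H) c) = H" "c \<in> voronoi (S \<inter> H)" "c \<in> H"
  using assms h.vor_extreme_iff[of c] h.affine_hull_tight[of c] span_hyperplane h_vor_eq by auto

lemma proj_voronoi_subset: "proj_along e ` voronoi S \<subseteq> h.vor"
proof
  fix y assume "y \<in> proj_along e ` voronoi S"
  then obtain m where m: "m \<in> voronoi S" "y = proj_along e m" by blast
  have "2 * (y \<bullet> v) \<le> v \<bullet> v" if "v \<in> S \<inter> H" for v
    using that m(1) inner_proj[of v m] by (auto simp: m(2) voronoi_iff)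
  then show "y \<in> h.vor" unfolding h_vor_eq using proj_hyperplane m(2) by (simp add: voronoi_iff)
qed

lemma orthogonal_hyperplane:
  assumes "\<And>v. v \<in> H \<Longrightarrow> a \<bullet> v = 0" shows "a = (e \<bullet> a) *\<^sub>R e"
proof -
  have "a \<bullet> proj_along e a = 0" using assms proj_hyperplane by blast
  moreover have "e \<bullet> proj_along e a = 0" using proj_hyperplane[of a] by simp
  ultimately have "proj_along e a \<bullet> proj_along e a = 0"
    by (simp add: proj_along_def inner_diff_left inner_commute)
  then show ?thesis by (simp add: proj_along_def)
qed

text \<open>The cell of the section dual to \<open>c\<close> is a facet of a cell \<open>Z\<close>
  of the lattice. The vertex \<open>m\<close> dual to \<open>Z\<close> lies above \<open>c\<close>,
  and the outer normal \<open>a\<close> of that facet is a multiple of \<open>e\<close>. As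
  \<open>a\<close> is nonpositive on \<open>Z\<close>, it is a feasible direction at
  \<open>m\<close>, so the fibre over \<open>c\<close> is more than a point.\<close>

lemma lamina_long_extreme:
  assumes lam: "lamina S H" and c: "c extreme_point_of h.vor"
  shows "dp.long c"
proof -
  let ?T = "tight (S \<inter> H) c"
  note T = affine_hull_tight_imp_H[OF c]
  have near: "nearest (S \<inter> H) c = ?T" using h.nearest_voronoi T(2) by blast
  then have "convex hull ?T \<in> delaunay_cells (S \<inter> H) H (int CARD('n) - 1)"
    using affine_hull_imp_cell[OF T(3)] T(1) by simp
  then obtain Z where Z: "Z \<in> dcells S (qe e 0)" "convex hull ?T face_of convex hull Z"
    using lam delaunay_cells_eq unfolding lamina_def qe_zero by auto
  have TZ: "?T \<subseteq> Z"
  proof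
    fix v assume v: "v \<in> ?T"
    then have "v \<in> convex hull Z" using Z(2) face_of_imp_subset hull_inc[of v ?T convex] by blast
    moreover have "v \<in> S" using v by (simp add: tight_def)
    ultimately show "v \<in> Z" using conv_mem_qe[of 0 Z v] Z(1) by simp
  qed
  have "0 \<in> ?T" by (rule h.zero_tight)
  then have "Z \<in> star S (\<lambda>v. v \<bullet> v)" using Z(1) TZ unfolding star_def qe_zero by blast
  then obtain m where m: "m extreme_point_of voronoi S" "Z = tight S m" using star_eq by blast
  have mV: "m \<in> voronoi S" using m(1) by (simp add: extreme_point_of_def)
  have "(m - c) \<bullet> v = 0" if "v \<in> ?T" for v
  proof -
    have "2 * (m \<bullet> v) = v \<bullet> v" "2 * (c \<bullet> v) = v \<bullet> v" using that TZ m(2) by (auto simp: tight_def)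
    then show ?thesis by (simp add: inner_diff_left)
  qed
  then have "?T \<subseteq> {x. (m - c) \<bullet> x = 0}" by blast
  then have "H \<subseteq> {x. (m - c) \<bullet> x = 0}" using hull_minimal[of ?T _ affine] affine_hyperplane T(1) by metis
  then have mc: "m - c = (e \<bullet> (m - c)) *\<^sub>R e" by (intro orthogonal_hyperplane) blast
  have pm: "proj_along e m = c"
    using mc proj_along_eq_iff[OF ee] proj_id[OF T(3)] by metis
  have finZ: "finite Z" using m(2) finite_tight by simp
  have "convex hull ?T exposed_face_of convex hull Z"
    using exposed_face_of_polyhedron[OF polyhedron_convex_hull[OF finZ]] Z(2) by blast
  then obtain a b where ab: "convex hull Z \<subseteq> {x. a \<bullet> x \<le> b}" "convex hull ?T = convex hull Z \<inter> {x. a \<bullet> x = b}"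
    unfolding exposed_face_of_def by blast
  have hT: "a \<bullet> v = b" if "v \<in> ?T" for v using hull_inc[OF that, of convex] ab(2) by blast
  then have b0: "b = 0" using \<open>0 \<in> ?T\<close> by force
  then have "?T \<subseteq> {x. a \<bullet> x = 0}" using hT by blast
  then have "H \<subseteq> {x. a \<bullet> x = 0}" using hull_minimal[of ?T _ affine] affine_hyperplane T(1) by metis
  then have ae: "a = (e \<bullet> a) *\<^sub>R e" by (intro orthogonal_hyperplane) blast
  \<comment> \<open>An exposed face may be the whole polytope; here it spans only
    \<open>H\<close>.\<close>
  have a0: "a \<noteq> 0"
  proof
    assume "a = 0"
    then have "convex hull ?T = convex hull Z" using ab(2) b0 by simp
    then have "affine hull ?T = affine hull Z" by (metis affine_hull_convex_hull)
    moreover have "affine hull Z = UNIV" using Z(1) unfolding dcells_def by blast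
    ultimately have "e \<in> H" using T(1) by blast
    then show False using ee by simp
  qed
  have "a \<bullet> v \<le> 0" if "v \<in> tight S m" for v
    using ab(1) b0 that m(2) hull_inc[of v Z convex] by blast
  then obtain \<delta> where d: "\<delta> > 0" "m + \<delta> *\<^sub>R a \<in> voronoi S" using voronoi_move[OF mV] by blast
  have "m + \<delta> *\<^sub>R a - m = (\<delta> * (e \<bullet> a)) *\<^sub>R e" using ae by (metis add_diff_cancel_left' scaleR_scaleR)
  then have "proj_along e (m + \<delta> *\<^sub>R a) = c" using proj_along_eq_iff[OF ee] pm by metis
  moreover have "m + \<delta> *\<^sub>R a \<noteq> m" using d(1) a0 by simp
  ultimately show ?thesis unfolding dp.long_def using mV d(2) pm by blast
qed

lemma lamina_imp_long:
  assumes lam: "lamina S H" and c: "c extreme_point_of proj_along e ` voronoi S"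
  shows "dp.long c"
proof -
  have "{c. c extreme_point_of h.vor} \<subseteq> proj_along e ` voronoi S"
    using lamina_long_extreme[OF lam] unfolding dp.long_def by blast
  then have "convex hull {c. c extreme_point_of h.vor} \<subseteq> proj_along e ` voronoi S"
    using polytope_imp_convex[OF dp.poly_image] by (intro hull_minimal)
  then have "h.vor \<subseteq> proj_along e ` voronoi S"
    using Krein_Milman_Minkowski[OF h.compact_vor h.convex_vor] by simp
  then have "proj_along e ` voronoi S = h.vor" using proj_voronoi_subset by blast
  then show ?thesis using lamina_long_extreme[OF lam] c by simp
qed

text \<open>A constraint tight at the midpoint of two points of the fibre is tight at both, so its
  vector is orthogonal to \<open>e\<close>. Thus the sphere about the midpoint meets the lattice
  only in the section.\<close>

lemma long_midpoint:
  assumes "dp.long c"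
  obtains m where "m \<in> voronoi S" "proj_along e m = c" "tight S m = tight (S \<inter> H) c"
proof -
  obtain x y where xy: "x \<in> voronoi S" "y \<in> voronoi S" "x \<noteq> y" "proj_along e x = c" "proj_along e y = c"
    using assms unfolding dp.long_def by blast
  obtain t where t: "x - y = t *\<^sub>R e" using xy(4,5) proj_along_eq_iff[OF ee] by metis
  have t0: "t \<noteq> 0" using t xy(3) by auto
  define m where "m = (1/2) *\<^sub>R x + (1/2) *\<^sub>R y"
  have mV: "m \<in> voronoi S" unfolding m_def using convexD[OF convex_voronoi xy(1,2), of "1/2" "1/2"] by simp
  have pm: "proj_along e m = c" unfolding m_def
    using xy(4,5) by (simp add: linear_add[OF linear_proj_along] linear_scale[OF linear_proj_along] scaleR_left.add[symmetric])
  have "v \<in> H" if v: "v \<in> tight S m" for v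
  proof -
    have "2 * (x \<bullet> v) \<le> v \<bullet> v" "2 * (y \<bullet> v) \<le> v \<bullet> v" "2 * (m \<bullet> v) = v \<bullet> v"
      using v xy(1,2) by (auto simp: tight_def voronoi_iff)
    then have "(x - y) \<bullet> v = 0" unfolding m_def by (simp add: inner_add_left inner_diff_left)
    then show ?thesis using t t0 by simp
  qed
  moreover have "v \<in> tight (S \<inter> H) c \<longleftrightarrow> v \<in> tight S m" if "v \<in> H" for v
    using inner_proj[OF that, of m] pm that by (simp add: tight_def)
  moreover have "tight (S \<inter> H) c \<subseteq> H" by (auto simp: tight_def)
  ultimately have "tight S m = tight (S \<inter> H) c" by blast
  then show ?thesis using that mV pm by blast
qed

text \<open>Separate a missing point \<open>y\<close> from the projection by \<open>a\<close>, and
  let \<open>g\<close> be a vertex minimising \<open>a\<close>. The constraints tight at the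
  midpoint over \<open>g\<close> all come from \<open>H\<close>, and \<open>y\<close> satisfies
  them, so one can move from the midpoint towards \<open>y\<close> and get below the
  minimum.\<close>

lemma long_imp_proj_eq:
  assumes all: "\<And>c. c extreme_point_of proj_along e ` voronoi S \<Longrightarrow> dp.long c"
  shows "proj_along e ` voronoi S = h.vor"
proof
  let ?K = "proj_along e ` voronoi S"
  have K: "compact ?K" "convex ?K" "?K \<noteq> {}"
    using dp.poly_image polytope_imp_compact polytope_imp_convex dp.nonempty by blast+
  show "h.vor \<subseteq> ?K"
  proof (rule subsetI, rule ccontr)
    fix y assume y: "y \<in> h.vor" and ny: "y \<notin> ?K"
    obtain a b where ab: "a \<bullet> y < b" "\<And>q. q \<in> ?K \<Longrightarrow> b < a \<bullet> q"
      using separating_hyperplane_closed_point[OF K(2) compact_imp_closed[OF K(1)] ny] by blast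
    have "continuous_on ?K ((\<bullet>) a)" by (intro continuous_intros)
    then obtain q0 where q0: "q0 \<in> ?K" "\<And>q. q \<in> ?K \<Longrightarrow> a \<bullet> q0 \<le> a \<bullet> q"
      using continuous_attains_inf[OF K(1,3)] by blast
    let ?F = "?K \<inter> {x. a \<bullet> x = a \<bullet> q0}"
    have F: "?F face_of ?K" using face_of_Int_supporting_hyperplane_ge[OF K(2)] q0(2) by blast
    have "compact ?F" "convex ?F" "?F \<noteq> {}"
      using face_of_imp_compact[OF K(2,1) F] face_of_imp_convex[OF F] q0(1) by auto
    then obtain g where "g extreme_point_of ?F" using extreme_point_exists_convex by blast
    then have g: "g extreme_point_of ?K" "a \<bullet> g = a \<bullet> q0" using extreme_point_of_face[OF F] by auto
    obtain m where m: "m \<in> voronoi S" "proj_along e m = g" "tight S m = tight (S \<inter> H) g"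
      using long_midpoint[OF all[OF g(1)]] .
    have yH: "y \<in> H" "\<And>v. v \<in> S \<inter> H \<Longrightarrow> 2 * (y \<bullet> v) \<le> v \<bullet> v"
      using y unfolding h_vor_eq by (blast, simp add: voronoi_iff)
    have "(y - m) \<bullet> v \<le> 0" if "v \<in> tight S m" for v
    proof -
      have "v \<in> S \<inter> H" "2 * (m \<bullet> v) = v \<bullet> v" using that m(3) by (auto simp: tight_def)
      then show ?thesis using yH(2)[of v] by (simp add: inner_diff_left)
    qed
    then obtain \<delta> where d: "\<delta> > 0" "m + \<delta> *\<^sub>R (y - m) \<in> voronoi S" using voronoi_move[OF m(1)] by blast
    have "proj_along e (m + \<delta> *\<^sub>R (y - m)) = g + \<delta> *\<^sub>R (y - g)"
      using m(2) proj_id[OF yH(1)]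
      by (simp add: linear_add[OF linear_proj_along] linear_diff[OF linear_proj_along] linear_scale[OF linear_proj_along])
    then have "g + \<delta> *\<^sub>R (y - g) \<in> ?K" using d(2) by (metis imageI)
    then have "a \<bullet> g \<le> a \<bullet> (g + \<delta> *\<^sub>R (y - g))" using q0(2) g(2) by metis
    then have "0 \<le> \<delta> * (a \<bullet> y - a \<bullet> g)" by (simp add: inner_add_right inner_diff_right)
    then have "a \<bullet> g \<le> a \<bullet> y" using d(1) by (simp add: zero_le_mult_iff)
    moreover have "b < a \<bullet> g" using ab(2) g(1) by (simp add: extreme_point_of_def)
    ultimately show False using ab(1) by linarith
  qed
qed (rule proj_voronoi_subset)

text \<open>A translate of the centre is a vertex of the Voronoi polytope of the section, hence of
  the projection. Lifted to a midpoint, it becomes the centre of an empty sphere of the whole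
  lattice through the same points, to which \<open>face_extend\<close> applies.\<close>

lemma long_imp_lamina:
  assumes all: "\<And>c. c extreme_point_of proj_along e ` voronoi S \<Longrightarrow> dp.long c"
  shows "lamina S H"
  unfolding lamina_def
proof
  fix P assume "P \<in> delaunay_cells (S \<inter> H) H (int CARD('n) - 1)"
  then obtain c where c: "c \<in> H" "P = convex hull (nearest (S \<inter> H) c)" "aff_dim P = int CARD('n) - 1"
    using h.delaunay_cells_iff[OF card_pos] by blast
  obtain w where w: "w \<in> nearest (S \<inter> H) c" using h.nearest_nonempty by blast
  have wS: "w \<in> S \<inter> H" using w by (simp add: nearest_def)
  let ?c = "c - w"
  have cv: "?c \<in> voronoi (S \<inter> H)" using h.nearest_diff_voronoi[OF w] .
  have cH: "?c \<in> H" using c(1) wS by (simp add: inner_diff_right)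
  have near: "nearest (S \<inter> H) c = (+) w ` tight (S \<inter> H) ?c" using h.nearest_add[OF cv wS] by simp
  let ?U = "span (tight (S \<inter> H) ?c)"
  have "?U \<subseteq> span (S \<inter> H)" by (rule span_mono) (auto simp: tight_def)
  then have UH: "?U \<subseteq> H" using span_hyperplane by simp
  have "aff_dim (tight (S \<inter> H) ?c) = int CARD('n) - 1"
    using c(2,3) near by (simp add: aff_dim_convex_hull aff_dim_translation_eq)
  then have "aff_dim ?U = aff_dim H" unfolding aff_dim_hyperplane_e
    using h.affine_hull_tight[of ?c] by (metis aff_dim_affine_hull)
  moreover have sub: "subspace ?U" "subspace H" by (auto intro: subspace_hyperplane)
  ultimately have "dim ?U = dim H" using aff_dim_subspace by (metis of_nat_eq_iff)
  then have "?U = H" using subspace_dim_equal[OF sub UH] by simp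
  then have "?c extreme_point_of h.vor"
    using h.vor_extreme_iff[of ?c] cv cH span_hyperplane h_vor_eq by simp
  then have "dp.long ?c" using all long_imp_proj_eq[OF all] by simp
  then obtain m where m: "m \<in> voronoi S" "proj_along e m = ?c" "tight S m = tight (S \<inter> H) ?c"
    by (rule long_midpoint)
  have "nearest S (m + w) = nearest (S \<inter> H) c" using nearest_add[OF m(1), of w] wS m(3) near by simp
  then obtain Z where "Z \<in> dcells S (\<lambda>v. v \<bullet> v)" "P face_of convex hull Z"
    using face_extend[of "m + w"] c(2) by auto
  then show "\<exists>Q\<in>delaunay_cells S UNIV (int CARD('n)). P face_of Q" using delaunay_cells_eq by blast
qed

lemma lamina_iff_closed_zone: "lamina S H \<longleftrightarrow> has_closed_zone (voronoi S) e"
  using lamina_imp_long long_imp_lamina dp.closed_zone_iff by blast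

end

section \<open>Gram matrices and coefficient space\<close>

definition basis_map :: "('n::finite \<Rightarrow> real^'n) \<Rightarrow> real^'n \<Rightarrow> real^'n" where
  "basis_map b x = (\<Sum>i\<in>UNIV. (x $ i) *\<^sub>R b i)"

lemma linear_basis_map: "linear (basis_map b)"
  by (intro linearI) (simp_all add: basis_map_def sum.distrib scaleR_left_distrib scaleR_sum_right)

lemma bij_basis_map:
  assumes "lin_indep_family b" shows "bij (basis_map b)"
proof -
  have "x = 0" if "basis_map b x = 0" for x
  proof -
    have "\<forall>i. x $ i = 0" using assms that unfolding lin_indep_family_def basis_map_def by blast
    then show ?thesis by (simp add: vec_eq_iff)
  qed
  then have "inj (basis_map b)" using linear_injective_0[OF linear_basis_map] by blast
  then show ?thesis using linear_injective_imp_surjective[OF linear_basis_map] by (simp add: bij_def)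
qed

lemma lattice_of_eq: "lattice_of b = basis_map b ` int_points"
proof (intro set_eqI iffI)
  fix v assume "v \<in> lattice_of b"
  then obtain z :: "'a \<Rightarrow> int" where "v = (\<Sum>i\<in>UNIV. of_int (z i) *\<^sub>R b i)" unfolding lattice_of_def by blast
  then have "v = basis_map b (\<chi> i. of_int (z i))" by (simp add: basis_map_def)
  moreover have "(\<chi> i. of_int (z i)) \<in> int_points" by (simp add: int_points_def)
  ultimately show "v \<in> basis_map b ` int_points" by blast
next
  fix v assume "v \<in> basis_map b ` int_points"
  then obtain x where x: "x \<in> int_points" "v = basis_map b x" by blast
  have "x $ i = of_int \<lfloor>x $ i\<rfloor>" for i using x(1) by (simp add: int_points_def of_int_floor)
  then have "v = (\<Sum>i\<in>UNIV. of_int \<lfloor>x $ i\<rfloor> *\<^sub>R b i)" using x(2) unfolding basis_map_def by simp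
  then show "v \<in> lattice_of b" unfolding lattice_of_def by (intro range_eqI)
qed

lemma span_int_points: "span int_points = UNIV"
proof -
  have "x \<in> span int_points" for x :: "real^'n"
  proof -
    have "(\<Sum>i\<in>UNIV. x $ i *\<^sub>R axis i 1) \<in> span int_points"
      by (intro span_sum span_scale span_base) (simp add: int_points_def axis_def)
    then show ?thesis using basis_expansion[of x] by (simp add: scalar_mult_eq_scaleR)
  qed
  then show ?thesis by blast
qed

lemma finite_int_points: "finite (int_points \<inter> cball (0::real^'n::finite) r)"
proof -
  let ?F = "PiE (UNIV::'n set) (\<lambda>_. {- \<lceil>r\<rceil>..\<lceil>r\<rceil>})"
  have "int_points \<inter> cball 0 r \<subseteq> (\<lambda>f. \<chi> i. of_int (f i)) ` ?F"
  proof
    fix x :: "real^'n" assume x: "x \<in> int_points \<inter> cball 0 r"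
    have "x $ i = of_int \<lfloor>x $ i\<rfloor>" for i using x by (simp add: int_points_def of_int_floor)
    moreover have "\<lfloor>x $ i\<rfloor> \<in> {- \<lceil>r\<rceil>..\<lceil>r\<rceil>}" for i
    proof -
      have "\<bar>x $ i\<bar> \<le> r" using x component_le_norm_cart[of x i] by auto
      then have "x $ i \<le> r" "- r \<le> x $ i" by auto
      then show ?thesis by (simp add: le_floor_iff) linarith
    qed
    ultimately show "x \<in> (\<lambda>f. \<chi> i. of_int (f i)) ` ?F"
      by (intro image_eqI[of _ _ "\<lambda>i. \<lfloor>x $ i\<rfloor>"]) (auto simp: vec_eq_iff)
  qed
  moreover have "finite ?F" by (intro finite_PiE) auto
  ultimately show ?thesis using finite_surj by blast
qed

lemma full_lattice_lattice_of:
  assumes "lin_indep_family b" shows "full_lattice (lattice_of b)"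
proof
  note lin = linear_basis_map[of b]
  show "0 \<in> lattice_of b"
    unfolding lattice_of_eq using linear_0[OF lin] by (intro image_eqI[of _ _ 0]) (auto simp: int_points_def)
  show "x - y \<in> lattice_of b" if xy: "x \<in> lattice_of b" "y \<in> lattice_of b" for x y
  proof -
    obtain u v where uv: "u \<in> int_points" "v \<in> int_points" "x = basis_map b u" "y = basis_map b v"
      using xy unfolding lattice_of_eq by blast
    have "u - v \<in> int_points" using uv(1,2) by (simp add: int_points_def)
    then show ?thesis unfolding lattice_of_eq using uv(3,4) linear_diff[OF lin, of u v]
      by (intro image_eqI[of _ _ "u - v"]) simp_all
  qed
  show "finite (lattice_of b \<inter> cball 0 r)" for r
  proof -
    obtain B where B: "B > 0" "\<And>x. B * norm x \<le> norm (basis_map b x)"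
      using linear_inj_bounded_below_pos[OF lin bij_is_inj[OF bij_basis_map[OF assms]]] by blast
    have "lattice_of b \<inter> cball 0 r \<subseteq> basis_map b ` (int_points \<inter> cball 0 (r / B))"
    proof
      fix v assume v: "v \<in> lattice_of b \<inter> cball 0 r"
      then obtain x where x: "x \<in> int_points" "v = basis_map b x" unfolding lattice_of_eq by blast
      have "B * norm x \<le> r" using B(2)[of x] v x(2) by simp
      then have "norm x \<le> r / B" using B(1) by (simp add: pos_le_divide_eq mult.commute)
      then show "v \<in> basis_map b ` (int_points \<inter> cball 0 (r / B))" using x by simp
    qed
    then show ?thesis using finite_int_points finite_surj by blast
  qed
  have "span (lattice_of b) = basis_map b ` UNIV"
    unfolding lattice_of_eq using linear_span_image[OF lin, of int_points] by (simp add: span_int_points)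
  then show "span (lattice_of b) = UNIV" using bij_is_surj[OF bij_basis_map[OF assms]] by simp
qed

lemma qval_gram:
  "qval (gram b + t *\<^sub>R rank_one_form b e) x = qe e t (basis_map b x)"
proof -
  have 1: "basis_map b x \<bullet> basis_map b x = (\<Sum>i\<in>UNIV. \<Sum>j\<in>UNIV. x $ i * (x $ j * (b i \<bullet> b j)))"
    unfolding basis_map_def by (simp add: inner_sum_left inner_sum_right sum_distrib_left inner_commute mult.left_commute)
  have "e \<bullet> basis_map b x = (\<Sum>i\<in>UNIV. x $ i * (e \<bullet> b i))"
    unfolding basis_map_def by (simp add: inner_sum_right)
  then have 2: "(e \<bullet> basis_map b x)\<^sup>2 = (\<Sum>i\<in>UNIV. \<Sum>j\<in>UNIV. (x $ i * (e \<bullet> b i)) * (x $ j * (e \<bullet> b j)))"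
    by (simp add: power2_eq_square sum_product)
  have "qval (gram b + t *\<^sub>R rank_one_form b e) x =
     (\<Sum>i\<in>UNIV. \<Sum>j\<in>UNIV. x $ i * ((b i \<bullet> b j + t * ((e \<bullet> b i) * (e \<bullet> b j))) * x $ j))"
    unfolding qval_def inner_vec_def matrix_vector_mult_def gram_def rank_one_form_def
    by (simp add: sum_distrib_left)
  also have "\<dots> = basis_map b x \<bullet> basis_map b x + t * (e \<bullet> basis_map b x)\<^sup>2"
    unfolding 1 2 by (simp add: sum_distrib_left sum.distrib[symmetric] algebra_simps)
  finally show ?thesis by (simp add: qe_def)
qed

lemma pos_def_gram:
  assumes "lin_indep_family b" "0 \<le> t"
  shows "pos_def_form (gram b + t *\<^sub>R rank_one_form b e)"
proof -
  have "0 < qval (gram b + t *\<^sub>R rank_one_form b e) x" if "x \<noteq> 0" for x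
  proof -
    have "basis_map b x \<noteq> 0"
      using that linear_injective_0[OF linear_basis_map] bij_is_inj[OF bij_basis_map[OF assms(1)]] by blast
    then have "0 < basis_map b x \<bullet> basis_map b x" by simp
    then show ?thesis unfolding qval_gram qe_def using assms(2) by (simp add: add_pos_nonneg)
  qed
  moreover have "transpose (gram b + t *\<^sub>R rank_one_form b e) = gram b + t *\<^sub>R rank_one_form b e"
    by (simp add: transpose_def gram_def rank_one_form_def vec_eq_iff inner_commute)
  ultimately show ?thesis by (simp add: pos_def_form_def)
qed

lemma qval_diff:
  assumes "transpose Q = Q"
  shows "qval Q (z - c) = qval Q z - (2 *\<^sub>R (Q *v c)) \<bullet> z + qval Q c"
proof -
  have "c \<bullet> (Q *v z) = (Q *v c) \<bullet> z"
    using dot_lmul_matrix[of c Q z] matrix_transpose_mul assms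
    by (metis transpose_matrix_vector)
  then show ?thesis unfolding qval_def
    by (simp add: matrix_vector_mult_diff_distrib inner_diff_left inner_diff_right inner_commute)
qed

lemma delaunay_form_eq:
  fixes Q :: "real^'n::finite^'n"
  assumes Q: "pos_def_form Q"
  shows "delaunay_form Q = (hull) convex ` dcells int_points (qval Q)"
proof -
  have sym: "transpose Q = Q" using Q by (simp add: pos_def_form_def)
  have inj: "inj ((*v) Q)"
  proof -
    have "x = 0" if "Q *v x = 0" for x
      using Q that unfolding pos_def_form_def qval_def by fastforce
    then show ?thesis using linear_injective_0[OF matrix_vector_mul_linear] by blast
  qed
  have surj: "surj ((*v) Q)" using linear_injective_imp_surjective[OF matrix_vector_mul_linear inj] by simp
  have full: "aff_dim (convex hull X) = int CARD('n) \<longleftrightarrow> affine hull X = UNIV" for X :: "(real^'n) set"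
    using aff_dim_eq_full[of "convex hull X"] by (simp add: affine_hull_convex_hull)
  show ?thesis
  proof (intro set_eqI iffI)
    fix P assume "P \<in> delaunay_form Q"
    then obtain c r where c: "\<forall>z\<in>int_points. r \<le> qval Q (z - c)"
      "P = convex hull {z\<in>int_points. qval Q (z - c) = r}" "aff_dim P = int CARD('n)"
      unfolding delaunay_form_def by blast
    let ?m = "2 *\<^sub>R (Q *v c)" and ?k = "r - qval Q c"
    let ?Z = "{z\<in>int_points. qval Q z = ?m \<bullet> z + ?k}"
    have "?Z = {z\<in>int_points. qval Q (z - c) = r}" unfolding qval_diff[OF sym] by auto
    moreover have "\<forall>z\<in>int_points. ?m \<bullet> z + ?k \<le> qval Q z" using c(1) unfolding qval_diff[OF sym] by auto
    moreover have "P = convex hull ?Z" using c(2) calculation(1) by simp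
    moreover have "affine hull ?Z = UNIV" using c(3) calculation(3) full[of ?Z] by simp
    ultimately have "?Z \<in> dcells int_points (qval Q)" "P = convex hull ?Z"
      unfolding dcells_def by blast+
    then show "P \<in> (hull) convex ` dcells int_points (qval Q)" by blast
  next
    fix P assume "P \<in> (hull) convex ` dcells int_points (qval Q)"
    then obtain m k Z where Z: "\<forall>z\<in>int_points. m \<bullet> z + k \<le> qval Q z" "Z = {z\<in>int_points. qval Q z = m \<bullet> z + k}"
      "affine hull Z = UNIV" "P = convex hull Z" unfolding dcells_def by blast
    \<comment> \<open>A positive definite \<open>Q\<close> is invertible, so every affine minorant
      comes from an empty ellipsoid, whose centre is \<open>c\<close>.\<close>
    obtain c where c: "m /\<^sub>R 2 = Q *v c" using surj by (metis surjD)
    then have m: "m = 2 *\<^sub>R (Q *v c)" by (metis scaleR_half_double scaleR_scaleR scaleR_one divide_inverse mult_1 right_inverse zero_neq_numeral)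
    let ?r = "k + qval Q c"
    have "Z = {z\<in>int_points. qval Q (z - c) = ?r}" using Z(2) unfolding qval_diff[OF sym] m by auto
    moreover have "\<forall>z\<in>int_points. ?r \<le> qval Q (z - c)" using Z(1) unfolding qval_diff[OF sym] m by auto
    ultimately show "P \<in> delaunay_form Q" using Z(3,4) full[of Z] unfolding delaunay_form_def by auto
  qed
qed

text \<open>The domain speaks of polytopes in coefficient space. The basis map carries them to the
  lattice, and \<open>inj_convex_hull_dcells\<close> recovers the cells from them.\<close>

lemma Ltype_iff_dcells:
  fixes b :: "'n::finite \<Rightarrow> real^'n"
  assumes b: "lin_indep_family b" and e: "norm e = 1" and t: "0 \<le> t"
  shows "gram b + t *\<^sub>R rank_one_form b e \<in> Ltype_domain (gram b) \<longleftrightarrow>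
    dcells (lattice_of b) (qe e t) = dcells (lattice_of b) (qe e 0)"
proof -
  let ?L = "lattice_of b" and ?T = "basis_map b"
  interpret L: full_lattice ?L by (rule full_lattice_lattice_of[OF b])
  interpret L: lattice_direction ?L e by unfold_locales (rule e)
  let ?g = "\<lambda>t. gram b + t *\<^sub>R rank_one_form b e"
  have image: "(`) ?T ` delaunay_form (?g s) = (hull) convex ` dcells ?L (qe e s)" if "0 \<le> s" for s
  proof -
    have q: "qval (?g s) = qe e s \<circ> ?T" by (rule ext) (simp add: qval_gram)
    have "(`) ?T ` delaunay_form (?g s) = (\<lambda>Z. ?T ` (convex hull Z)) ` dcells int_points (qe e s \<circ> ?T)"
      unfolding delaunay_form_eq[OF pos_def_gram[OF b that]] q by (simp add: image_image)
    also have "\<dots> = (\<lambda>Z. convex hull (?T ` Z)) ` dcells int_points (qe e s \<circ> ?T)"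
      by (simp add: convex_hull_linear_image[OF linear_basis_map])
    also have "\<dots> = (hull) convex ` dcells ?L (qe e s)"
      unfolding lattice_of_eq dcells_image[OF linear_basis_map bij_basis_map[OF b]] by (simp add: image_image)
    finally show ?thesis .
  qed
  have inj: "inj ((`) ?T)" using bij_is_inj[OF bij_basis_map[OF b]] by (meson inj_def inj_image_eq_iff)
  have "delaunay_form (?g t) = delaunay_form (?g 0) \<longleftrightarrow>
      (hull) convex ` dcells ?L (qe e t) = (hull) convex ` dcells ?L (qe e 0)"
    by (simp only: image[OF t, symmetric] image[OF order_refl, symmetric] inj_image_eq_iff[OF inj])
  also have "\<dots> \<longleftrightarrow> dcells ?L (qe e t) = dcells ?L (qe e 0)"
  proof
    assume eq: "(hull) convex ` dcells ?L (qe e t) = (hull) convex ` dcells ?L (qe e 0)"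
    have "dcells ?L (qe e s) \<subseteq> dcells ?L (qe e s')"
      if s: "0 \<le> s" "0 \<le> s'" and eq: "(hull) convex ` dcells ?L (qe e s) = (hull) convex ` dcells ?L (qe e s')" for s s'
    proof
      fix Z assume Z: "Z \<in> dcells ?L (qe e s)"
      then have "convex hull Z \<in> (hull) convex ` dcells ?L (qe e s')" using eq by blast
      then obtain Z' where Z': "Z' \<in> dcells ?L (qe e s')" "convex hull Z = convex hull Z'" by blast
      then have "Z = Z'" using L.inj_convex_hull_dcells[OF s(1) Z s(2)] by blast
      then show "Z \<in> dcells ?L (qe e s')" using Z' by simp
    qed
    then show "dcells ?L (qe e t) = dcells ?L (qe e 0)" using eq t by (intro subset_antisym) auto
  qed simp
  finally show ?thesis using pos_def_gram[OF b t] by (simp add: Ltype_domain_def)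
qed

theorem theorem1:
  fixes b :: "'n::finite \<Rightarrow> real^'n" and H :: "(real^'n) set" and e :: "real^'n"
  assumes basis: "lin_indep_family b"
    and H_hyp: "subspace H" "dim H = CARD('n) - 1"
    and H_span: "span (lattice_of b \<inter> H) = H"
    and e_unit: "norm e = 1"
    and e_orth: "\<forall>x\<in>H. e \<bullet> x = 0"
  shows "(lamina (lattice_of b) H \<longleftrightarrow> has_closed_zone (voronoi (lattice_of b)) e)
       \<and> (has_closed_zone (voronoi (lattice_of b)) e \<longleftrightarrow>
            (\<forall>\<epsilon>>0. same_Ltype (extend \<epsilon> e ` lattice_of b) (lattice_of b)))
       \<and> ((\<forall>\<epsilon>>0. same_Ltype (extend \<epsilon> e ` lattice_of b) (lattice_of b)) \<longleftrightarrow>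
            (\<forall>t\<ge>0. gram b + t *\<^sub>R rank_one_form b e \<in> Ltype_domain (gram b)))"
proof -
  have "e \<noteq> 0" using e_unit by auto
  then have "H = {x. e \<bullet> x = 0}"
    using subspace_dim_equal[OF H_hyp(1) subspace_hyperplane[of e]] e_orth H_hyp(2) by (simp add: dim_hyperplane subset_iff)
  then interpret lattice_hyperplane "lattice_of b" e
    rewrites "{x. e \<bullet> x = 0} = H"
    using full_lattice_lattice_of[OF basis] e_unit H_span
    by (auto simp: lattice_hyperplane_def lattice_direction_def lattice_direction_axioms_def lattice_hyperplane_axioms_def)
  have "(\<forall>t\<ge>0. gram b + t *\<^sub>R rank_one_form b e \<in> Ltype_domain (gram b)) \<longleftrightarrow>
      (\<forall>t\<ge>0. dcells (lattice_of b) (qe e t) = dcells (lattice_of b) (qe e 0))"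
    using Ltype_iff_dcells[OF basis e_unit] by blast
  then show ?thesis using lamina_iff_closed_zone lamina_iff_dcells same_Ltype_iff_dcells by blast
qed

end
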